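(* Let $0<\lambda,\alpha<1$, let $\Omega_\alpha\subset(0,1)$ be a closed Ahlfors $\alpha$-regular subset (with the Euclidean metric), equipped with the $\alpha$-dimensional Hausdorff measure $\mathcal H^\alpha$, and let $T_\lambda:L_\infty(0,1)\rightarrow L_1(\Omega_\alpha,\mathcal H^\alpha)$ be the operator $$T_\lambda f(t)=\int_0^1 \frac{f(u)}{|t-u|^\lambda}\, du,\qquad t\in\Omega_\alpha .$$ Then $$V(T_\lambda)=\Big\{\Big(x\,,\,\frac{1}{\alpha}(x-1+\lambda)\Big):1-\lambda<x<\min\Big\{1,\frac{1-\lambda}{1-\alpha}\Big\}\Big\}.$$
   Context: $(0,1)$ carries Lebesgue measure. A metric space $(X,d)$ is Ahlfors $Q$-regular ($Q>0$) if its Hausdorff dimension equals $Q$ and there are constants $c,C>0$ such that $c r^Q\le\mathcal H^Q(B(x,r))\le C r^Q$ for all $x\in X$ and all $0<r\le \mathrm{diam}(X)$, where $B(x,r)=\{y\in X:d(x,y)<r\}$ and $\mathcal H^Q$ is the $Q$-dimensional Hausdorff measure, $\mathcal H^Q(E)=\lim_{\delta\to0}\inf\{\sum_i|A_i|^Q:E\subset\bigcup_{i=1}^\infty A_i,\ 0<|A_i|\le\delta\}$, $|A|$ being the diameter of $A$. Operators are bounded and linear. An operator between Banach spaces is strictly singular if its restriction to any closed infinite-dimensional subspace is not an isomorphism onto its image. For an operator $T:L_\infty(0,1)\to L_1(\Omega_\alpha,\mathcal H^\alpha)$ and $1<p,q<\infty$, $T$ is said to be a bounded (resp. compact, strictly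 singular) operator $L_p(0,1)\to L_q(\Omega_\alpha,\mathcal H^\alpha)$ if it extends from the dense subspace $L_\infty(0,1)$ to such an operator. $S(T)$ (resp. $K(T)$) is the set of points $(\frac1p,\frac1q)\in(0,1)\times(0,1)$ such that $T:L_p(0,1)\to L_q(\Omega_\alpha,\mathcal H^\alpha)$ is strictly singular (resp. compact), and $V(T)=S(T)\setminus K(T)$. *)

theory Defs
  imports "HOL-Analysis.Analysis"
begin

text \<open>The library's \<open>diameter\<close> is meaningless on unbounded sets, hence the explicit boundedness.\<close>

definition hausdorff_content :: "real \<Rightarrow> real \<Rightarrow> 'a::metric_space set \<Rightarrow> ennreal" where
  "hausdorff_content Q \<delta> E =
     (INF A \<in> {A :: nat \<Rightarrow> 'a set. E \<subseteq> (\<Union>i. A i) \<and>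
                 (\<forall>i. bounded (A i) \<and> 0 < diameter (A i) \<and> diameter (A i) \<le> \<delta>)}.
        \<Sum>i. ennreal (diameter (A i) powr Q))"

definition hausdorff_outer :: "real \<Rightarrow> 'a::metric_space set \<Rightarrow> ennreal" where
  "hausdorff_outer Q E = Lim (at_right 0) (\<lambda>\<delta>. hausdorff_content Q \<delta> E)"

text \<open>\<open>measure_of\<close> silently gives the null measure if its argument is not countably additive;
  here it is, on the real line, because Hausdorff outer measure is a metric outer measure and Borel
  sets are therefore Caratheodory measurable.\<close>

definition hausdorff_measure :: "real \<Rightarrow> 'a::metric_space set \<Rightarrow> 'a measure" where
  "hausdorff_measure Q X = measure_of X (sets (restrict_space borel X)) (hausdorff_outer Q)"

definition hausdorff_dim :: "'a::metric_space set \<Rightarrow> ennreal" where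
  "hausdorff_dim E = (INF s \<in> {s :: real. 0 < s \<and> hausdorff_outer s E = 0}. ennreal s)"

text \<open>An unbounded set has infinite diameter, so it imposes no upper bound on the radii.\<close>

definition ahlfors_regular :: "real \<Rightarrow> 'a::metric_space set \<Rightarrow> bool" where
  "ahlfors_regular Q X \<longleftrightarrow> hausdorff_dim X = ennreal Q \<and>
     (\<exists>c>0. \<exists>C>0. \<forall>x\<in>X. \<forall>r>0. (bounded X \<longrightarrow> r \<le> diameter X) \<longrightarrow>
        ennreal (c * r powr Q) \<le> hausdorff_outer Q (X \<inter> ball x r) \<and>
        hausdorff_outer Q (X \<inter> ball x r) \<le> ennreal (C * r powr Q))"

text \<open>The space \<open>L\<^sub>p\<close> depends on a measure and a real exponent, so it cannot be a type in the class of
  normed vector spaces; normed spaces are therefore records with an explicit carrier.\<close>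

record 'v nspace =
  vcarrier :: "'v set"
  vzero :: 'v
  vadd :: "'v \<Rightarrow> 'v \<Rightarrow> 'v"
  vscale :: "real \<Rightarrow> 'v \<Rightarrow> 'v"
  vnorm :: "'v \<Rightarrow> real"

text \<open>The value off the carrier is irrelevant; it is fixed because \<open>Metric_space\<close> demands a
  nonnegative symmetric distance on the whole type.\<close>

definition vdist :: "'v nspace \<Rightarrow> 'v \<Rightarrow> 'v \<Rightarrow> real" where
  "vdist X x y =
     (if x \<in> vcarrier X \<and> y \<in> vcarrier X then vnorm X (vadd X x (vscale X (-1) y)) else 0)"

definition vtopology :: "'v nspace \<Rightarrow> 'v topology" where
  "vtopology X = Metric_space.mtopology (vcarrier X) (vdist X)"

definition vsubspace :: "'v nspace \<Rightarrow> 'v set \<Rightarrow> bool" where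
  "vsubspace X E \<longleftrightarrow> E \<subseteq> vcarrier X \<and> vzero X \<in> E \<and>
     (\<forall>x\<in>E. \<forall>y\<in>E. vadd X x y \<in> E) \<and> (\<forall>a. \<forall>x\<in>E. vscale X a x \<in> E)"

text \<open>For a subset \<open>B\<close> of the carrier, \<open>vsubspace X hull B\<close> is the linear span of \<open>B\<close>.\<close>

definition infinite_dimensional :: "'v nspace \<Rightarrow> 'v set \<Rightarrow> bool" where
  "infinite_dimensional X E \<longleftrightarrow> \<not> (\<exists>B. finite B \<and> B \<subseteq> E \<and> E \<subseteq> vsubspace X hull B)"

definition bounded_operator :: "'v nspace \<Rightarrow> 'w nspace \<Rightarrow> ('v \<Rightarrow> 'w) \<Rightarrow> bool" where
  "bounded_operator X Y T \<longleftrightarrow>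
     (\<forall>x\<in>vcarrier X. T x \<in> vcarrier Y) \<and>
     (\<forall>x\<in>vcarrier X. \<forall>y\<in>vcarrier X. T (vadd X x y) = vadd Y (T x) (T y)) \<and>
     (\<forall>a. \<forall>x\<in>vcarrier X. T (vscale X a x) = vscale Y a (T x)) \<and>
     (\<exists>C. \<forall>x\<in>vcarrier X. vnorm Y (T x) \<le> C * vnorm X x)"

definition isomorphism :: "'v nspace \<Rightarrow> 'w nspace \<Rightarrow> ('v \<Rightarrow> 'w) \<Rightarrow> bool" where
  "isomorphism X Y T \<longleftrightarrow>
     bounded_operator X Y T \<and> bij_betw T (vcarrier X) (vcarrier Y) \<and>
     bounded_operator Y X (inv_into (vcarrier X) T)"

definition strictly_singular :: "'v nspace \<Rightarrow> 'w nspace \<Rightarrow> ('v \<Rightarrow> 'w) \<Rightarrow> bool" where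
  "strictly_singular X Y T \<longleftrightarrow> bounded_operator X Y T \<and>
     (\<forall>E. vsubspace X E \<and> closedin (vtopology X) E \<and> infinite_dimensional X E \<longrightarrow>
        \<not> isomorphism (X\<lparr>vcarrier := E\<rparr>) (Y\<lparr>vcarrier := T ` E\<rparr>) T)"

definition compact_operator :: "'v nspace \<Rightarrow> 'w nspace \<Rightarrow> ('v \<Rightarrow> 'w) \<Rightarrow> bool" where
  "compact_operator X Y T \<longleftrightarrow> bounded_operator X Y T \<and>
     compactin (vtopology Y)
       (vtopology Y closure_of (T ` {x \<in> vcarrier X. vnorm X x \<le> 1}))"

text \<open>Elements are classes of measurable functions modulo equality almost everywhere. A class does
  not record the exponent, so \<open>Linfty M\<close> is literally a subset of \<open>vcarrier (Lp M p)\<close> when \<open>M\<close> is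
  finite.\<close>

definition ae_class :: "'a measure \<Rightarrow> ('a \<Rightarrow> real) \<Rightarrow> ('a \<Rightarrow> real) set" where
  "ae_class M f = {g \<in> borel_measurable M. AE x in M. g x = f x}"

definition Lp :: "'a measure \<Rightarrow> real \<Rightarrow> ('a \<Rightarrow> real) set nspace" where
  "Lp M p = \<lparr>
     vcarrier = {ae_class M f | f. f \<in> borel_measurable M \<and> integrable M (\<lambda>x. \<bar>f x\<bar> powr p)},
     vzero = ae_class M (\<lambda>_. 0),
     vadd = (\<lambda>F G. \<Union>f\<in>F. \<Union>g\<in>G. ae_class M (\<lambda>x. f x + g x)),
     vscale = (\<lambda>a F. \<Union>f\<in>F. ae_class M (\<lambda>x. a * f x)),
     vnorm = (\<lambda>F. (\<integral>x. \<bar>(SOME f. f \<in> F) x\<bar> powr p \<partial>M) powr (1 / p)) \<rparr>"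

definition Linfty :: "'a measure \<Rightarrow> ('a \<Rightarrow> real) set set" where
  "Linfty M = {ae_class M f | f. f \<in> borel_measurable M \<and> (\<exists>C. AE x in M. \<bar>f x\<bar> \<le> C)}"

text \<open>The map on classes induced by a map \<open>T\<close> on functions that respects equality almost
  everywhere.\<close>

definition ae_lift ::
  "'b measure \<Rightarrow> (('a \<Rightarrow> real) \<Rightarrow> 'b \<Rightarrow> real) \<Rightarrow> ('a \<Rightarrow> real) set \<Rightarrow> ('b \<Rightarrow> real) set" where
  "ae_lift N T F = (\<Union>f\<in>F. ae_class N (T f))"

definition S_set ::
  "'a measure \<Rightarrow> 'b measure \<Rightarrow> (('a \<Rightarrow> real) set \<Rightarrow> ('b \<Rightarrow> real) set) \<Rightarrow> (real \<times> real) set" where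
  "S_set M N T = {(1 / p, 1 / q) | p q. 1 < p \<and> 1 < q \<and>
     (\<exists>U. strictly_singular (Lp M p) (Lp N q) U \<and> (\<forall>F\<in>Linfty M. U F = T F))}"

definition K_set ::
  "'a measure \<Rightarrow> 'b measure \<Rightarrow> (('a \<Rightarrow> real) set \<Rightarrow> ('b \<Rightarrow> real) set) \<Rightarrow> (real \<times> real) set" where
  "K_set M N T = {(1 / p, 1 / q) | p q. 1 < p \<and> 1 < q \<and>
     (\<exists>U. compact_operator (Lp M p) (Lp N q) U \<and> (\<forall>F\<in>Linfty M. U F = T F))}"

definition V_set ::
  "'a measure \<Rightarrow> 'b measure \<Rightarrow> (('a \<Rightarrow> real) set \<Rightarrow> ('b \<Rightarrow> real) set) \<Rightarrow> (real \<times> real) set" where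
  "V_set M N T = S_set M N T - K_set M N T"

text \<open>At \<open>u = t\<close> the integrand is 0 by the convention on division; this is a null set of \<open>u\<close>.\<close>

definition frac_integral :: "real \<Rightarrow> (real \<Rightarrow> real) \<Rightarrow> real \<Rightarrow> real" where
  "frac_integral lam f t = (\<integral>u. f u / \<bar>t - u\<bar> powr lam \<partial>lebesgue_on {0<..<1})"

end

theory Submission
  imports Defs
begin

text \<open>On the critical line \<open>\<alpha> / q = 1 / p - 1 + lam\<close> with \<open>p < q\<close> boundedness is a trace inequality of
  Hardy--Littlewood--Sobolev type. Split the kernel at distance \<open>R\<close> and \<open>f\<close> at height \<open>R powr (- 1/p)\<close>: the far
  part is uniformly bounded, the near part is estimated from \<open>L\<^sub>r\<close> to \<open>L\<^sub>r\<close> for one \<open>r\<close> on each side of \<open>p\<close>,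
  and summing over dyadic \<open>R\<close> gives the strong bound. Strictly above the line the near part has small norm as
  \<open>R\<close> tends to 0, hence compactness. Below the line, small intervals show unboundedness;
  for \<open>p \<le> (1 - \<alpha>) / (1 - lam)\<close> weighted sums of neighbourhoods of \<open>\<Omega>\<close> do.
  On the line the images of normalized small intervals stay separated, so the operator is not compact.

  It is strictly singular there because it is compact from \<open>L\<^sub>p\<close> to \<open>L\<^sub>p\<close>. On a subspace where it were an
  isomorphism into \<open>L\<^sub>q\<close> there would be unit vectors whose images are arbitrarily small in \<open>L\<^sub>p\<close>;
  these are concentrated on small sets, as are their images, so that sums of \<open>n\<close> of them
  have norm at least of order \<open>n powr (1/p)\<close> but images of order at most \<open>n powr (1/q)\<close>.\<close>

section \<open>Hausdorff measure on the line\<close>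

text \<open>Put x = 1/p. The bounds on x have three origins: x > 1 - lam because \<alpha>/q is
  positive, x < 1 because p > 1, and x < (1 - lam)/(1 - \<alpha>), that is
  \<open>1 - \<alpha> < p * (1 - lam)\<close>, because otherwise no q gives a bounded operator. On
  the line the last bound says p < q, and equally that the diagonal point (x, x) lies strictly above
  the line. One inequality thus supplies both ingredients of strict singularity: compactness from
  L_p to L_p and the gap between \<open>n powr (1/p)\<close> and \<open>n powr (1/q)\<close>. The
  bumps that refute compactness show the obstacle: normalized functions living on ever smaller sets,
  whose images do not become small. Almost disjoint functions of this kind behave like unit vectors
  of l_p and their images like unit vectors of l_q. Norm estimates for sums of n terms, each chosen
  after the previous ones, express this without extracting disjoint sequences. Of the Hausdorff
  measure the analysis sees the two-sided bounds on balls with exponent \<alpha>; those come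
  first.\<close>

definition hcost :: "real \<Rightarrow> real \<Rightarrow> real set \<Rightarrow> ennreal" where
  "hcost Q \<delta> A = (if bounded A \<and> diameter A \<le> \<delta> then ennreal (diameter A powr Q) else \<infinity>)"

lemma hcost_empty: "0 \<le> \<delta> \<Longrightarrow> hcost Q \<delta> {} = 0"
  by (simp add: hcost_def)

lemma hcost_mono: "0 \<le> Q \<Longrightarrow> A \<subseteq> B \<Longrightarrow> hcost Q \<delta> A \<le> hcost Q \<delta> B"
  unfolding hcost_def
  by (auto intro!: ennreal_leI powr_mono2 diameter_subset diameter_ge_0 bounded_subset[of B] 
      dest: diameter_subset[of A B])

text \<open>Covering sets of diameter zero, which the content forbids, are enlarged to pairs of tiny diameter.\<close>

lemma hausdorff_content_le_cover:
  fixes A :: "nat \<Rightarrow> real set"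
  assumes Q: "0 < Q" and \<delta>: "0 < \<delta>" and E: "E \<subseteq> (\<Union>i. A i)"
  shows "hausdorff_content Q \<delta> E \<le> (\<Sum>i. hcost Q \<delta> (A i))"
proof (cases "\<forall>i. bounded (A i) \<and> diameter (A i) \<le> \<delta>")
  case False
  then obtain i where "\<not> (bounded (A i) \<and> diameter (A i) \<le> \<delta>)" by auto
  then have i: "hcost Q \<delta> (A i) = \<infinity>" by (simp add: hcost_def)
  have "hcost Q \<delta> (A i) \<le> (\<Sum>i. hcost Q \<delta> (A i))"
    using sum_le_suminf[of "\<lambda>i. hcost Q \<delta> (A i)" "{i}"] by (auto simp: summableI)
  then show ?thesis using i by (simp add: top_unique)
next
  case True
  show ?thesis
  proof (rule ennreal_le_epsilon)
    fix e :: real assume e: "0 < e"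
    \<comment> \<open>The allowances \<open>e * (1/2)^Suc i\<close> add up to e; the exponent 1/Q
      turns an allowance on the cost into one on the diameter.\<close>
    define d where "d i = min \<delta> ((e * (1/2)^Suc i) powr (1/Q))" for i
    have d: "0 < d i" "d i \<le> \<delta>" "d i powr Q \<le> e * (1/2)^Suc i" for i
    proof -
      show "0 < d i" "d i \<le> \<delta>" using e \<delta> by (auto simp: d_def)
      have "d i powr Q \<le> ((e * (1/2)^Suc i) powr (1/Q)) powr Q"
        using \<open>0 < d i\<close> Q by (intro powr_mono2) (auto simp: d_def)
      also have "\<dots> = e * (1/2)^Suc i" using e Q by (simp add: powr_powr)
      finally show "d i powr Q \<le> e * (1/2)^Suc i" .
    qed
    \<comment> \<open>\<open>diameter {}\<close> is 0 as well, so empty members must also be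
      replaced; any pair of the right diameter will do, as there is nothing to cover.\<close>
    define B where "B i = (if diameter (A i) > 0 then A i else if A i = {} then {0, d i}
       else {SOME x. x \<in> A i, (SOME x. x \<in> A i) + d i})" for i
    have pair: "diameter {x, x + d i} = d i" for x i
    proof (rule antisym)
      show "diameter {x, x + d i} \<le> d i"
        using d(1)[of i] by (intro diameter_le) (auto simp: dist_real_def)
      show "d i \<le> diameter {x, x + d i}"
        using diameter_bounded_bound[of "{x, x + d i}" x "x + d i"] d(1)[of i]
        by (simp add: dist_real_def)
    qed
    have pair0: "diameter {0, d i} = d i" for i using pair[of 0 i] by simp
    have AB: "A i \<subseteq> B i" for i
    proof (cases "diameter (A i) > 0 \<or> A i = {}")
      case False
      have "x = y" if "x \<in> A i" "y \<in> A i" for x y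
      proof -
        have "dist x y \<le> 0"
          using diameter_bounded_bound[OF conjunct1[OF spec[OF True, of i]] that] False
          by linarith
        then show ?thesis by simp
      qed
      moreover have "(SOME x. x \<in> A i) \<in> A i" using False some_in_eq by blast
      ultimately show ?thesis using False by (auto simp: B_def)
    qed (auto simp: B_def)
    have B: "bounded (B i)" "0 < diameter (B i)" "diameter (B i) \<le> \<delta>" for i
      using True d pair pair0 by (auto simp: B_def)
    have Bc: "ennreal (diameter (B i) powr Q) \<le> hcost Q \<delta> (A i) + ennreal (e * (1/2)^Suc i)" for i
    proof (cases "diameter (A i) > 0")
      case True then show ?thesis using \<open>\<forall>i. _ i\<close> by (simp add: B_def hcost_def)
    next
      case False
      then have "diameter (B i) = d i" using pair pair0 by (auto simp: B_def)
      then show ?thesis using d(3)[of i] by (auto intro!: add_increasing ennreal_leI)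
    qed
    have "hausdorff_content Q \<delta> E \<le> (\<Sum>i. ennreal (diameter (B i) powr Q))"
      unfolding hausdorff_content_def
      using B E AB by (intro INF_lower) (auto, blast)
    also have "\<dots> \<le> (\<Sum>i. hcost Q \<delta> (A i) + ennreal (e * (1/2)^Suc i))"
      by (intro suminf_le Bc) (auto simp: summableI)
    also have "\<dots> = (\<Sum>i. hcost Q \<delta> (A i)) + (\<Sum>i. ennreal (e * (1/2)^Suc i))"
      by (rule suminf_add[symmetric]) auto
    also have "(\<Sum>i. ennreal (e * (1/2)^Suc i)) = ennreal e"
    proof (rule suminf_ennreal_eq)
      show "(\<lambda>i. e * (1/2)^Suc i) sums e"
        using sums_mult[OF power_half_series, of e] by simp
    qed (use e in auto)
    finally show "hausdorff_content Q \<delta> E \<le> (\<Sum>i. hcost Q \<delta> (A i)) + ennreal e" .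
  qed
qed

text \<open>\<open>hcost\<close> moves the admissibility of a covering set into its cost, with value
  \<infinity> for unbounded or too large sets. It is then an increasing function of all sets, zero
  on the empty set, so the content is the outer measure it generates and countable subadditivity
  comes from the general theory.\<close>

lemma hausdorff_content_eq_outer_measure:
  fixes E :: "real set"
  assumes Q: "0 < Q" and \<delta>: "0 < \<delta>"
  shows "hausdorff_content Q \<delta> E = outer_measure (Pow UNIV) (hcost Q \<delta>) E"
proof (rule antisym)
  show "hausdorff_content Q \<delta> E \<le> outer_measure (Pow UNIV) (hcost Q \<delta>) E"
    unfolding outer_measure_def
    by (intro INF_greatest hausdorff_content_le_cover Q \<delta>) auto
  interpret ring_of_sets UNIV "Pow UNIV :: real set set"
    by (intro algebra.axioms(1) algebra_Pow)
  have *: "positive (Pow UNIV) (hcost Q \<delta>)" "increasing (Pow UNIV) (hcost Q \<delta>)"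
    using Q \<delta> by (auto simp: positive_def increasing_def hcost_empty intro: hcost_mono)
  show "outer_measure (Pow UNIV) (hcost Q \<delta>) E \<le> hausdorff_content Q \<delta> E"
    unfolding hausdorff_content_def
  proof (rule INF_greatest)
    fix A :: "nat \<Rightarrow> real set"
    assume A: "A \<in> {A. E \<subseteq> (\<Union>i. A i) \<and> (\<forall>i. bounded (A i) \<and> 0 < diameter (A i) \<and> diameter (A i) \<le> \<delta>)}"
    then have "outer_measure (Pow UNIV) (hcost Q \<delta>) E \<le> (\<Sum>i. hcost Q \<delta> (A i))"
      by (intro outer_measure_le *) auto
    then show "outer_measure (Pow UNIV) (hcost Q \<delta>) E \<le> (\<Sum>i. ennreal (diameter (A i) powr Q))"
      using A by (simp add: hcost_def)
  qed
qed

lemma outer_measure_space_hausdorff_content: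
  assumes Q: "0 < Q" and \<delta>: "0 < \<delta>"
  shows "outer_measure_space (Pow UNIV) (hausdorff_content Q \<delta> :: real set \<Rightarrow> ennreal)"
proof -
  interpret ring_of_sets UNIV "Pow UNIV :: real set set"
    by (intro algebra.axioms(1) algebra_Pow)
  have *: "positive (Pow UNIV) (hcost Q \<delta>)" "increasing (Pow UNIV) (hcost Q \<delta>)"
    using Q \<delta> by (auto simp: positive_def increasing_def hcost_empty intro: hcost_mono)
  have "hausdorff_content Q \<delta> = outer_measure (Pow UNIV) (hcost Q \<delta>)"
    using hausdorff_content_eq_outer_measure[OF Q \<delta>] by auto
  with outer_measure_space_outer_measure[OF *] show ?thesis by simp
qed

lemma hausdorff_content_antimono:
  "\<delta> \<le> \<delta>' \<Longrightarrow> hausdorff_content Q \<delta>' E \<le> hausdorff_content Q \<delta> E"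
  unfolding hausdorff_content_def by (intro INF_superset_mono) (auto intro: order_trans)

text \<open>Shrinking \<delta> discards covers, so the content increases and its limit exists as a
  supremum; without existence \<open>Lim\<close> would carry no information. In this form the outer
  measure inherits the properties of the contents scale by scale.\<close>

lemma hausdorff_outer_eq_SUP:
  "hausdorff_outer Q E = (SUP \<delta>\<in>{0<..}. hausdorff_content Q \<delta> E)"
  unfolding hausdorff_outer_def
proof (rule tendsto_Lim)
  show "((\<lambda>\<delta>. hausdorff_content Q \<delta> E) \<longlongrightarrow> (SUP \<delta>\<in>{0<..}. hausdorff_content Q \<delta> E)) (at_right 0)"
  proof (rule increasing_tendsto)
    show "\<forall>\<^sub>F \<delta> in at_right 0. hausdorff_content Q \<delta> E \<le> (SUP \<delta>\<in>{0<..}. hausdorff_content Q \<delta> E)"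
      unfolding eventually_at_right_field by (rule exI[of _ 1]) (auto intro!: SUP_upper)
    fix x assume "x < (SUP \<delta>\<in>{0<..}. hausdorff_content Q \<delta> E)"
    then obtain d where "0 < d" "x < hausdorff_content Q d E" by (auto simp: less_SUP_iff)
    then show "\<forall>\<^sub>F \<delta> in at_right 0. x < hausdorff_content Q \<delta> E"
      unfolding eventually_at_right_field
      by (intro exI[of _ d]) (auto elim!: less_le_trans intro: hausdorff_content_antimono)
  qed
qed simp

lemma hausdorff_content_le_outer: "0 < \<delta> \<Longrightarrow> hausdorff_content Q \<delta> E \<le> hausdorff_outer Q E"
  unfolding hausdorff_outer_eq_SUP by (auto intro: SUP_upper)

lemma hausdorff_outer_mono:
  fixes E :: "real set" assumes "0 < Q" "E \<subseteq> F"
  shows "hausdorff_outer Q E \<le> hausdorff_outer Q F"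
  unfolding hausdorff_outer_eq_SUP
proof (intro SUP_mono bexI)
  fix \<delta> :: real assume "\<delta> \<in> {0<..}"
  then show "hausdorff_content Q \<delta> E \<le> hausdorff_content Q \<delta> F"
    using outer_measure_space_hausdorff_content[of Q \<delta>] assms
    by (auto simp: outer_measure_space_def increasing_def)
qed

section \<open>Caratheodory measurability of half-lines and Borel sets\<close>

lemma outer_measure_space_hausdorff_outer:
  assumes Q: "0 < Q"
  shows "outer_measure_space (Pow UNIV) (hausdorff_outer Q :: real set \<Rightarrow> ennreal)"
  unfolding outer_measure_space_def
proof (intro conjI)
  note oms = outer_measure_space_hausdorff_content[OF Q, unfolded outer_measure_space_def]
  show "positive (Pow UNIV) (hausdorff_outer Q :: real set \<Rightarrow> ennreal)"
    using oms by (auto simp: positive_def hausdorff_outer_eq_SUP)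
  show "increasing (Pow UNIV) (hausdorff_outer Q :: real set \<Rightarrow> ennreal)"
    using Q by (auto simp: increasing_def intro: hausdorff_outer_mono)
  show "countably_subadditive (Pow UNIV) (hausdorff_outer Q :: real set \<Rightarrow> ennreal)"
    unfolding countably_subadditive_def
  proof (intro allI impI)
    fix A :: "nat \<Rightarrow> real set" assume A: "disjoint_family A"
    show "hausdorff_outer Q (\<Union>i. A i) \<le> (\<Sum>i. hausdorff_outer Q (A i))"
      unfolding hausdorff_outer_eq_SUP[of _ "\<Union>i. A i"]
    proof (rule SUP_least)
      fix \<delta> :: real assume "\<delta> \<in> {0<..}"
      then have "hausdorff_content Q \<delta> (\<Union>i. A i) \<le> (\<Sum>i. hausdorff_content Q \<delta> (A i))"
        using oms[of \<delta>] A by (auto simp: countably_subadditive_def)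
      also have "\<dots> \<le> (\<Sum>i. hausdorff_outer Q (A i))"
        using \<open>\<delta> \<in> _\<close> by (intro suminf_le hausdorff_content_le_outer) auto
      finally show "hausdorff_content Q \<delta> (\<Union>i. A i) \<le> (\<Sum>i. hausdorff_outer Q (A i))" .
    qed
  qed
qed

text \<open>On the line all covering sets that straddle a point can be replaced, at cost \<open>2 \<delta> powr Q\<close>,
  by the two intervals of length \<open>\<delta>\<close> that end there.\<close>

lemma hausdorff_content_split_atMost:
  fixes E :: "real set"
  assumes Q: "0 < Q" and \<delta>: "0 < \<delta>"
  shows "hausdorff_content Q \<delta> (E \<inter> {..a}) + hausdorff_content Q \<delta> (E - {..a})
    \<le> hausdorff_content Q \<delta> E + ennreal (2 * \<delta> powr Q)"
proof -
  \<comment> \<open>The part of E in a half-line H is covered by those A i that lie inside H,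
    together with one extra set I that catches what the other A i have in H.\<close>
  have one: "hausdorff_content Q \<delta> (E \<inter> H) \<le> ennreal (\<delta> powr Q) + 
      (\<Sum>i. if A i \<subseteq> H then hcost Q \<delta> (A i) else 0)"
    if I: "diameter I = \<delta>" "bounded I" and cov: "E \<subseteq> (\<Union>i. A i)" 
      and st: "\<And>i. \<not> A i \<subseteq> H \<Longrightarrow> A i \<inter> H \<subseteq> I" for A :: "nat \<Rightarrow> real set" and H I
  proof -
    define B where "B i = (case i of 0 \<Rightarrow> I | Suc i \<Rightarrow> if A i \<subseteq> H then A i else {})" for i
    have "x \<in> (\<Union>i. B i)" if "x \<in> E \<inter> H" for x
    proof -
      from that cov obtain i where "x \<in> A i" by auto
      then have "x \<in> B (Suc i) \<or> x \<in> B 0" using st[of i] that by (auto simp: B_def)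
      then show ?thesis by blast
    qed
    then have "hausdorff_content Q \<delta> (E \<inter> H) \<le> (\<Sum>i. hcost Q \<delta> (B i))"
      by (intro hausdorff_content_le_cover Q \<delta>) blast
    also have "(\<lambda>i. hcost Q \<delta> (B i)) sums ((\<Sum>i. hcost Q \<delta> (B (Suc i))) + hcost Q \<delta> (B 0))"
      by (intro sums_Suc summable_sums) auto
    then have "(\<Sum>i. hcost Q \<delta> (B i)) = (\<Sum>i. hcost Q \<delta> (B (Suc i))) + hcost Q \<delta> (B 0)"
      by (rule sums_unique[symmetric])
    also have "(\<lambda>i. hcost Q \<delta> (B (Suc i))) = (\<lambda>i. if A i \<subseteq> H then hcost Q \<delta> (A i) else 0)"
      using \<delta> by (auto simp: B_def hcost_empty)
    also have "hcost Q \<delta> (B 0) = ennreal (\<delta> powr Q)" using I by (simp add: B_def hcost_def)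
    finally show ?thesis by (simp add: add.commute)
  qed
  have "hausdorff_content Q \<delta> (E \<inter> {..a}) + hausdorff_content Q \<delta> (E - {..a}) \<le>
      (\<Sum>i. ennreal (diameter (A i) powr Q)) + ennreal (2 * \<delta> powr Q)"
    if A: "E \<subseteq> (\<Union>i. A i)" "\<And>i. bounded (A i)" "\<And>i. 0 < diameter (A i)" "\<And>i. diameter (A i) \<le> \<delta>" 
    for A :: "nat \<Rightarrow> real set"
  proof -
    have d: "\<bar>x - y\<bar> \<le> \<delta>" if "x \<in> A i" "y \<in> A i" for x y i
      using diameter_bounded_bound[OF A(2) that] A(4)[of i] by (simp add: dist_real_def)
    have 1: "hausdorff_content Q \<delta> (E \<inter> {..a}) \<le> ennreal (\<delta> powr Q) + 
      (\<Sum>i. if A i \<subseteq> {..a} then hcost Q \<delta> (A i) else 0)"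
    proof (rule one[of "{a-\<delta>..a}"])
      show "A i \<inter> {..a} \<subseteq> {a-\<delta>..a}" if n: "\<not> A i \<subseteq> {..a}" for i
      proof
        fix x assume x: "x \<in> A i \<inter> {..a}"
        from n obtain y where "y \<in> A i" "y > a" by (auto simp: not_le subset_iff)
        then show "x \<in> {a-\<delta>..a}" using d[of x i y] x by auto
      qed
    qed (use \<delta> A in auto)
    have 2: "hausdorff_content Q \<delta> (E \<inter> {a<..}) \<le> ennreal (\<delta> powr Q) + 
      (\<Sum>i. if A i \<subseteq> {a<..} then hcost Q \<delta> (A i) else 0)"
    proof (rule one[of "{a..a+\<delta>}"])
      show "A i \<inter> {a<..} \<subseteq> {a..a+\<delta>}" if n: "\<not> A i \<subseteq> {a<..}" for i
      proof
        fix x assume x: "x \<in> A i \<inter> {a<..}"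
        from n obtain y where "y \<in> A i" "y \<le> a" by (auto simp: not_less subset_iff)
        then show "x \<in> {a..a+\<delta>}" using d[of x i y] x by auto
      qed
    qed (use \<delta> A in auto)
    have E: "E - {..a} = E \<inter> {a<..}" by auto
    have "(\<Sum>i. if A i \<subseteq> {..a} then hcost Q \<delta> (A i) else 0) + (\<Sum>i. if A i \<subseteq> {a<..} then hcost Q \<delta> (A i) else 0)
       = (\<Sum>i. (if A i \<subseteq> {..a} then hcost Q \<delta> (A i) else 0) + (if A i \<subseteq> {a<..} then hcost Q \<delta> (A i) else 0))"
      by (rule suminf_add) auto
    also have "\<dots> \<le> (\<Sum>i. ennreal (diameter (A i) powr Q))"
    proof (rule suminf_le)
      fix i
      \<comment> \<open>Positive diameter excludes the empty set, the one set contained in both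
        half-lines; hence no cost is charged twice.\<close>
      have "A i \<noteq> {}" using A(3)[of i] by auto
      then have "\<not> (A i \<subseteq> {..a} \<and> A i \<subseteq> {a<..})" by force
      then show "(if A i \<subseteq> {..a} then hcost Q \<delta> (A i) else 0) + (if A i \<subseteq> {a<..} then hcost Q \<delta> (A i) else 0)
         \<le> ennreal (diameter (A i) powr Q)" using A by (auto simp: hcost_def)
    qed auto
    finally have 3: "(\<Sum>i. if A i \<subseteq> {..a} then hcost Q \<delta> (A i) else 0) + (\<Sum>i. if A i \<subseteq> {a<..} then hcost Q \<delta> (A i) else 0)
       \<le> (\<Sum>i. ennreal (diameter (A i) powr Q))" .
    have "ennreal (2 * \<delta> powr Q) = ennreal (\<delta> powr Q) + ennreal (\<delta> powr Q)"
      by (subst ennreal_plus[symmetric]) auto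
    then show ?thesis unfolding E
      by (intro order_trans[OF add_mono[OF 1 2]]) (use add_right_mono[OF 3, of "ennreal (2 * \<delta> powr Q)"] in \<open>simp add: ac_simps\<close>)
  qed
  then have "hausdorff_content Q \<delta> (E \<inter> {..a}) + hausdorff_content Q \<delta> (E - {..a}) - ennreal (2 * \<delta> powr Q)
      \<le> hausdorff_content Q \<delta> E"
    unfolding hausdorff_content_def[of _ _ E]
    by (intro INF_greatest) (auto simp: ennreal_minus_le_iff add.commute)
  then show ?thesis by (auto simp: ennreal_minus_le_iff add.commute)
qed

text \<open>The splitting error \<open>2 * \<delta> powr Q\<close> tends to 0 because Q is positive,
  so in the limit nothing is lost at the point a. Half-lines suffice: they generate the Borel sets,
  and the Caratheodory sets form a sigma-algebra.\<close>

lemma atMost_hausdorff_measurable: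
  assumes Q: "0 < Q"
  shows "{..a} \<in> lambda_system UNIV (Pow UNIV) (hausdorff_outer Q :: real set \<Rightarrow> ennreal)"
  unfolding algebra.lambda_system_eq[OF algebra_Pow]
proof (intro CollectI conjI ballI antisym)
  fix E :: "real set"
  let ?H = "hausdorff_outer Q :: real set \<Rightarrow> ennreal"
  show "?H (E \<inter> {..a}) + ?H (E - {..a}) \<le> ?H E"
  proof (rule ennreal_le_epsilon)
    fix e :: real assume e: "0 < e"
    define d0 where "d0 = (e/2) powr (1/Q)"
    have d0: "0 < d0" "2 * d0 powr Q = e" using e Q by (auto simp: d0_def powr_powr)
    have *: "hausdorff_content Q d1 (E \<inter> {..a}) + hausdorff_content Q d2 (E - {..a}) \<le> ?H E + ennreal e"
      if d: "d1 \<in> {0<..}" "d2 \<in> {0<..}" for d1 d2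
    proof -
      \<comment> \<open>The two suprema run over independent scales d1 and d2. Passing to a common
        smaller scale only increases both contents, and d0 keeps the splitting error at most
        e.\<close>
      define d where "d = min d0 (min d1 d2)"
      have d': "0 < d" "d \<le> d1" "d \<le> d2" "d \<le> d0" using d d0 by (auto simp: d_def)
      have "hausdorff_content Q d1 (E \<inter> {..a}) + hausdorff_content Q d2 (E - {..a})
        \<le> hausdorff_content Q d (E \<inter> {..a}) + hausdorff_content Q d (E - {..a})"
        by (intro add_mono hausdorff_content_antimono d')
      also have "\<dots> \<le> hausdorff_content Q d E + ennreal (2 * d powr Q)"
        by (rule hausdorff_content_split_atMost[OF Q d'(1)])
      also have "\<dots> \<le> ?H E + ennreal e"
        using powr_mono2[of Q d d0] d' Q d0(2) by (intro add_mono hausdorff_content_le_outer ennreal_leI) auto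
      finally show "hausdorff_content Q d1 (E \<inter> {..a}) + hausdorff_content Q d2 (E - {..a}) \<le> ?H E + ennreal e" .
    qed
    have ne: "{0::real<..} \<noteq> {}" by simp
    let ?A = "\<lambda>d. hausdorff_content Q d (E \<inter> {..a})" and ?B = "\<lambda>d. hausdorff_content Q d (E - {..a})"
    have "?H (E \<inter> {..a}) + ?H (E - {..a}) = (SUP d1\<in>{0<..}. ?A d1 + ?H (E - {..a}))"
      unfolding hausdorff_outer_eq_SUP[of Q "E \<inter> {..a}"] by (rule ennreal_SUP_add_left[OF ne, symmetric])
    also have "\<dots> \<le> ?H E + ennreal e"
    proof (rule SUP_least)
      fix d1 :: real assume d1: "d1 \<in> {0<..}"
      have "?A d1 + ?H (E - {..a}) = (SUP d2\<in>{0<..}. ?A d1 + ?B d2)"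
        unfolding hausdorff_outer_eq_SUP[of Q "E - {..a}"] by (rule ennreal_SUP_add_right[OF ne])
      also have "\<dots> \<le> ?H E + ennreal e"
        by (rule SUP_least) (rule *[OF d1])
      finally show "?A d1 + ?H (E - {..a}) \<le> ?H E + ennreal e" .
    qed
    finally show "?H (E \<inter> {..a}) + ?H (E - {..a}) \<le> ?H E + ennreal e" .
  qed
  have "subadditive (Pow UNIV) ?H"
    using outer_measure_space_hausdorff_outer[OF Q]
    by (intro ring_of_sets.countably_subadditive_subadditive[OF algebra.axioms(1)[OF algebra_Pow]])
       (auto simp: outer_measure_space_def)
  from subadditiveD[OF this, of "E \<inter> {..a}" "E - {..a}"]
  have "?H ((E \<inter> {..a}) \<union> (E - {..a})) \<le> ?H (E \<inter> {..a}) + ?H (E - {..a})" by auto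
  moreover have "(E \<inter> {..a}) \<union> (E - {..a}) = E" by auto
  ultimately show "?H E \<le> ?H (E \<inter> {..a}) + ?H (E - {..a})" by simp
qed auto

lemma measure_space_hausdorff_outer:
  assumes Q: "0 < Q"
  shows "measure_space UNIV (sets borel) (hausdorff_outer Q :: real set \<Rightarrow> ennreal)"
proof -
  let ?H = "hausdorff_outer Q :: real set \<Rightarrow> ennreal"
  have ms: "measure_space UNIV (lambda_system UNIV (Pow UNIV) ?H) ?H"
    by (intro sigma_algebra.caratheodory_lemma sigma_algebra_Pow outer_measure_space_hausdorff_outer Q)
  then interpret sigma_algebra UNIV "lambda_system UNIV (Pow UNIV) ?H" by (simp add: measure_space_def)
  have "sets borel = sigma_sets UNIV (range (\<lambda>a::real. {..a}))"
    unfolding borel_eq_atMost by simp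
  also have "\<dots> \<subseteq> lambda_system UNIV (Pow UNIV) ?H"
    by (intro sigma_sets_subset) (intro image_subsetI atMost_hausdorff_measurable[OF Q])
  finally have "sets borel \<subseteq> lambda_system UNIV (Pow UNIV) ?H" .
  then show ?thesis using ms sets.sigma_algebra_axioms[of borel] by (intro measure_down[OF ms]) auto
qed

lemma space_hausdorff_measure [simp]: 
  fixes X :: "real set" shows "space (hausdorff_measure Q X) = X"
  using sets.space_closed[of "restrict_space borel X"]
  by (auto simp: hausdorff_measure_def space_measure_of_conv space_restrict_space)

lemma sets_hausdorff_measure [measurable_cong]: 
  fixes X :: "real set" shows "sets (hausdorff_measure Q X) = sets (restrict_space borel X)"
proof -
  have *: "sets (restrict_space borel X) \<subseteq> Pow X"
    using sets.space_closed[of "restrict_space borel X"] by (simp add: space_restrict_space)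
  have "sigma_algebra X (sets (restrict_space borel X))"
    using sets.sigma_algebra_axioms[of "restrict_space borel X"] by (simp add: space_restrict_space)
  from sigma_algebra.sigma_sets_eq[OF this] show ?thesis
    unfolding hausdorff_measure_def sets_measure_of[OF *] .
qed

text \<open>Countable additivity of the outer measure on Borel sets is what keeps
  \<open>measure_of\<close> from collapsing to the null measure.\<close>

lemma emeasure_hausdorff_measure:
  fixes X :: "real set"
  assumes Q: "0 < Q" and X: "X \<in> sets borel" and A: "A \<in> sets borel" "A \<subseteq> X"
  shows "emeasure (hausdorff_measure Q X) A = hausdorff_outer Q A"
proof (rule emeasure_measure_of[OF hausdorff_measure_def])
  have s: "sets (restrict_space borel X) \<subseteq> sets borel"
    using X by (auto simp: sets_restrict_space)
  show "sets (restrict_space borel X) \<subseteq> Pow X" 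
    using sets.space_closed[of "restrict_space borel X"] by (simp add: space_restrict_space)
  have m: "positive (sets borel) (hausdorff_outer Q :: real set \<Rightarrow> ennreal)" 
     "countably_additive (sets borel) (hausdorff_outer Q :: real set \<Rightarrow> ennreal)"
    using measure_space_hausdorff_outer[OF Q] by (auto simp: measure_space_def)
  show "positive (sets (hausdorff_measure Q X)) (hausdorff_outer Q)"
    using m s by (auto simp: positive_def)
  show "countably_additive (sets (hausdorff_measure Q X)) (hausdorff_outer Q)"
    using m(2) s unfolding countably_additive_def sets_hausdorff_measure by (meson subset_trans subsetD)
  show "A \<in> sets (hausdorff_measure Q X)"
    using A X by (auto simp: sets_hausdorff_measure sets_restrict_space_iff)
qed

section \<open>From Ahlfors regularity to uniform bounds on balls\<close>

lemma hausdorff_outer_subset_singleton: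
  fixes X :: "real set"
  assumes Q: "0 < Q" and X: "X \<subseteq> {a}"
  shows "hausdorff_outer Q X = 0"
proof -
  have "hausdorff_content Q \<delta> X = 0" if "0 < \<delta>" for \<delta>
  proof -
    have "X \<subseteq> (\<Union>i::nat. {a})" using X by auto
    from hausdorff_content_le_cover[OF Q that this]
    show ?thesis using that by (simp add: hcost_def)
  qed
  then show ?thesis by (simp add: hausdorff_outer_eq_SUP)
qed

text \<open>Regularity speaks of centres in X and radii up to the diameter. The kernel estimates
  need the upper bound around arbitrary points and for all radii, and the lower bound up to radius
  1; both follow at the price of worse constants.\<close>

lemma ahlfors_regular_bounds:
  fixes X :: "real set"
  assumes Q: "0 < Q" and X: "X \<subseteq> {0<..<1}" "X \<in> sets borel" and reg: "ahlfors_regular Q X"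
  obtains c C where "X \<noteq> {}" "0 < c" "0 < C"
    "\<And>t r. 0 < r \<Longrightarrow> emeasure (hausdorff_measure Q X) (X \<inter> ball t r) \<le> ennreal (C * r powr Q)"
    "\<And>t r. t \<in> X \<Longrightarrow> 0 < r \<Longrightarrow> r \<le> 1 \<Longrightarrow> ennreal (c * r powr Q) \<le> emeasure (hausdorff_measure Q X) (X \<inter> ball t r)"
proof -
  let ?m = "hausdorff_measure Q X"
  have bd: "bounded X" by (rule bounded_subset[OF bounded_closed_interval[of 0 "1::real"]]) (use X(1) in auto)
  define D where "D = diameter X"
  have "norm (x - y) \<le> 1" if "x \<in> X" "y \<in> X" for x y
    using subsetD[OF X(1) that(1)] subsetD[OF X(1) that(2)] by (simp add: abs_le_iff)
  then have D1: "D \<le> 1" unfolding D_def by (intro diameter_le) auto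
  \<comment> \<open>A set with at most one point is null in every positive dimension, so its
    dimension would be at most Q/2, against the dimension clause of regularity.\<close>
  have D0: "0 < D"
  proof (rule ccontr)
    assume "\<not> 0 < D"
    then have "dist x y \<le> 0" if "x \<in> X" "y \<in> X" for x y
      using diameter_bounded_bound[OF bd that] \<open>\<not> 0 < D\<close> unfolding D_def by linarith
    then obtain a where "X \<subseteq> {a}" by (cases "X = {}") auto
    then have "hausdorff_outer (Q/2) X = 0" using Q by (intro hausdorff_outer_subset_singleton) auto
    then have "hausdorff_dim X \<le> ennreal (Q/2)"
      unfolding hausdorff_dim_def using Q by (intro INF_lower) auto
    then show False using reg Q by (simp add: ahlfors_regular_def ennreal_le_iff)
  qed
  have ne: "X \<noteq> {}" using D0 by (auto simp: D_def)
  from reg obtain c C where c: "0 < c" "0 < C" and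
    *: "\<And>x r. x \<in> X \<Longrightarrow> 0 < r \<Longrightarrow> r \<le> D \<Longrightarrow> ennreal (c * r powr Q) \<le> hausdorff_outer Q (X \<inter> ball x r) \<and>
        hausdorff_outer Q (X \<inter> ball x r) \<le> ennreal (C * r powr Q)"
    unfolding ahlfors_regular_def D_def by blast
  have em: "emeasure ?m (X \<inter> ball x r) = hausdorff_outer Q (X \<inter> ball x r)" for x r
    using X by (intro emeasure_hausdorff_measure Q) auto
  have S: "X \<inter> ball x r \<in> sets ?m" for x r
    using X by (auto simp: sets_hausdorff_measure sets_restrict_space_iff)
  have lo: "ennreal (c * r powr Q) \<le> emeasure ?m (X \<inter> ball x r)" 
    and up: "emeasure ?m (X \<inter> ball x r) \<le> ennreal (C * r powr Q)" if "x \<in> X" "0 < r" "r \<le> D" for x r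
    using *[OF that] by (auto simp: em)
  \<comment> \<open>Balls are open, so the ball of radius D around z may miss points at distance
    exactly D. On the line these can only be z - D and z + D, and each gets a ball of its own; hence
    the factor 3.\<close>
  have tot: "emeasure ?m X \<le> ennreal (3 * C * D powr Q)"
  proof -
    obtain z where z: "z \<in> X" using ne by auto
    define z1 where "z1 = (if z - D \<in> X then z - D else z)"
    define z2 where "z2 = (if z + D \<in> X then z + D else z)"
    have zz: "z1 \<in> X" "z2 \<in> X" using z by (auto simp: z1_def z2_def)
    have "X \<subseteq> (X \<inter> ball z D) \<union> (X \<inter> ball z1 D) \<union> (X \<inter> ball z2 D)"
    proof
      fix y assume y: "y \<in> X"
      then have "dist z y \<le> D" using diameter_bounded_bound[OF bd z y] by (simp add: D_def)
      then have "dist z y < D \<or> y = z - D \<or> y = z + D" by (auto simp: dist_real_def abs_if split: if_splits)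
      then show "y \<in> (X \<inter> ball z D) \<union> (X \<inter> ball z1 D) \<union> (X \<inter> ball z2 D)"
        using y D0 by (auto simp: z1_def z2_def)
    qed
    then have "emeasure ?m X \<le> emeasure ?m ((X \<inter> ball z D) \<union> (X \<inter> ball z1 D) \<union> (X \<inter> ball z2 D))"
      by (intro emeasure_mono) (auto intro!: S sets.Un)
    also have "\<dots> \<le> emeasure ?m ((X \<inter> ball z D) \<union> (X \<inter> ball z1 D)) + emeasure ?m (X \<inter> ball z2 D)"
      by (intro emeasure_subadditive S sets.Un)
    also have "\<dots> \<le> emeasure ?m (X \<inter> ball z D) + emeasure ?m (X \<inter> ball z1 D) + emeasure ?m (X \<inter> ball z2 D)"
      by (intro add_right_mono emeasure_subadditive S)
    also have "\<dots> \<le> ennreal (C * D powr Q) + ennreal (C * D powr Q) + ennreal (C * D powr Q)"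
      using z zz D0 by (intro add_mono up) auto
    also have "\<dots> = ennreal (3 * C * D powr Q)"
      using c by (simp flip: ennreal_plus)
    finally show ?thesis .
  qed
  \<comment> \<open>A ball that meets X at z lies in the ball of twice the radius around z, which
    costs \<open>2 powr Q\<close>; radii beyond D/2 are handled by the total mass.\<close>
  have UP: "emeasure ?m (X \<inter> ball t r) \<le> ennreal (3 * C * 2 powr Q * r powr Q)" if r: "0 < r" for t r
  proof (cases "X \<inter> ball t r = {}")
    case False
    then obtain z where z: "z \<in> X" "dist t z < r" by auto
    show ?thesis
    proof (cases "2 * r \<le> D")
      case True
      have "emeasure ?m (X \<inter> ball t r) \<le> emeasure ?m (X \<inter> ball z (2 * r))"
        using z by (intro emeasure_mono S) (auto simp: dist_real_def)
      also have "\<dots> \<le> ennreal (C * (2 * r) powr Q)" using True r z by (intro up) auto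
      also have "\<dots> \<le> ennreal (3 * C * 2 powr Q * r powr Q)"
        using c r by (intro ennreal_leI) (simp add: powr_mult)
      finally show ?thesis .
    next
      case False
      have "emeasure ?m (X \<inter> ball t r) \<le> emeasure ?m X"
        using sets.top[of ?m] by (intro emeasure_mono) auto
      also note tot
      also have "ennreal (3 * C * D powr Q) \<le> ennreal (3 * C * (2 * r) powr Q)"
        using False c D0 Q by (intro ennreal_leI mult_left_mono powr_mono2) auto
      finally show ?thesis using r by (simp add: powr_mult mult.assoc)
    qed
  qed (use c in auto)
  have LO: "ennreal (c * D powr Q * r powr Q) \<le> emeasure ?m (X \<inter> ball t r)" if "t \<in> X" "0 < r" "r \<le> 1" for t r
  proof -
    have rD: "r * D \<le> D" "r * D \<le> r" using that D0 D1 by (auto simp: mult_le_cancel_left1 mult_le_cancel_right1)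
    have "ennreal (c * D powr Q * r powr Q) = ennreal (c * (r * D) powr Q)"
      using that D0 by (simp add: powr_mult ac_simps)
    also have "\<dots> \<le> emeasure ?m (X \<inter> ball t (r * D))" using that D0 rD by (intro lo) auto
    also have "\<dots> \<le> emeasure ?m (X \<inter> ball t r)"
      using rD by (intro emeasure_mono S) auto
    finally show ?thesis .
  qed
  show ?thesis
    by (rule that[OF ne _ _ UP LO]) (use c D0 in auto)
qed

section \<open>Spaces of p-integrable functions\<close>

text \<open>Estimates are made for functions: \<open>Lfun M p\<close> collects the representatives
  of the vectors of \<open>Lp M p\<close>, and \<open>pnorm\<close> is the value of
  \<open>vnorm\<close> on any of them. Classes return when an operator statement is
  assembled.\<close>

definition Lfun :: "'a measure \<Rightarrow> real \<Rightarrow> ('a \<Rightarrow> real) set" where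
  "Lfun M p = {f \<in> borel_measurable M. integrable M (\<lambda>x. \<bar>f x\<bar> powr p)}"

definition pnorm :: "'a measure \<Rightarrow> real \<Rightarrow> ('a \<Rightarrow> real) \<Rightarrow> real" where
  "pnorm M p f = (\<integral>x. \<bar>f x\<bar> powr p \<partial>M) powr (1 / p)"

lemma LfunD [dest]:
  "f \<in> Lfun M p \<Longrightarrow> f \<in> borel_measurable M" "f \<in> Lfun M p \<Longrightarrow> integrable M (\<lambda>x. \<bar>f x\<bar> powr p)"
  by (auto simp: Lfun_def)

lemma pnorm_nonneg [simp]: "0 \<le> pnorm M p f"
  by (simp add: pnorm_def)

lemma pnorm_powr: 
  assumes "p > 0" shows "pnorm M p f powr p = (\<integral>x. \<bar>f x\<bar> powr p \<partial>M)"
  using assms by (simp add: pnorm_def powr_powr)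

lemma pnorm_le_iff:
  assumes "p > 0" "0 \<le> c" shows "pnorm M p f \<le> c \<longleftrightarrow> (\<integral>x. \<bar>f x\<bar> powr p \<partial>M) \<le> c powr p"
  unfolding pnorm_powr[OF assms(1), symmetric]
  using assms powr_mono2[of p "pnorm M p f" c] powr_less_mono2[of p c "pnorm M p f"] pnorm_nonneg[of M p f]
  by linarith

lemma nn_integral_pnorm:
  assumes "p > 0" "f \<in> Lfun M p"
  shows "(\<integral>\<^sup>+x. ennreal (\<bar>f x\<bar> powr p) \<partial>M) = ennreal (pnorm M p f powr p)"
  using assms LfunD(2)[OF assms(2)] by (subst nn_integral_eq_integral) (auto simp: pnorm_powr)

text \<open>A bound on the extended nonnegative integral yields membership and norm at once, with no
  separate proof of integrability.\<close>

lemma Lfun_pnorm_leI: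
  assumes p: "p > 0" and [measurable]: "f \<in> borel_measurable M" and c: "0 \<le> c"
    and le: "(\<integral>\<^sup>+x. ennreal (\<bar>f x\<bar> powr p) \<partial>M) \<le> ennreal (c powr p)"
  shows "f \<in> Lfun M p" "pnorm M p f \<le> c"
proof -
  have i: "integrable M (\<lambda>x. \<bar>f x\<bar> powr p)"
    using le by (intro integrableI_nonneg) (auto simp: less_top[symmetric] top_unique)
  then show L: "f \<in> Lfun M p" by (simp add: Lfun_def)
  show "pnorm M p f \<le> c"
    using le c nn_integral_pnorm[OF p L] p by (simp add: pnorm_le_iff pnorm_powr ennreal_le_iff)
qed

section \<open>Convexity of powers and Minkowski's inequality\<close>

lemma convex_combination_powr:
  fixes u v s t :: real
  assumes "p \<ge> 1" "0 \<le> u" "0 \<le> v" "0 \<le> s" "0 \<le> t" "s + t = 1"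
  shows "(s * u + t * v) powr p \<le> s * u powr p + t * v powr p"
proof -
  \<comment> \<open>Convexity is applied to positive arguments. If u or v is 0, only a factor
    \<open>t powr p\<close> or \<open>s powr p\<close> is left, and it is compared with t or s by
    this inequality.\<close>
  have pw: "r powr p \<le> r" if "0 \<le> r" "r \<le> 1" for r :: real
    using powr_mono_both'[of 1 p r r] that assms(1) by (cases "r = 0") auto
  show ?thesis
  proof (cases "u = 0 \<or> v = 0")
    case True
    then show ?thesis
    proof
      assume "u = 0"
      then have "(s * u + t * v) powr p = t powr p * v powr p" using assms by (simp add: powr_mult)
      also have "\<dots> \<le> t * v powr p" using assms by (intro mult_right_mono pw) auto
      finally show ?thesis using \<open>u = 0\<close> by simp
    next
      assume "v = 0"
      then have "(s * u + t * v) powr p = s powr p * u powr p" using assms by (simp add: powr_mult)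
      also have "\<dots> \<le> s * u powr p" using assms by (intro mult_right_mono pw) auto
      finally show ?thesis using \<open>v = 0\<close> by simp
    qed
  next
    case False
    have s: "s = 1 - t" using assms by simp
    show ?thesis unfolding s
      using convex_onD[OF powr_convex[OF assms(1)], of t u v] assms False by simp
  qed
qed

lemma powr_add_le:
  fixes u v :: real
  assumes "p \<ge> 1" "0 \<le> u" "0 \<le> v"
  shows "(u + v) powr p \<le> 2 powr p * (u powr p + v powr p)"
proof -
  have "(u + v) powr p \<le> (2 * max u v) powr p" using assms by (intro powr_mono2) auto
  also have "\<dots> = 2 powr p * (max u v) powr p" using assms by (simp add: powr_mult)
  also have "\<dots> \<le> 2 powr p * (u powr p + v powr p)"
    by (intro mult_left_mono) (auto simp: max_def)
  finally show ?thesis .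
qed

lemma Lfun_add:
  assumes p: "p \<ge> 1" and f: "f \<in> Lfun M p" and g: "g \<in> Lfun M p"
  shows "(\<lambda>x. f x + g x) \<in> Lfun M p"
proof -
  note [measurable] = LfunD(1)[OF f] LfunD(1)[OF g]
  have "integrable M (\<lambda>x. \<bar>f x + g x\<bar> powr p)"
  proof (rule Bochner_Integration.integrable_bound)
    show "integrable M (\<lambda>x. 2 powr p * (\<bar>f x\<bar> powr p + \<bar>g x\<bar> powr p))" using f g by auto
    show "AE x in M. norm (\<bar>f x + g x\<bar> powr p) \<le> norm (2 powr p * (\<bar>f x\<bar> powr p + \<bar>g x\<bar> powr p))"
    proof (rule AE_I2)
      fix x
      have "\<bar>f x + g x\<bar> powr p \<le> (\<bar>f x\<bar> + \<bar>g x\<bar>) powr p" using p by (intro powr_mono2) auto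
      also have "\<dots> \<le> 2 powr p * (\<bar>f x\<bar> powr p + \<bar>g x\<bar> powr p)" using p by (intro powr_add_le) auto
      finally show "norm (\<bar>f x + g x\<bar> powr p) \<le> norm (2 powr p * (\<bar>f x\<bar> powr p + \<bar>g x\<bar> powr p))" by simp
    qed
  qed auto
  then show ?thesis by (simp add: Lfun_def)
qed

lemma Lfun_scale:
  assumes f: "f \<in> Lfun M p"
  shows "(\<lambda>x. a * f x) \<in> Lfun M p"
  using f by (auto simp: Lfun_def abs_mult powr_mult)

lemma Lfun_diff:
  assumes p: "p \<ge> 1" and f: "f \<in> Lfun M p" and g: "g \<in> Lfun M p"
  shows "(\<lambda>x. f x - g x) \<in> Lfun M p"
  using Lfun_add[OF p f Lfun_scale[OF g, of "-1"]] by simp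

lemma pnorm_scale:
  assumes "p > 0" shows "pnorm M p (\<lambda>x. a * f x) = \<bar>a\<bar> * pnorm M p f"
  using assms by (simp add: pnorm_def abs_mult powr_mult powr_powr)

lemma pnorm_cong_AE:
  assumes "f \<in> borel_measurable M" "g \<in> borel_measurable M" "AE x in M. f x = g x"
  shows "pnorm M p f = pnorm M p g"
proof -
  have "(\<integral>x. \<bar>f x\<bar> powr p \<partial>M) = (\<integral>x. \<bar>g x\<bar> powr p \<partial>M)"
    using assms by (intro integral_cong_AE) auto
  then show ?thesis by (simp add: pnorm_def)
qed

lemma Lfun_cong_AE:
  assumes "f \<in> Lfun M p" "g \<in> borel_measurable M" "AE x in M. f x = g x"
  shows "g \<in> Lfun M p"
proof -
  have "integrable M (\<lambda>x. \<bar>g x\<bar> powr p)"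
  proof (rule integrable_cong_AE_imp[OF LfunD(2)[OF assms(1)]])
    show "AE x in M. \<bar>f x\<bar> powr p = \<bar>g x\<bar> powr p" using assms(3) by eventually_elim auto
  qed (use assms(2) in measurable)
  then show ?thesis using assms by (simp add: Lfun_def)
qed

lemma pnorm_eq_0_iff:
  assumes "f \<in> Lfun M p" "p > 0"
  shows "pnorm M p f = 0 \<longleftrightarrow> (AE x in M. f x = 0)"
proof -
  have "pnorm M p f = 0 \<longleftrightarrow> (\<integral>x. \<bar>f x\<bar> powr p \<partial>M) = 0" using assms by (auto simp: pnorm_def)
  also have "\<dots> \<longleftrightarrow> (AE x in M. \<bar>f x\<bar> powr p = 0)"
    using assms by (intro integral_nonneg_eq_0_iff_AE) auto
  finally show ?thesis by simp
qed

lemma pnorm_zero [simp]: "p > 0 \<Longrightarrow> pnorm M p (\<lambda>_. 0) = 0"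
  by (simp add: pnorm_def)

lemma pnorm_mono:
  assumes p: "p > 0" and f: "f \<in> borel_measurable M" and g: "g \<in> Lfun M p"
    and le: "AE x in M. \<bar>f x\<bar> \<le> \<bar>g x\<bar>"
  shows "f \<in> Lfun M p" "pnorm M p f \<le> pnorm M p g"
proof -
  have le': "AE x in M. \<bar>f x\<bar> powr p \<le> \<bar>g x\<bar> powr p"
    using le by eventually_elim (use p in \<open>auto intro: powr_mono2\<close>)
  have "integrable M (\<lambda>x. \<bar>f x\<bar> powr p)"
    by (rule Bochner_Integration.integrable_bound[OF LfunD(2)[OF g]]) (use f le' in auto)
  then show F: "f \<in> Lfun M p" using f by (simp add: Lfun_def)
  show "pnorm M p f \<le> pnorm M p g"
    unfolding pnorm_def using F g le' p
    by (intro powr_mono2 integral_mono_AE) (auto intro: integral_nonneg)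
qed

text \<open>With a and b the two norms, |f + g| / (a + b) is at most the convex combination of |f| /
  a and |g| / b with weights a / (a + b) and b / (a + b). Both quotients have p-th powers of
  integral 1, so convexity suffices; zero norms are treated beforehand.\<close>

lemma pnorm_add_le:
  assumes p: "p \<ge> 1" and f: "f \<in> Lfun M p" and g: "g \<in> Lfun M p"
  shows "pnorm M p (\<lambda>x. f x + g x) \<le> pnorm M p f + pnorm M p g"
proof (cases "pnorm M p f = 0 \<or> pnorm M p g = 0")
  case True
  note [measurable] = LfunD(1)[OF f] LfunD(1)[OF g]
  from True show ?thesis
  proof
    assume "pnorm M p f = 0"
    then have "AE x in M. f x = 0" using f p by (simp add: pnorm_eq_0_iff)
    then have "pnorm M p (\<lambda>x. f x + g x) = pnorm M p g" by (intro pnorm_cong_AE) auto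
    then show ?thesis by simp
  next
    assume "pnorm M p g = 0"
    then have "AE x in M. g x = 0" using g p by (simp add: pnorm_eq_0_iff)
    then have "pnorm M p (\<lambda>x. f x + g x) = pnorm M p f" by (intro pnorm_cong_AE) auto
    then show ?thesis by simp
  qed
next
  case False
  define a b where "a = pnorm M p f" and "b = pnorm M p g"
  have ab: "0 < a" "0 < b" using False pnorm_nonneg[of M p] by (auto simp: a_def b_def less_le)
  define s t where "s = a / (a + b)" and "t = b / (a + b)"
  have st: "0 \<le> s" "0 \<le> t" "s + t = 1" using ab by (auto simp: s_def t_def simp flip: add_divide_distrib)
  have st': "(a + b) * s = a" "(a + b) * t = b" using ab by (auto simp: s_def t_def)
  have pt: "\<bar>f x + g x\<bar> powr p \<le> (a + b) powr p * (s * (\<bar>f x\<bar> powr p / a powr p) + t * (\<bar>g x\<bar> powr p / b powr p))" for x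
  proof -
    have "\<bar>f x\<bar> + \<bar>g x\<bar> = (a + b) * (s * (\<bar>f x\<bar> / a) + t * (\<bar>g x\<bar> / b))"
      using ab by (simp add: distrib_left mult.assoc[symmetric] st')
    then have "\<bar>f x + g x\<bar> powr p \<le> ((a + b) * (s * (\<bar>f x\<bar> / a) + t * (\<bar>g x\<bar> / b))) powr p"
      using p abs_triangle_ineq[of "f x" "g x"] by (intro powr_mono2) auto
    also have "\<dots> = (a + b) powr p * (s * (\<bar>f x\<bar> / a) + t * (\<bar>g x\<bar> / b)) powr p"
      by (rule powr_mult) 
    also have "\<dots> \<le> (a + b) powr p * (s * (\<bar>f x\<bar> / a) powr p + t * (\<bar>g x\<bar> / b) powr p)"
      using p st ab by (intro mult_left_mono convex_combination_powr) auto
    finally show ?thesis using ab by (simp add: powr_divide)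
  qed
  have I: "integrable M (\<lambda>x. \<bar>f x\<bar> powr p)" "integrable M (\<lambda>x. \<bar>g x\<bar> powr p)" using f g by auto
  have "(\<integral>x. \<bar>f x + g x\<bar> powr p \<partial>M) \<le> 
      (\<integral>x. (a + b) powr p * (s * (\<bar>f x\<bar> powr p / a powr p) + t * (\<bar>g x\<bar> powr p / b powr p)) \<partial>M)"
    using I LfunD(2)[OF Lfun_add[OF p f g]] by (intro integral_mono pt) auto
  also have "\<dots> = (a + b) powr p * (s * ((\<integral>x. \<bar>f x\<bar> powr p \<partial>M) / a powr p) + t * ((\<integral>x. \<bar>g x\<bar> powr p \<partial>M) / b powr p))"
    using I by simp
  also have "\<dots> = (a + b) powr p * (s + t)"
    using ab p by (simp add: pnorm_powr[symmetric] flip: a_def b_def)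
  finally have "(\<integral>x. \<bar>f x + g x\<bar> powr p \<partial>M) \<le> (a + b) powr p" using st by simp
  then show ?thesis using p ab unfolding a_def[symmetric] b_def[symmetric] by (subst pnorm_le_iff) auto
qed

lemma pnorm_diff_triangle:
  assumes p: "p \<ge> 1" and f: "f \<in> Lfun M p" and g: "g \<in> Lfun M p" and h: "h \<in> Lfun M p"
  shows "pnorm M p (\<lambda>x. f x - h x) \<le> pnorm M p (\<lambda>x. f x - g x) + pnorm M p (\<lambda>x. g x - h x)"
  using pnorm_add_le[OF p Lfun_diff[OF p f g] Lfun_diff[OF p g h]] by simp

lemma pnorm_minus_commute: "pnorm M p (\<lambda>x. f x - g x) = pnorm M p (\<lambda>x. g x - f x)"
proof -
  have "\<bar>f x - g x\<bar> = \<bar>g x - f x\<bar>" for x by (rule abs_minus_commute)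
  then show ?thesis by (simp only: pnorm_def)
qed

lemma Lfun_bounded:
  assumes "finite_measure M" "f \<in> borel_measurable M" "AE x in M. \<bar>f x\<bar> \<le> C" "p > 0"
  shows "f \<in> Lfun M p"
proof -
  interpret finite_measure M by fact
  have "integrable M (\<lambda>x. \<bar>f x\<bar> powr p)"
  proof (rule integrable_const_bound[where B = "C powr p"])
    show "AE x in M. norm (\<bar>f x\<bar> powr p) \<le> C powr p"
      using assms(3) by eventually_elim (use assms in \<open>auto intro: powr_mono2\<close>)
  qed (use assms in auto)
  then show ?thesis using assms by (simp add: Lfun_def)
qed

subsection \<open>Classes of functions\<close>

lemma ae_class_self: "f \<in> borel_measurable M \<Longrightarrow> f \<in> ae_class M f"
  by (simp add: ae_class_def)

lemma ae_class_eq_iff: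
  assumes "f \<in> borel_measurable M" "g \<in> borel_measurable M"
  shows "ae_class M f = ae_class M g \<longleftrightarrow> (AE x in M. f x = g x)"
proof
  assume "ae_class M f = ae_class M g"
  then have "f \<in> ae_class M g" using ae_class_self assms by auto
  then show "AE x in M. f x = g x" by (simp add: ae_class_def)
next
  assume e: "AE x in M. f x = g x"
  have "(AE x in M. h x = f x) \<longleftrightarrow> (AE x in M. h x = g x)" for h
  proof
    assume "AE x in M. h x = f x" then show "AE x in M. h x = g x" using e by eventually_elim auto
  next
    assume "AE x in M. h x = g x" then show "AE x in M. h x = f x" using e by eventually_elim auto
  qed
  then show "ae_class M f = ae_class M g" by (simp add: ae_class_def)
qed

lemma ae_classD: "g \<in> ae_class M f \<Longrightarrow> g \<in> borel_measurable M" "g \<in> ae_class M f \<Longrightarrow> AE x in M. g x = f x"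
  by (auto simp: ae_class_def)

text \<open>Operations on classes are encoded as unions over all representatives. The union
  collapses because every representative gives the same class and f itself is one of them.\<close>

lemma UN_ae_class_const:
  assumes f: "f \<in> borel_measurable M" 
    and "\<And>g. g \<in> ae_class M f \<Longrightarrow> ae_class N (H g) = ae_class N (H f)"
  shows "(\<Union>g\<in>ae_class M f. ae_class N (H g)) = ae_class N (H f)"
proof -
  have "(\<Union>g\<in>ae_class M f. ae_class N (H g)) = (\<Union>g\<in>ae_class M f. ae_class N (H f))"
    by (intro SUP_cong refl assms(2))
  also have "\<dots> = ae_class N (H f)" using ae_class_self[OF f] by blast
  finally show ?thesis .
qed

lemma vadd_Lp [simp]:
  assumes [measurable]: "f \<in> borel_measurable M" "g \<in> borel_measurable M"
  shows "vadd (Lp M p) (ae_class M f) (ae_class M g) = ae_class M (\<lambda>x. f x + g x)"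
proof -
  have eq: "ae_class M (\<lambda>x. f' x + g' x) = ae_class M (\<lambda>x. f x + g x)"
    if "f' \<in> ae_class M f" "g' \<in> ae_class M g" for f' g'
  proof -
    note [measurable] = ae_classD(1)[OF that(1)] ae_classD(1)[OF that(2)]
    have "AE x in M. f' x + g' x = f x + g x"
      using ae_classD(2)[OF that(1)] ae_classD(2)[OF that(2)] by eventually_elim auto
    then show ?thesis by (subst ae_class_eq_iff) auto
  qed
  have "vadd (Lp M p) (ae_class M f) (ae_class M g) 
     = (\<Union>f'\<in>ae_class M f. \<Union>g'\<in>ae_class M g. ae_class M (\<lambda>x. f' x + g' x))" by (simp add: Lp_def)
  also have "\<dots> = (\<Union>f'\<in>ae_class M f. \<Union>g'\<in>ae_class M g. ae_class M (\<lambda>x. f x + g x))"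
    by (intro SUP_cong refl) (rule eq)
  also have "\<dots> = ae_class M (\<lambda>x. f x + g x)"
    using ae_class_self[of f M] ae_class_self[of g M] by auto
  finally show ?thesis .
qed

lemma vscale_Lp [simp]:
  assumes [measurable]: "f \<in> borel_measurable M"
  shows "vscale (Lp M p) a (ae_class M f) = ae_class M (\<lambda>x. a * f x)"
proof -
  have eq: "ae_class M (\<lambda>x. a * f' x) = ae_class M (\<lambda>x. a * f x)" if "f' \<in> ae_class M f" for f'
  proof -
    note [measurable] = ae_classD(1)[OF that(1)]
    have "AE x in M. a * f' x = a * f x" using ae_classD(2)[OF that(1)] by eventually_elim auto
    then show ?thesis by (subst ae_class_eq_iff) auto
  qed
  have "vscale (Lp M p) a (ae_class M f) = (\<Union>f'\<in>ae_class M f. ae_class M (\<lambda>x. a * f' x))" by (simp add: Lp_def)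
  also have "\<dots> = ae_class M (\<lambda>x. a * f x)"
    by (rule UN_ae_class_const[of f M M "\<lambda>f' x. a * f' x", OF assms eq])
  finally show ?thesis .
qed

lemma vnorm_Lp [simp]:
  assumes [measurable]: "f \<in> borel_measurable M"
  shows "vnorm (Lp M p) (ae_class M f) = pnorm M p f"
proof -
  let ?g = "SOME g. g \<in> ae_class M f"
  have g: "?g \<in> ae_class M f" by (rule someI[of "\<lambda>g. g \<in> ae_class M f", OF ae_class_self[OF assms]])
  have "vnorm (Lp M p) (ae_class M f) = pnorm M p ?g" by (simp add: Lp_def pnorm_def)
  also have "\<dots> = pnorm M p f" using ae_classD[OF g] by (intro pnorm_cong_AE) auto
  finally show ?thesis .
qed

lemma vzero_Lp [simp]: "vzero (Lp M p) = ae_class M (\<lambda>_. 0)"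
  by (simp add: Lp_def)

lemma vcarrier_Lp: "vcarrier (Lp M p) = ae_class M ` Lfun M p"
  by (auto simp: Lp_def Lfun_def)

lemma ae_class_in_vcarrier_iff:
  assumes "f \<in> borel_measurable M"
  shows "ae_class M f \<in> vcarrier (Lp M p) \<longleftrightarrow> f \<in> Lfun M p"
proof
  assume "ae_class M f \<in> vcarrier (Lp M p)"
  then obtain g where g: "g \<in> Lfun M p" "ae_class M f = ae_class M g" by (auto simp: vcarrier_Lp)
  then have "AE x in M. g x = f x" using assms by (subst ae_class_eq_iff[symmetric]) auto
  then show "f \<in> Lfun M p" using Lfun_cong_AE[OF g(1) assms] by simp
qed (auto simp: vcarrier_Lp)

lemma vdist_Lp:
  assumes f: "f \<in> Lfun M p" and g: "g \<in> Lfun M p"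
  shows "vdist (Lp M p) (ae_class M f) (ae_class M g) = pnorm M p (\<lambda>x. f x - g x)"
proof -
  note [measurable] = LfunD(1)[OF f] LfunD(1)[OF g]
  show ?thesis using f g by (simp add: vdist_def ae_class_in_vcarrier_iff)
qed

section \<open>Metric structure and completeness\<close>

lemma Metric_space_Lp:
  assumes p: "p \<ge> 1"
  shows "Metric_space (vcarrier (Lp M p)) (vdist (Lp M p))"
proof
  show nn: "0 \<le> vdist (Lp M p) F G" for F G
    by (cases "F \<in> vcarrier (Lp M p) \<and> G \<in> vcarrier (Lp M p)") 
       (auto simp: vcarrier_Lp vdist_Lp, auto simp: vdist_def vcarrier_Lp)
  show "vdist (Lp M p) F G = vdist (Lp M p) G F" for F G
    by (cases "F \<in> vcarrier (Lp M p) \<and> G \<in> vcarrier (Lp M p)") 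
       (auto simp: vcarrier_Lp vdist_Lp intro: pnorm_minus_commute, auto simp: vdist_def vcarrier_Lp)
  fix F G assume "F \<in> vcarrier (Lp M p)" "G \<in> vcarrier (Lp M p)"
  then obtain f g where fg: "f \<in> Lfun M p" "F = ae_class M f" "g \<in> Lfun M p" "G = ae_class M g"
    by (auto simp: vcarrier_Lp)
  note [measurable] = LfunD(1)[OF fg(1)] LfunD(1)[OF fg(3)]
  show "vdist (Lp M p) F G = 0 \<longleftrightarrow> F = G"
    using fg p by (auto simp: vdist_Lp pnorm_eq_0_iff Lfun_diff ae_class_eq_iff)
  fix H assume "H \<in> vcarrier (Lp M p)"
  then obtain h where "h \<in> Lfun M p" "H = ae_class M h" by (auto simp: vcarrier_Lp)
  then show "vdist (Lp M p) F H \<le> vdist (Lp M p) F G + vdist (Lp M p) G H"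
    using fg p by (simp add: vdist_Lp pnorm_diff_triangle)
qed

text \<open>The rate 1/4 leaves a spare factor \<open>2^k\<close>: the p-th powers of
  \<open>2^k\<close> times the increments have a summable series of integrals, so their sum is
  finite almost everywhere, and there the increments are at most a constant times
  \<open>(1/2)^k\<close>.\<close>

lemma ex_AE_limit_of_fast_Cauchy:
  fixes f :: "nat \<Rightarrow> 'a \<Rightarrow> real"
  assumes p: "p \<ge> 1" and f: "\<And>k. f k \<in> Lfun M p"
    and fast: "\<And>k. pnorm M p (\<lambda>x. f (Suc k) x - f k x) \<le> (1/4)^k"
  obtains g where "g \<in> borel_measurable M" "AE x in M. (\<lambda>k. f k x) \<longlonglongrightarrow> g x"
proof -
  note [measurable] = LfunD(1)[OF f]
  define h where "h k x = \<bar>2^k * (f (Suc k) x - f k x)\<bar> powr p" for k x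
  have [measurable]: "h k \<in> borel_measurable M" for k unfolding h_def by measurable
  have hk: "(\<integral>\<^sup>+x. ennreal (h k x) \<partial>M) \<le> ennreal ((1/2)^k)" for k
  proof -
    have L: "(\<lambda>x. 2^k * (f (Suc k) x - f k x)) \<in> Lfun M p"
      by (intro Lfun_scale Lfun_diff p f)
    have "(\<integral>\<^sup>+x. ennreal (h k x) \<partial>M) = ennreal (pnorm M p (\<lambda>x. 2^k * (f (Suc k) x - f k x)) powr p)"
      unfolding h_def using p by (intro nn_integral_pnorm L) auto
    also have "pnorm M p (\<lambda>x. 2^k * (f (Suc k) x - f k x)) = 2^k * pnorm M p (\<lambda>x. f (Suc k) x - f k x)"
      using p by (subst pnorm_scale) auto
    also have "ennreal ((2^k * pnorm M p (\<lambda>x. f (Suc k) x - f k x)) powr p) \<le> ennreal ((1/2)^k)"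
    proof (rule ennreal_leI)
      have "2^k * pnorm M p (\<lambda>x. f (Suc k) x - f k x) \<le> 2^k * (1/4)^k"
        by (intro mult_left_mono fast) auto
      also have "\<dots> = (1/2)^k" by (simp add: power_mult_distrib[symmetric])
      finally have "(2^k * pnorm M p (\<lambda>x. f (Suc k) x - f k x)) powr p \<le> ((1/2)^k) powr p"
        using p by (intro powr_mono2) auto
      also have "\<dots> \<le> ((1/2)^k) powr 1"
        using p by (intro powr_mono') (auto simp: power_le_one)
      finally show "(2^k * pnorm M p (\<lambda>x. f (Suc k) x - f k x)) powr p \<le> (1/2)^k" by simp
    qed
    finally show ?thesis .
  qed
  have "(\<integral>\<^sup>+x. (\<Sum>k. ennreal (h k x)) \<partial>M) = (\<Sum>k. \<integral>\<^sup>+x. ennreal (h k x) \<partial>M)"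
    by (rule nn_integral_suminf) measurable
  also have "\<dots> \<le> (\<Sum>k. ennreal ((1/2)^k))" by (intro suminf_le hk) auto
  also have "\<dots> = ennreal 2" 
    using geometric_sums[of "1/2::real"] by (intro suminf_ennreal_eq) auto
  finally have "AE x in M. (\<Sum>k. ennreal (h k x)) \<noteq> \<infinity>"
    by (intro nn_integral_PInf_AE) (auto simp: top_unique)
  then have conv: "AE x in M. convergent (\<lambda>k. f k x)"
  proof eventually_elim
    case (elim x)
    define S where "S = enn2real (\<Sum>k. ennreal (h k x))"
    have S: "(\<Sum>k. ennreal (h k x)) = ennreal S"
      using elim by (simp add: S_def less_top)
    have hS: "h k x \<le> S" for k
    proof -
      have "ennreal (h k x) \<le> (\<Sum>k. ennreal (h k x))"
        using sum_le_suminf[of "\<lambda>k. ennreal (h k x)" "{k}"] by auto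
      then show ?thesis unfolding S by (simp add: ennreal_le_iff S_def)
    qed
    have bd: "\<bar>f (Suc k) x - f k x\<bar> \<le> S powr (1/p) * (1/2)^k" for k
    proof -
      have "\<bar>2^k * (f (Suc k) x - f k x)\<bar> = h k x powr (1/p)" using p by (simp add: h_def powr_powr)
      also have "\<dots> \<le> S powr (1/p)" using p hS[of k] by (intro powr_mono2) (auto simp: h_def)
      finally have le: "2^k * \<bar>f (Suc k) x - f k x\<bar> \<le> S powr (1/p)" by (simp add: abs_mult)
      have "\<bar>f (Suc k) x - f k x\<bar> = 2^k * \<bar>f (Suc k) x - f k x\<bar> * (1/2)^k" by (simp add: power_one_over)
      also have "\<dots> \<le> S powr (1/p) * (1/2)^k" by (intro mult_right_mono le) auto
      finally show ?thesis .
    qed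
    have "summable (\<lambda>k. f (Suc k) x - f k x)"
    proof (rule summable_comparison_test')
      show "summable (\<lambda>k. S powr (1/p) * (1/2)^k)" by (intro summable_mult summable_geometric) auto
      show "norm (f (Suc k) x - f k x) \<le> S powr (1/p) * (1/2)^k" if "k \<ge> 0" for k using bd[of k] by simp
    qed
    then obtain l where "(\<lambda>k. f (Suc k) x - f k x) sums l" by (auto simp: summable_def)
    then have "(\<lambda>n. f n x - f 0 x) \<longlonglongrightarrow> l"
      unfolding sums_def by (simp add: sum_lessThan_telescope[of "\<lambda>k. f k x"])
    then have "(\<lambda>n. (f n x - f 0 x) + f 0 x) \<longlonglongrightarrow> l + f 0 x" by (intro tendsto_intros)
    then show ?case by (auto simp: convergent_def)
  qed
  show ?thesis
  proof (rule that)
    show "(\<lambda>x. lim (\<lambda>k. f k x)) \<in> borel_measurable M" by measurable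
    show "AE x in M. (\<lambda>k. f k x) \<longlonglongrightarrow> lim (\<lambda>k. f k x)"
      using conv by eventually_elim (rule convergent_LIMSEQ_iff[THEN iffD1])
  qed
qed

text \<open>Fatou's lemma, which delivers integrability of the limit together with the
  bound.\<close>

lemma pnorm_limit_le:
  fixes f :: "nat \<Rightarrow> 'a \<Rightarrow> real"
  assumes p: "p \<ge> 1" and f: "\<And>k. f k \<in> Lfun M p" and g: "g \<in> borel_measurable M" 
    and lim: "AE x in M. (\<lambda>k. f k x) \<longlonglongrightarrow> g x"
    and le: "\<And>k. k \<ge> m \<Longrightarrow> pnorm M p (\<lambda>x. f k x - f m x) \<le> c"
  shows "(\<lambda>x. g x - f m x) \<in> Lfun M p" "pnorm M p (\<lambda>x. g x - f m x) \<le> c"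
proof -
  note [measurable] = LfunD(1)[OF f] g
  have c: "0 \<le> c" using le[of m] order_trans[OF pnorm_nonneg] by blast
  have "(\<integral>\<^sup>+x. ennreal (\<bar>g x - f m x\<bar> powr p) \<partial>M) = (\<integral>\<^sup>+x. liminf (\<lambda>k. ennreal (\<bar>f k x - f m x\<bar> powr p)) \<partial>M)"
  proof (rule nn_integral_cong_AE)
    show "AE x in M. ennreal (\<bar>g x - f m x\<bar> powr p) = liminf (\<lambda>k. ennreal (\<bar>f k x - f m x\<bar> powr p))"
      using lim
    proof eventually_elim
      case (elim x)
      then have "(\<lambda>k. ennreal (\<bar>f k x - f m x\<bar> powr p)) \<longlonglongrightarrow> ennreal (\<bar>g x - f m x\<bar> powr p)"
        using p by (intro tendsto_ennrealI tendsto_powr2 tendsto_intros) auto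
      then show ?case using lim_imp_Liminf[of sequentially] by fastforce
    qed
  qed
  also have "\<dots> \<le> liminf (\<lambda>k. \<integral>\<^sup>+x. ennreal (\<bar>f k x - f m x\<bar> powr p) \<partial>M)"
    by (rule nn_integral_liminf) measurable
  also have "\<dots> \<le> liminf (\<lambda>k. ennreal (c powr p))"
  proof (rule Liminf_mono)
    show "\<forall>\<^sub>F k in sequentially. (\<integral>\<^sup>+x. ennreal (\<bar>f k x - f m x\<bar> powr p) \<partial>M) \<le> ennreal (c powr p)"
      using eventually_ge_at_top[of m]
    proof eventually_elim
      case (elim k)
      have "(\<integral>\<^sup>+x. ennreal (\<bar>f k x - f m x\<bar> powr p) \<partial>M) = ennreal (pnorm M p (\<lambda>x. f k x - f m x) powr p)"
        using p by (intro nn_integral_pnorm Lfun_diff f) auto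
      also have "\<dots> \<le> ennreal (c powr p)" using le[OF elim] p by (intro ennreal_leI powr_mono2) auto
      finally show ?case .
    qed
  qed
  also have "\<dots> = ennreal (c powr p)" by (simp add: Liminf_const)
  finally have *: "(\<integral>\<^sup>+x. ennreal (\<bar>g x - f m x\<bar> powr p) \<partial>M) \<le> ennreal (c powr p)" .
  show "(\<lambda>x. g x - f m x) \<in> Lfun M p" "pnorm M p (\<lambda>x. g x - f m x) \<le> c"
    using p c * by (auto intro!: Lfun_pnorm_leI)
qed

text \<open>The argument of Riesz and Fischer: a fast subsequence converges, and a Cauchy sequence
  follows any convergent subsequence. Completeness matters because closures are shown to be compact
  through total boundedness.\<close>

lemma mcomplete_Lp:
  assumes p: "p \<ge> 1"
  shows "Metric_space.mcomplete (vcarrier (Lp M p)) (vdist (Lp M p))"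
proof -
  interpret Metric_space "vcarrier (Lp M p)" "vdist (Lp M p)" by (rule Metric_space_Lp[OF p])
  have "\<exists>l. limitin mtopology \<sigma> l sequentially" if C: "MCauchy \<sigma>" for \<sigma>
  proof -
    have *: "\<exists>n0. \<forall>n n'. n0 \<le> n \<longrightarrow> n0 \<le> n' \<longrightarrow> vdist (Lp M p) (\<sigma> n) (\<sigma> n') < (1/4)^k" for k :: nat
      using C unfolding MCauchy_def by (meson zero_less_power zero_less_divide_1_iff zero_less_numeral)
    have "\<exists>r. \<forall>k. (\<forall>n n'. r k \<le> n \<longrightarrow> r k \<le> n' \<longrightarrow> vdist (Lp M p) (\<sigma> n) (\<sigma> n') < (1/4)^k) \<and> r k < r (Suc k)"
    proof (rule dependent_nat_choice)
      show "\<exists>x. \<forall>n n'. x \<le> n \<longrightarrow> x \<le> n' \<longrightarrow> vdist (Lp M p) (\<sigma> n) (\<sigma> n') < (1/4)^0"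
        using *[of 0] by simp
      fix x k :: nat
      obtain n0 where "\<forall>n n'. n0 \<le> n \<longrightarrow> n0 \<le> n' \<longrightarrow> vdist (Lp M p) (\<sigma> n) (\<sigma> n') < (1/4)^Suc k"
        using *[of "Suc k"] by blast
      then show "\<exists>y. (\<forall>n n'. y \<le> n \<longrightarrow> y \<le> n' \<longrightarrow> vdist (Lp M p) (\<sigma> n) (\<sigma> n') < (1/4)^Suc k) \<and> x < y"
        by (intro exI[of _ "max n0 (Suc x)"]) auto
    qed
    then obtain r where r: "\<And>k n n'. r k \<le> n \<Longrightarrow> r k \<le> n' \<Longrightarrow> vdist (Lp M p) (\<sigma> n) (\<sigma> n') < (1/4)^k" 
      "strict_mono r" by (auto simp: strict_mono_Suc_iff)
    have "\<sigma> n \<in> vcarrier (Lp M p)" for n using C by (auto simp: MCauchy_def)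
    then have "\<exists>f. f \<in> Lfun M p \<and> \<sigma> n = ae_class M f" for n by (auto simp: vcarrier_Lp)
    then obtain F where F: "\<And>n. F n \<in> Lfun M p" "\<And>n. \<sigma> n = ae_class M (F n)" by metis
    define f where "f k = F (r k)" for k
    have f: "f k \<in> Lfun M p" "\<sigma> (r k) = ae_class M (f k)" for k using F by (auto simp: f_def)
    have rm: "k \<le> l \<Longrightarrow> r k \<le> r l" for k l using r(2) by (simp add: strict_mono_less_eq)
    have d: "pnorm M p (\<lambda>x. f l x - f k x) \<le> (1/4)^k" if "k \<le> l" for k l
      using r(1)[of k "r l" "r k"] rm[OF that] f by (simp add: vdist_Lp)
    obtain g where g: "g \<in> borel_measurable M" "AE x in M. (\<lambda>k. f k x) \<longlonglongrightarrow> g x"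
      by (rule ex_AE_limit_of_fast_Cauchy[OF p f(1) d[OF le_SucI[OF order.refl]]])
    have gd: "(\<lambda>x. g x - f k x) \<in> Lfun M p" "pnorm M p (\<lambda>x. g x - f k x) \<le> (1/4)^k" for k
      using pnorm_limit_le[OF p f(1) g d] by auto
    have gL: "g \<in> Lfun M p" using Lfun_add[OF p gd(1)[of 0] f(1)[of 0]] by simp
    have "limitin mtopology (\<sigma> \<circ> r) (ae_class M g) sequentially"
      unfolding limitin_metric
    proof (intro conjI allI impI)
      show gc: "ae_class M g \<in> vcarrier (Lp M p)" using gL by (auto simp: vcarrier_Lp)
      fix e :: real assume "e > 0"
      then have "\<forall>\<^sub>F k in sequentially. (1/4)^k < e"
        using LIMSEQ_realpow_zero[of "1/4"] by (intro order_tendstoD) auto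
      then show "\<forall>\<^sub>F k in sequentially. (\<sigma> \<circ> r) k \<in> vcarrier (Lp M p) \<and> vdist (Lp M p) ((\<sigma> \<circ> r) k) (ae_class M g) < e"
      proof eventually_elim
        case (elim k)
        have "vdist (Lp M p) (ae_class M (f k)) (ae_class M g) = pnorm M p (\<lambda>x. g x - f k x)"
          using f gL pnorm_minus_commute[of M p "f k" g] by (simp add: vdist_Lp)
        then show ?case using gd(2)[of k] elim f by (auto simp: vcarrier_Lp)
      qed
    qed
    from MCauchy_convergent_subsequence[OF C r(2) this] show ?thesis by blast
  qed
  then show ?thesis by (simp add: mcomplete_def)
qed

subsection \<open>Operators between spaces of classes\<close>

text \<open>The counterpart of \<open>bounded_operator\<close> for maps on functions. Linearity is
  asked for only almost everywhere, because an integral operator takes a default value where its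
  integral diverges. That functions equal almost everywhere have images equal almost everywhere then
  follows from the norm bound.\<close>

definition Lp_bounded :: "'a measure \<Rightarrow> real \<Rightarrow> 'b measure \<Rightarrow> real \<Rightarrow> (('a \<Rightarrow> real) \<Rightarrow> 'b \<Rightarrow> real) \<Rightarrow> bool" where
  "Lp_bounded M p N q T \<longleftrightarrow> (\<forall>f\<in>Lfun M p. T f \<in> Lfun N q) \<and>
     (\<forall>f\<in>Lfun M p. \<forall>g\<in>Lfun M p. AE t in N. T (\<lambda>x. f x + g x) t = T f t + T g t) \<and>
     (\<forall>a. \<forall>f\<in>Lfun M p. AE t in N. T (\<lambda>x. a * f x) t = a * T f t) \<and>
     (\<exists>C\<ge>0. \<forall>f\<in>Lfun M p. pnorm N q (T f) \<le> C * pnorm M p f)"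

lemma Lp_boundedD:
  assumes "Lp_bounded M p N q T" "f \<in> Lfun M p"
  shows "T f \<in> Lfun N q" "g \<in> Lfun M p \<Longrightarrow> AE t in N. T (\<lambda>x. f x + g x) t = T f t + T g t"
    "AE t in N. T (\<lambda>x. a * f x) t = a * T f t"
  using assms by (auto simp: Lp_bounded_def)

lemma Lp_bounded_diff:
  assumes T: "Lp_bounded M p N q T" and f: "f \<in> Lfun M p" and g: "g \<in> Lfun M p"
  shows "AE t in N. T (\<lambda>x. f x - g x) t = T f t - T g t"
proof -
  have "AE t in N. T (\<lambda>x. f x + (-1) * g x) t = T f t + T (\<lambda>x. (-1) * g x) t"
    by (rule Lp_boundedD(2)[OF T f Lfun_scale[OF g]])
  moreover have "AE t in N. T (\<lambda>x. (-1) * g x) t = (-1) * T g t"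
    by (rule Lp_boundedD(3)[OF T g])
  ultimately show ?thesis by eventually_elim simp
qed

lemma Lp_bounded_cong:
  assumes T: "Lp_bounded M p N q T" and p: "p \<ge> 1" and q: "q \<ge> 1" 
    and f: "f \<in> Lfun M p" and g: "g \<in> Lfun M p" and e: "AE x in M. f x = g x"
  shows "AE t in N. T f t = T g t"
proof -
  obtain C where C: "\<And>f. f \<in> Lfun M p \<Longrightarrow> pnorm N q (T f) \<le> C * pnorm M p f"
    using T unfolding Lp_bounded_def by metis
  have d: "(\<lambda>x. f x - g x) \<in> Lfun M p" by (intro Lfun_diff p f g)
  have "pnorm M p (\<lambda>x. f x - g x) = 0" using e p by (simp add: pnorm_eq_0_iff[OF d])
  then have "pnorm N q (T (\<lambda>x. f x - g x)) = 0" using C[OF d] pnorm_nonneg[of N q] by (simp add: order_antisym)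
  then have "AE t in N. T (\<lambda>x. f x - g x) t = 0"
    using q by (simp add: pnorm_eq_0_iff[OF Lp_boundedD(1)[OF T d]])
  with Lp_bounded_diff[OF T f g] show ?thesis by eventually_elim simp
qed

section \<open>Compactness and strict singularity\<close>

lemma Lp_bounded_bound:
  assumes "Lp_bounded M p N q T"
  obtains C where "0 \<le> C" "\<And>f. f \<in> Lfun M p \<Longrightarrow> pnorm N q (T f) \<le> C * pnorm M p f"
  using assms unfolding Lp_bounded_def by metis

lemma ae_lift_Lfun:
  assumes T: "Lp_bounded M p N q T" and p: "p \<ge> 1" and q: "q \<ge> 1" and f: "f \<in> Lfun M p"
  shows "ae_lift N T (ae_class M f) = ae_class N (T f)"
  unfolding ae_lift_def
proof (rule UN_ae_class_const)
  fix g assume "g \<in> ae_class M f"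
  then have g: "g \<in> Lfun M p" "AE x in M. g x = f x" 
  proof -
    show e: "AE x in M. g x = f x" by (rule ae_classD) fact
    show "g \<in> Lfun M p" using e by (intro Lfun_cong_AE[OF f ae_classD(1)[OF \<open>g \<in> _\<close>]]) auto
  qed
  then show "ae_class N (T g) = ae_class N (T f)"
    using Lp_boundedD(1)[OF T] f by (intro ae_class_eq_iff[THEN iffD2] Lp_bounded_cong[OF T p q]) auto
qed (use f in auto)

lemma bounded_operator_ae_lift:
  assumes T: "Lp_bounded M p N q T" and p: "p \<ge> 1" and q: "q \<ge> 1"
  shows "bounded_operator (Lp M p) (Lp N q) (ae_lift N T)"
proof -
  note lift = ae_lift_Lfun[OF T p q]
  obtain C where C: "0 \<le> C" "\<And>f. f \<in> Lfun M p \<Longrightarrow> pnorm N q (T f) \<le> C * pnorm M p f"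
    using Lp_bounded_bound[OF T] by blast
  have add: "ae_lift N T (vadd (Lp M p) (ae_class M f) (ae_class M g)) = 
      vadd (Lp N q) (ae_lift N T (ae_class M f)) (ae_lift N T (ae_class M g))" 
    if f: "f \<in> Lfun M p" and g: "g \<in> Lfun M p" for f g
  proof -
    note [measurable] = LfunD(1)[OF Lp_boundedD(1)[OF T f]] LfunD(1)[OF Lp_boundedD(1)[OF T g]]
    have m: "T (\<lambda>x. f x + g x) \<in> borel_measurable N"
      using Lp_boundedD(1)[OF T Lfun_add[OF p f g]] by auto
    show ?thesis using f g LfunD(1)[OF f] LfunD(1)[OF g] Lp_boundedD(2)[OF T f g] m
      by (simp add: lift Lfun_add[OF p] ae_class_eq_iff)
  qed
  have sc: "ae_lift N T (vscale (Lp M p) a (ae_class M f)) = vscale (Lp N q) a (ae_lift N T (ae_class M f))" 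
    if f: "f \<in> Lfun M p" for a f
  proof -
    note [measurable] = LfunD(1)[OF Lp_boundedD(1)[OF T f]]
    have m: "T (\<lambda>x. a * f x) \<in> borel_measurable N"
      using Lp_boundedD(1)[OF T Lfun_scale[OF f]] by auto
    show ?thesis using f LfunD(1)[OF f] Lp_boundedD(3)[OF T f] m
      by (simp add: lift Lfun_scale ae_class_eq_iff)
  qed
  have bd: "vnorm (Lp N q) (ae_lift N T (ae_class M f)) \<le> C * vnorm (Lp M p) (ae_class M f)"
    if f: "f \<in> Lfun M p" for f
    using C(2)[OF f] f LfunD(1)[OF f] LfunD(1)[OF Lp_boundedD(1)[OF T f]] by (simp add: lift)
  show ?thesis unfolding bounded_operator_def vcarrier_Lp
  proof (intro conjI exI[of _ C])
    show "\<forall>F\<in>ae_class M ` Lfun M p. ae_lift N T F \<in> ae_class N ` Lfun N q"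
      using Lp_boundedD(1)[OF T] by (auto simp: lift)
  qed (use add sc bd in auto)
qed

text \<open>Approximability by finitely many functionals is a form of compactness that interacts well with
  subspaces: on the common kernel of the functionals the operator has small norm.\<close>

definition fin_approx :: "'a measure \<Rightarrow> real \<Rightarrow> 'b measure \<Rightarrow> real \<Rightarrow> (('a \<Rightarrow> real) \<Rightarrow> 'b \<Rightarrow> real) \<Rightarrow> bool" where
  "fin_approx M p N q T \<longleftrightarrow> (\<forall>\<epsilon>>0. \<exists>(K::nat) \<phi> C. 0 \<le> C \<and>
     (\<forall>i. \<forall>f\<in>Lfun M p. \<forall>g\<in>Lfun M p. \<phi> i (\<lambda>x. f x + g x) = (\<phi> i f + \<phi> i g :: real)) \<and>
     (\<forall>i a. \<forall>f\<in>Lfun M p. \<phi> i (\<lambda>x. a * f x) = a * \<phi> i f) \<and>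
     (\<forall>i. \<forall>f\<in>Lfun M p. \<bar>\<phi> i f\<bar> \<le> C * pnorm M p f) \<and>
     (\<forall>f\<in>Lfun M p. pnorm N q (T f) \<le> \<epsilon> * pnorm M p f + C * (\<Sum>i<K. \<bar>\<phi> i f\<bar>)))"

lemma fin_approxE:
  assumes "fin_approx M p N q T" "0 < \<epsilon>"
  obtains K :: nat and \<phi> C where "0 \<le> C" 
    "\<And>i f g. f \<in> Lfun M p \<Longrightarrow> g \<in> Lfun M p \<Longrightarrow> \<phi> i (\<lambda>x. f x + g x) = (\<phi> i f + \<phi> i g :: real)"
    "\<And>i a f. f \<in> Lfun M p \<Longrightarrow> \<phi> i (\<lambda>x. a * f x) = a * \<phi> i f"
    "\<And>i f. f \<in> Lfun M p \<Longrightarrow> \<bar>\<phi> i f\<bar> \<le> C * pnorm M p f"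
    "\<And>f. f \<in> Lfun M p \<Longrightarrow> pnorm N q (T f) \<le> \<epsilon> * pnorm M p f + C * (\<Sum>i<K. \<bar>\<phi> i f\<bar>)"
proof -
  from assms(1)[unfolded fin_approx_def, THEN spec, THEN mp, OF assms(2)] show ?thesis
  proof (elim exE conjE)
    fix K :: nat and \<phi> :: "nat \<Rightarrow> ('a \<Rightarrow> real) \<Rightarrow> real" and C
    assume C: "0 \<le> C" 
      and add: "\<forall>i. \<forall>f\<in>Lfun M p. \<forall>g\<in>Lfun M p. \<phi> i (\<lambda>x. f x + g x) = \<phi> i f + \<phi> i g"
      and sc: "\<forall>i a. \<forall>f\<in>Lfun M p. \<phi> i (\<lambda>x. a * f x) = a * \<phi> i f"
      and bd: "\<forall>i. \<forall>f\<in>Lfun M p. \<bar>\<phi> i f\<bar> \<le> C * pnorm M p f"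
      and T: "\<forall>f\<in>Lfun M p. pnorm N q (T f) \<le> \<epsilon> * pnorm M p f + C * (\<Sum>i<K. \<bar>\<phi> i f\<bar>)"
    show thesis
      by (rule that[OF C add[rule_format] sc[rule_format] bd[rule_format] T[rule_format]])
  qed
qed

text \<open>On the unit ball the finitely many functionals take bounded values. Rounding these to a
  grid sorts the ball into finitely many cells, and functions in one cell have images at distance
  less than e; one image per nonempty cell is an e-net.\<close>

lemma compact_operator_ae_lift:
  assumes T: "Lp_bounded M p N q T" and p: "p \<ge> 1" and q: "q \<ge> 1" and fa: "fin_approx M p N q T"
  shows "compact_operator (Lp M p) (Lp N q) (ae_lift N T)"
proof -
  interpret Metric_space "vcarrier (Lp N q)" "vdist (Lp N q)" by (rule Metric_space_Lp[OF q])
  define B where "B = {f \<in> Lfun M p. pnorm M p f \<le> 1}"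
  let ?U = "\<lambda>f. ae_class N (T f)"
  have UB: "ae_lift N T ` {x \<in> vcarrier (Lp M p). vnorm (Lp M p) x \<le> 1} = ?U ` B"
  proof -
    have "{x \<in> vcarrier (Lp M p). vnorm (Lp M p) x \<le> 1} = ae_class M ` B"
      by (auto simp: vcarrier_Lp B_def LfunD(1))
    then show ?thesis using ae_lift_Lfun[OF T p q] by (auto simp: image_image B_def)
  qed
  have "mtotally_bounded (?U ` B)"
    unfolding mtotally_bounded_def
  proof (intro allI impI)
    fix e :: real assume e: "0 < e"
    obtain K :: nat and \<phi> C where C: "0 \<le> C" 
      and \<phi>add: "\<And>i f g. f \<in> Lfun M p \<Longrightarrow> g \<in> Lfun M p \<Longrightarrow> \<phi> i (\<lambda>x. f x + g x) = (\<phi> i f + \<phi> i g :: real)"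
      and \<phi>sc: "\<And>i a f. f \<in> Lfun M p \<Longrightarrow> \<phi> i (\<lambda>x. a * f x) = a * \<phi> i f"
      and \<phi>bd: "\<And>i f. f \<in> Lfun M p \<Longrightarrow> \<bar>\<phi> i f\<bar> \<le> C * pnorm M p f"
      and Tbd: "\<And>f. f \<in> Lfun M p \<Longrightarrow> pnorm N q (T f) \<le> (e/8) * pnorm M p f + C * (\<Sum>i<K. \<bar>\<phi> i f\<bar>)"
      by (rule fin_approxE[OF fa, of "e/8"]) (use e in auto)
    \<comment> \<open>The error budget: two functions of the unit ball differ by norm at most 2,
      which contributes \<open>(e/8) * 2\<close>, and the K functionals contribute at most
      \<open>C * (K * d)\<close>, each part being at most e/4. The summand 1 keeps the denominator
      positive.\<close>
    define d where "d = e / (4 * (C * K + 1))"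
    have CK: "0 < C * K + 1" using C by (simp add: add_nonneg_pos)
    have d: "0 < d" "C * (K * d) \<le> e / 4"
    proof -
      show "0 < d" using e CK by (simp add: d_def)
      have "C * (K * d) = (e / 4) * ((C * K) / (C * K + 1))" by (simp add: d_def)
      also have "\<dots> \<le> (e / 4) * 1" using e CK C by (intro mult_left_mono) (auto simp: divide_le_eq_1)
      finally show "C * (K * d) \<le> e / 4" by simp
    qed
    define m where "m = \<lceil>C / d\<rceil> + 1"
    define \<Phi> where "\<Phi> f = restrict (\<lambda>i. \<lfloor>\<phi> i f / d\<rfloor>) {..<K}" for f
    have "\<Phi> ` B \<subseteq> PiE {..<K} (\<lambda>_. {-m..m})"
    proof (rule image_subsetI)
      fix f assume f: "f \<in> B"
      have "\<lfloor>\<phi> i f / d\<rfloor> \<in> {-m..m}" for i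
      proof -
        have "\<bar>\<phi> i f\<bar> \<le> C * pnorm M p f" using f \<phi>bd by (auto simp: B_def)
        also have "\<dots> \<le> C" using f C by (auto simp: B_def mult_left_le)
        finally have "\<bar>\<phi> i f\<bar> \<le> C" .
        then have "\<phi> i f / d \<le> C / d" "- C / d \<le> \<phi> i f / d"
          using d by (intro divide_right_mono; simp)+
        then show ?thesis unfolding m_def atLeastAtMost_iff by linarith
      qed
      then show "\<Phi> f \<in> PiE {..<K} (\<lambda>_. {-m..m})" by (auto simp: \<Phi>_def)
    qed
    then have fin: "finite (\<Phi> ` B)" by (rule finite_subset) (auto intro: finite_PiE)
    define R where "R v = inv_into B \<Phi> v" for v
    have R: "R v \<in> B" "\<Phi> (R v) = v" if "v \<in> \<Phi> ` B" for v
      using that by (auto simp: R_def inv_into_into f_inv_into_f)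
    show "\<exists>L. finite L \<and> L \<subseteq> ?U ` B \<and> ?U ` B \<subseteq> (\<Union>x\<in>L. mball x e)"
    proof (intro exI[of _ "(\<lambda>v. ?U (R v)) ` \<Phi> ` B"] conjI)
      show "finite ((\<lambda>v. ?U (R v)) ` \<Phi> ` B)" using fin by simp
      show "(\<lambda>v. ?U (R v)) ` \<Phi> ` B \<subseteq> ?U ` B" using R by auto
      show "?U ` B \<subseteq> (\<Union>x\<in>(\<lambda>v. ?U (R v)) ` \<Phi> ` B. mball x e)"
      proof safe
        fix f assume f: "f \<in> B"
        define g where "g = R (\<Phi> f)"
        have g: "g \<in> B" "\<Phi> g = \<Phi> f" using R[of "\<Phi> f"] f by (auto simp: g_def)
        have fgL: "f \<in> Lfun M p" "g \<in> Lfun M p" using f g by (auto simp: B_def)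
        have dL: "(\<lambda>x. g x - f x) \<in> Lfun M p" by (intro Lfun_diff p fgL)
        have "\<bar>\<phi> i (\<lambda>x. g x - f x)\<bar> \<le> d" if "i < K" for i
        proof -
          have "\<phi> i (\<lambda>x. g x + (-1) * f x) = \<phi> i g + (-1) * \<phi> i f"
            using \<phi>add[OF fgL(2) Lfun_scale[OF fgL(1), of "-1"], of i] \<phi>sc[OF fgL(1), of i "-1"] by simp
          then have eq: "\<phi> i (\<lambda>x. g x - f x) = \<phi> i g - \<phi> i f" by simp
          have "\<lfloor>\<phi> i g / d\<rfloor> = \<lfloor>\<phi> i f / d\<rfloor>" using fun_cong[OF g(2), of i] that by (simp add: \<Phi>_def)
          then have "\<bar>\<phi> i g / d - \<phi> i f / d\<bar> \<le> 1" by linarith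
          then have "\<bar>(\<phi> i g - \<phi> i f) / d\<bar> \<le> 1" by (simp add: diff_divide_distrib)
          then show ?thesis using d eq by (simp add: abs_divide)
        qed
        then have s: "(\<Sum>i<K. \<bar>\<phi> i (\<lambda>x. g x - f x)\<bar>) \<le> K * d"
          using sum_bounded_above[of "{..<K}" "\<lambda>i. \<bar>\<phi> i (\<lambda>x. g x - f x)\<bar>" d] by simp
        have two: "pnorm M p (\<lambda>x. g x - f x) \<le> 2"
          using pnorm_add_le[OF p fgL(2) Lfun_scale[OF fgL(1), of "-1"]] f g p
            pnorm_scale[of p M "-1" f] by (simp add: B_def)
        have "pnorm N q (T (\<lambda>x. g x - f x)) \<le> (e/8) * 2 + C * (K * d)"
          by (rule order_trans[OF Tbd[OF dL] add_mono[OF mult_left_mono[OF two] mult_left_mono[OF s C]]]) (use e in simp)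
        also have "\<dots> < e" using d e by simp
        finally have lt: "pnorm N q (T (\<lambda>x. g x - f x)) < e" .
        have TL: "T f \<in> Lfun N q" "T g \<in> Lfun N q" "T (\<lambda>x. g x - f x) \<in> Lfun N q"
          using Lp_boundedD(1)[OF T] fgL dL by auto
        note [measurable] = LfunD(1)[OF TL(1)] LfunD(1)[OF TL(2)]
        have "pnorm N q (T (\<lambda>x. g x - f x)) = pnorm N q (\<lambda>t. T g t - T f t)"
          using Lp_bounded_diff[OF T fgL(2,1)] TL by (intro pnorm_cong_AE) auto
        then have "vdist (Lp N q) (?U g) (?U f) < e" using TL lt by (simp add: vdist_Lp)
        then have "?U f \<in> mball (?U g) e" using TL by (simp add: ae_class_in_vcarrier_iff LfunD(1))
        then show "?U f \<in> (\<Union>x\<in>(\<lambda>v. ?U (R v)) ` \<Phi> ` B. mball x e)" using f by (auto simp: g_def)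
      qed
    qed
  qed
  then have "compactin mtopology (mtopology closure_of (?U ` B))"
    using mtotally_bounded_eq_compact_closure_of[OF mcomplete_Lp[OF q]] by blast
  then show ?thesis unfolding compact_operator_def UB vtopology_def
    using bounded_operator_ae_lift[OF T p q] by simp
qed

section \<open>Small sets: absolute continuity and almost disjoint perturbations\<close>

lemma integral_small_on_small_sets:
  fixes F :: "'a \<Rightarrow> real"
  assumes fin: "finite_measure M" and F: "integrable M F" and nn: "\<And>x. 0 \<le> F x" and e: "0 < e"
  obtains d where "0 < d" 
    "\<And>A. A \<in> sets M \<Longrightarrow> measure M A \<le> d \<Longrightarrow> (\<integral>x. indicator A x * F x \<partial>M) \<le> e"
proof -
  interpret finite_measure M by fact
  have [measurable]: "F \<in> borel_measurable M" using F by auto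
  \<comment> \<open>The excess of F over height n tends to 0 in mean, while the part below n
    contributes at most n times the measure of the set.\<close>
  have "(\<lambda>n. \<integral>x. (F x - min (F x) (real n)) \<partial>M) \<longlonglongrightarrow> (\<integral>x. 0 \<partial>M)"
  proof (rule integral_dominated_convergence[where w = F])
    show "AE x in M. (\<lambda>n. F x - min (F x) (real n)) \<longlonglongrightarrow> 0"
    proof (rule AE_I2)
      fix x
      have "\<forall>\<^sub>F n in sequentially. F x - min (F x) (real n) = 0"
        using eventually_ge_at_top[of "nat \<lceil>F x\<rceil>"] 
      proof eventually_elim
        case (elim n)
        then have "F x \<le> real n" by linarith
        then show ?case by simp
      qed
      then show "(\<lambda>n. F x - min (F x) (real n)) \<longlonglongrightarrow> 0" by (rule tendsto_eventually)
    qed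
  qed (use F nn in \<open>auto simp: min_def\<close>)
  then have "\<forall>\<^sub>F n in sequentially. (\<integral>x. (F x - min (F x) (real n)) \<partial>M) < e / 2"
    using e by (intro order_tendstoD(2)) auto
  then obtain n where n: "(\<integral>x. (F x - min (F x) (real n)) \<partial>M) < e / 2"
    by (auto simp: eventually_sequentially)
  have im: "integrable M (\<lambda>x. min (F x) (real n))" using F by auto
  have iI: "integrable M (\<lambda>x. real n * indicator A x)" if "A \<in> sets M" for A
    using that by (intro integrable_mult_right) (simp add: less_top[symmetric])
  show ?thesis
  proof (rule that)
    show d0: "0 < e / (2 * (real n + 1))" using e by auto
    fix A assume A[measurable]: "A \<in> sets M" and le: "measure M A \<le> e / (2 * (real n + 1))"
    have "(\<integral>x. indicator A x * F x \<partial>M) \<le> (\<integral>x. (F x - min (F x) (real n)) + real n * indicator A x \<partial>M)"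
    proof (rule integral_mono)
      show "integrable M (\<lambda>x. indicator A x * F x)" 
        using integrable_real_mult_indicator[OF A F] by (simp add: mult.commute)
      show "integrable M (\<lambda>x. (F x - min (F x) (real n)) + real n * indicator A x)"
        using F im iI[OF A] by (intro Bochner_Integration.integrable_add Bochner_Integration.integrable_diff)
      show "indicator A x * F x \<le> (F x - min (F x) (real n)) + real n * indicator A x" for x
        using nn[of x] by (auto simp: indicator_def min_def)
    qed
    also have "\<dots> = (\<integral>x. (F x - min (F x) (real n)) \<partial>M) + real n * measure M A"
      using F im iI[OF A] by (subst Bochner_Integration.integral_add) auto
    also have "\<dots> \<le> e / 2 + real n * (e / (2 * (real n + 1)))"
      using n le by (intro add_mono mult_left_mono) auto
    also have "real n * (e / (2 * (real n + 1))) \<le> e / 2"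
      using e by (simp add: field_simps)
    finally show "(\<integral>x. indicator A x * F x \<partial>M) \<le> e" by simp
  qed
qed

lemma measure_superlevel_le:
  assumes fin: "finite_measure M" and p: "p > 0" and f: "f \<in> Lfun M p" and b: "0 < b"
  shows "measure M {x\<in>space M. b < \<bar>f x\<bar>} \<le> (pnorm M p f / b) powr p"
proof -
  interpret finite_measure M by fact
  note [measurable] = LfunD(1)[OF f]
  have "b powr p * measure M {x\<in>space M. b < \<bar>f x\<bar>} = (\<integral>x. b powr p * indicator {x\<in>space M. b < \<bar>f x\<bar>} x \<partial>M)"
    by simp
  also have "\<dots> \<le> (\<integral>x. \<bar>f x\<bar> powr p \<partial>M)"
  proof (rule integral_mono)
    show "integrable M (\<lambda>x. b powr p * indicator {x \<in> space M. b < \<bar>f x\<bar>} x)" by (simp add: less_top[symmetric])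
    show "b powr p * indicator {x \<in> space M. b < \<bar>f x\<bar>} x \<le> \<bar>f x\<bar> powr p" for x
      using b p by (auto simp: indicator_def intro!: powr_mono2)
  qed (use f in auto)
  also have "\<dots> = pnorm M p f powr p" using p by (simp add: pnorm_powr)
  finally show ?thesis using b by (simp add: powr_divide field_simps)
qed

text \<open>Up to sign, both a and b are half sums of a + b and a - b, so convexity bounds each of
  their powers. Averaging over the two signs is what later allows a favourable sign to be chosen
  without any control of cross terms.\<close>

lemma max_powr_le_average:
  fixes a b :: real
  assumes p: "p \<ge> 1"
  shows "2 * max (\<bar>a\<bar> powr p) (\<bar>b\<bar> powr p) \<le> \<bar>a + b\<bar> powr p + \<bar>a - b\<bar> powr p"
proof -
  have *: "2 * \<bar>c\<bar> powr p \<le> u powr p + v powr p" if "2 * \<bar>c\<bar> \<le> u + v" "0 \<le> u" "0 \<le> v" for c u v :: real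
  proof -
    have "\<bar>c\<bar> powr p \<le> ((1/2) * u + (1/2) * v) powr p" using that p by (intro powr_mono2) auto
    also have "\<dots> \<le> (1/2) * u powr p + (1/2) * v powr p" using p that by (intro convex_combination_powr) auto
    finally show ?thesis by simp
  qed
  have "2 * \<bar>a\<bar> powr p \<le> \<bar>a + b\<bar> powr p + \<bar>a - b\<bar> powr p" "2 * \<bar>b\<bar> powr p \<le> \<bar>a + b\<bar> powr p + \<bar>a - b\<bar> powr p"
    by (rule *; linarith)+
  then show ?thesis by (simp add: max_def)
qed

text \<open>A function that is concentrated on a set on which \<open>S\<close> is small increases the \<open>p\<close>-th power
  of the norm of \<open>S\<close> by a fixed amount, for one of the two signs.\<close>

lemma pnorm_increase:
  assumes fin: "finite_measure M" and p: "p \<ge> 1" and S: "S \<in> Lfun M p" and c: "0 < c"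
  obtains H where "0 < H" "\<And>f. f \<in> Lfun M p \<Longrightarrow> pnorm M p f = 1 \<Longrightarrow>
    c \<le> (\<integral>x. indicator {x\<in>space M. H < \<bar>f x\<bar>} x * \<bar>f x\<bar> powr p \<partial>M) \<Longrightarrow>
    \<exists>s\<in>{1,-1}. pnorm M p S powr p + c / 2 \<le> pnorm M p (\<lambda>x. S x + s * f x) powr p"
proof -
  have p0: "p > 0" using p by simp
  obtain d where d: "0 < d" 
    "\<And>A. A \<in> sets M \<Longrightarrow> measure M A \<le> d \<Longrightarrow> (\<integral>x. indicator A x * \<bar>S x\<bar> powr p \<partial>M) \<le> c / 2"
    by (rule integral_small_on_small_sets[OF fin LfunD(2)[OF S], of "c/2"]) (use c in auto)
  \<comment> \<open>By Chebyshev's inequality a function of norm 1 exceeds H on a set of measure at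
    most \<open>(1 / H) powr p = d\<close>.\<close>
  define H where "H = d powr (- 1 / p)"
  have H: "0 < H" "(1 / H) powr p = d"
    using d(1) p by (auto simp: H_def powr_powr powr_divide powr_minus_divide) 
  show ?thesis
  proof (rule that[OF H(1)])
    fix f assume f: "f \<in> Lfun M p" "pnorm M p f = 1"
    define A where "A = {x\<in>space M. H < \<bar>f x\<bar>}"
    assume "c \<le> (\<integral>x. indicator {x\<in>space M. H < \<bar>f x\<bar>} x * \<bar>f x\<bar> powr p \<partial>M)"
    then have cA: "c \<le> (\<integral>x. indicator A x * \<bar>f x\<bar> powr p \<partial>M)" by (simp add: A_def)
    note [measurable] = LfunD(1)[OF f(1)] LfunD(1)[OF S]
    have A[measurable]: "A \<in> sets M" unfolding A_def by measurable
    have "measure M A \<le> d"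
      using measure_superlevel_le[OF fin p0 f(1) H(1)] H(2) f(2) by (simp add: A_def)
    then have SA: "(\<integral>x. indicator A x * \<bar>S x\<bar> powr p \<partial>M) \<le> c / 2" using d A by auto
    have iS: "integrable M (\<lambda>x. \<bar>S x\<bar> powr p)" "integrable M (\<lambda>x. indicator A x * \<bar>S x\<bar> powr p)"
      using LfunD(2)[OF S] integrable_real_mult_indicator[OF A LfunD(2)[OF S]] by (auto simp: mult.commute)
    have ifA: "integrable M (\<lambda>x. indicator A x * \<bar>f x\<bar> powr p)"
      using integrable_real_mult_indicator[OF A LfunD(2)[OF f(1)]] by (simp add: mult.commute)
    have L: "(\<lambda>x. S x + f x) \<in> Lfun M p" "(\<lambda>x. S x - f x) \<in> Lfun M p"
      by (intro Lfun_add Lfun_diff p S f)+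
    \<comment> \<open>Off A the larger of the two powers is bounded below by that of S, on A by that
      of f. The sum over both signs gains c, so one sign gains c/2.\<close>
    have "2 * (pnorm M p S powr p - c / 2 + c) \<le> 
      2 * ((\<integral>x. \<bar>S x\<bar> powr p \<partial>M) - (\<integral>x. indicator A x * \<bar>S x\<bar> powr p \<partial>M) + (\<integral>x. indicator A x * \<bar>f x\<bar> powr p \<partial>M))"
      using SA cA p0 by (simp add: pnorm_powr)
    also have "\<dots> = (\<integral>x. 2 * (\<bar>S x\<bar> powr p - indicator A x * \<bar>S x\<bar> powr p + indicator A x * \<bar>f x\<bar> powr p) \<partial>M)"
      using iS ifA by simp
    also have "\<dots> \<le> (\<integral>x. \<bar>S x + f x\<bar> powr p + \<bar>S x - f x\<bar> powr p \<partial>M)"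
    proof (rule integral_mono)
      fix x
      show "2 * (\<bar>S x\<bar> powr p - indicator A x * \<bar>S x\<bar> powr p + indicator A x * \<bar>f x\<bar> powr p)
        \<le> \<bar>S x + f x\<bar> powr p + \<bar>S x - f x\<bar> powr p"
        using max_powr_le_average[OF p, of "S x" "f x"] by (auto simp: indicator_def)
    qed (use iS ifA LfunD(2)[OF L(1)] LfunD(2)[OF L(2)] in auto)
    also have "\<dots> = pnorm M p (\<lambda>x. S x + f x) powr p + pnorm M p (\<lambda>x. S x - f x) powr p"
      using LfunD(2)[OF L(1)] LfunD(2)[OF L(2)] p0 by (simp add: pnorm_powr)
    finally have "pnorm M p S powr p + c / 2 \<le> pnorm M p (\<lambda>x. S x + f x) powr p \<or>
        pnorm M p S powr p + c / 2 \<le> pnorm M p (\<lambda>x. S x - f x) powr p"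
      by argo
    then show "\<exists>s\<in>{1,-1}. pnorm M p S powr p + c / 2 \<le> pnorm M p (\<lambda>x. S x + s * f x) powr p" by auto
  qed
qed

text \<open>Conversely, a bounded perturbation that is small in a weaker norm, hence in measure, cannot increase
  the \<open>q\<close>-th power of the norm by more than a fixed amount.\<close>

lemma pnorm_increase_bounded:
  assumes fin: "finite_measure N" and p: "p \<ge> 1" and q: "q \<ge> 1" and S: "S \<in> Lfun N q" 
  obtains e where "0 < e" "\<And>g. g \<in> Lfun N q \<Longrightarrow> g \<in> Lfun N p \<Longrightarrow> pnorm N p g \<le> e \<Longrightarrow> 
    pnorm N q (\<lambda>x. S x + g x) powr q \<le> pnorm N q S powr q + 2 + 2 powr q * pnorm N q g powr q"
proof -
  interpret finite_measure N by fact
  have p0: "p > 0" and q0: "q > 0" using p q by auto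
  note [measurable] = LfunD(1)[OF S]
  define n where "n = measure N (space N) powr (1/q)"
  have cL: "(\<lambda>_. b) \<in> Lfun N q" for b :: real by (rule Lfun_bounded[OF fin, of _ "\<bar>b\<bar>"]) (use q in auto)
  have pc: "pnorm N q (\<lambda>_. b) = b * n" if "0 \<le> b" for b
    using that q0 by (simp add: pnorm_def n_def powr_mult powr_powr mult.commute)
  \<comment> \<open>The height b is taken so small that adding it to |S| raises the q-th power of
    the norm by less than 1.\<close>
  have "((\<lambda>b. (pnorm N q S + b * n) powr q) \<longlongrightarrow> (pnorm N q S + 0 * n) powr q) (at_right 0)"
    using q0 by (intro tendsto_powr2 tendsto_intros) (auto simp: n_def eventually_at_right_field intro!: exI[of _ 1] add_nonneg_nonneg)
  then have "\<forall>\<^sub>F b in at_right 0. (pnorm N q S + b * n) powr q < pnorm N q S powr q + 1"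
    by (rule order_tendstoD(2)) simp
  then obtain b0 where "0 < b0" "\<And>b. 0 < b \<Longrightarrow> b < b0 \<Longrightarrow> (pnorm N q S + b * n) powr q < pnorm N q S powr q + 1"
    unfolding eventually_at_right_field by blast
  then obtain b where b: "0 < b" "(pnorm N q S + b * n) powr q < pnorm N q S powr q + 1"
    using dense[of 0 b0] by blast
  obtain d where d: "0 < d" 
    "\<And>A. A \<in> sets N \<Longrightarrow> measure N A \<le> d \<Longrightarrow> (\<integral>x. indicator A x * \<bar>S x\<bar> powr q \<partial>N) \<le> 2 powr - q"
    by (rule integral_small_on_small_sets[OF fin LfunD(2)[OF S], of "2 powr - q"]) auto
  \<comment> \<open>Chebyshev's inequality again: a p-norm of at most e forces |g| > b to hold on a
    set of measure at most d only. There |S| contributes at most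
    \<open>2 powr q * 2 powr - q = 1\<close>; with the increment from b this makes the constant 2 of
    the claim.\<close>
  define e where "e = b * d powr (1/p)"
  have e: "0 < e" "(e / b) powr p = d" using b d p0 by (auto simp: e_def powr_powr)
  show ?thesis
  proof (rule that[OF e(1)])
    fix g assume g: "g \<in> Lfun N q" "g \<in> Lfun N p" "pnorm N p g \<le> e"
    note [measurable] = LfunD(1)[OF g(1)]
    define A where "A = {x\<in>space N. b < \<bar>g x\<bar>}"
    have A[measurable]: "A \<in> sets N" unfolding A_def by measurable
    have "measure N A \<le> (pnorm N p g / b) powr p"
      using measure_superlevel_le[OF fin p0 g(2) b(1)] by (simp add: A_def)
    also have "\<dots> \<le> (e / b) powr p" using g b p0 by (intro powr_mono2 divide_right_mono) auto
    finally have SA: "(\<integral>x. indicator A x * \<bar>S x\<bar> powr q \<partial>N) \<le> 2 powr - q" using e d by simp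
    have aL: "(\<lambda>x. \<bar>S x\<bar> + b) \<in> Lfun N q"
      using S by (intro Lfun_add[OF q _ cL]) (auto simp: Lfun_def)
    have aS: "(\<lambda>x. \<bar>S x\<bar>) \<in> Lfun N q" using S by (auto simp: Lfun_def)
    have iA: "integrable N (\<lambda>x. indicator A x * \<bar>S x\<bar> powr q)"
      using integrable_real_mult_indicator[OF A LfunD(2)[OF S]] by (simp add: mult.commute)
    have "pnorm N q (\<lambda>x. S x + g x) powr q = (\<integral>x. \<bar>S x + g x\<bar> powr q \<partial>N)" using q0 by (simp add: pnorm_powr)
    also have "\<dots> \<le> (\<integral>x. \<bar>\<bar>S x\<bar> + b\<bar> powr q + (2 powr q * (indicator A x * \<bar>S x\<bar> powr q) + 2 powr q * \<bar>g x\<bar> powr q) \<partial>N)"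
    proof (rule integral_mono)
      fix x assume x: "x \<in> space N"
      show "\<bar>S x + g x\<bar> powr q \<le> \<bar>\<bar>S x\<bar> + b\<bar> powr q + (2 powr q * (indicator A x * \<bar>S x\<bar> powr q) + 2 powr q * \<bar>g x\<bar> powr q)"
      proof (cases "x \<in> A")
        case True
        have "\<bar>S x + g x\<bar> powr q \<le> (\<bar>S x\<bar> + \<bar>g x\<bar>) powr q" using q0 by (intro powr_mono2) auto
        also have "\<dots> \<le> 2 powr q * (\<bar>S x\<bar> powr q + \<bar>g x\<bar> powr q)" by (rule powr_add_le[OF q]) auto
        finally show ?thesis using True by (simp add: algebra_simps add_increasing)
      next
        case False
        then have "\<bar>g x\<bar> \<le> b" using x by (auto simp: A_def)
        then have "\<bar>S x + g x\<bar> powr q \<le> \<bar>\<bar>S x\<bar> + b\<bar> powr q" using q0 b by (intro powr_mono2) auto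
        then show ?thesis by (simp add: add_increasing2)
      qed
    qed (use LfunD(2)[OF Lfun_add[OF q S g(1)]] LfunD(2)[OF aL] iA LfunD(2)[OF g(1)] in auto)
    also have "\<dots> = (\<integral>x. \<bar>\<bar>S x\<bar> + b\<bar> powr q \<partial>N) + (2 powr q * (\<integral>x. indicator A x * \<bar>S x\<bar> powr q \<partial>N) + 2 powr q * (\<integral>x. \<bar>g x\<bar> powr q \<partial>N))"
      using LfunD(2)[OF aL] iA LfunD(2)[OF g(1)] by simp
    also have "\<dots> \<le> pnorm N q (\<lambda>x. \<bar>S x\<bar> + b) powr q + (1 + 2 powr q * pnorm N q g powr q)"
      using SA q0 mult_left_mono[OF SA, of "2 powr q"] by (simp add: pnorm_powr powr_minus)
    also have "pnorm N q (\<lambda>x. \<bar>S x\<bar> + b) \<le> pnorm N q S + b * n"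
    proof -
      have "pnorm N q (\<lambda>x. \<bar>S x\<bar>) = pnorm N q S" by (simp add: pnorm_def)
      then show ?thesis using pnorm_add_le[OF q aS cL[of b]] pc[of b] b by simp
    qed
    then have "pnorm N q (\<lambda>x. \<bar>S x\<bar> + b) powr q \<le> (pnorm N q S + b * n) powr q"
      using q0 by (intro powr_mono2) auto
    then have "pnorm N q (\<lambda>x. \<bar>S x\<bar> + b) powr q + (1 + 2 powr q * pnorm N q g powr q) 
       \<le> pnorm N q S powr q + 2 + 2 powr q * pnorm N q g powr q" using b by simp
    finally show "pnorm N q (\<lambda>x. S x + g x) powr q \<le> pnorm N q S powr q + 2 + 2 powr q * pnorm N q g powr q" .
  qed
qed

section \<open>Linear spans and common kernels of functionals\<close>

lemma
  shows hull_vsubspace_add: "\<lbrakk>x \<in> vsubspace X hull B; y \<in> vsubspace X hull B\<rbrakk> \<Longrightarrow> vadd X x y \<in> vsubspace X hull B"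
    and hull_vsubspace_scale: "x \<in> vsubspace X hull B \<Longrightarrow> vscale X a x \<in> vsubspace X hull B"
    and hull_vsubspace_zero: "vzero X \<in> vsubspace X hull B"
  by (auto simp: hull_def vsubspace_def)

text \<open>Each functional cuts off at most one dimension: by induction on K every vector of E lies
  in the common kernel modulo a fixed finite-dimensional span. If the kernel contained only null
  functions, that span would be all of E.\<close>

lemma infinite_dimensional_kernel:
  fixes \<phi> :: "nat \<Rightarrow> ('a \<Rightarrow> real) \<Rightarrow> real"
  assumes p: "p \<ge> 1" and E: "vsubspace (Lp M p) E" and inf: "infinite_dimensional (Lp M p) E"
    and \<phi>add: "\<And>i f g. f \<in> Lfun M p \<Longrightarrow> g \<in> Lfun M p \<Longrightarrow> \<phi> i (\<lambda>x. f x + g x) = \<phi> i f + \<phi> i g"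
    and \<phi>sc: "\<And>i a f. f \<in> Lfun M p \<Longrightarrow> \<phi> i (\<lambda>x. a * f x) = a * \<phi> i f"
  shows "\<exists>f\<in>Lfun M p. ae_class M f \<in> E \<and> pnorm M p f = 1 \<and> (\<forall>i<K. \<phi> i f = 0)"
proof -
  define V where "V = {f \<in> Lfun M p. ae_class M f \<in> E}"
  have Vadd: "(\<lambda>x. f x + g x) \<in> V" if "f \<in> V" "g \<in> V" for f g
  proof -
    have "vadd (Lp M p) (ae_class M f) (ae_class M g) \<in> E" using that E by (auto simp: vsubspace_def V_def)
    then show ?thesis using that p by (auto simp: V_def Lfun_add LfunD(1))
  qed
  have Vsc: "(\<lambda>x. a * f x) \<in> V" if "f \<in> V" for f a
  proof -
    have "vscale (Lp M p) a (ae_class M f) \<in> E" using that E by (auto simp: vsubspace_def V_def)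
    then show ?thesis using that p by (auto simp: V_def Lfun_scale LfunD(1))
  qed
  have Vm: "f \<in> borel_measurable M" "f \<in> Lfun M p" if "f \<in> V" for f using that by (auto simp: V_def)
  have "\<exists>B. finite B \<and> B \<subseteq> E \<and> (\<forall>f\<in>V. \<exists>h\<in>V. (\<forall>i<K. \<phi> i h = 0) \<and> 
     ae_class M (\<lambda>x. f x - h x) \<in> vsubspace (Lp M p) hull B)" for K
  proof (induction K)
    case 0
    have "ae_class M (\<lambda>x. f x - f x) \<in> vsubspace (Lp M p) hull {}" for f
      using hull_vsubspace_zero[of "Lp M p" "{}"] by simp
    then show ?case by (intro exI[of _ "{}"]) blast
  next
    case (Suc K)
    then obtain B where B: "finite B" "B \<subseteq> E" "\<And>f. f \<in> V \<Longrightarrow> \<exists>h\<in>V. (\<forall>i<K. \<phi> i h = 0) \<and> 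
     ae_class M (\<lambda>x. f x - h x) \<in> vsubspace (Lp M p) hull B" by blast
    show ?case
    proof (cases "\<forall>h\<in>V. (\<forall>i<K. \<phi> i h = 0) \<longrightarrow> \<phi> K h = 0")
      case True
      then show ?thesis using B by (intro exI[of _ B]) (auto simp: less_Suc_eq, blast)
    next
      case False
      then obtain w0 where w0: "w0 \<in> V" "\<And>i. i < K \<Longrightarrow> \<phi> i w0 = 0" "\<phi> K w0 \<noteq> 0" by auto
      \<comment> \<open>The normalization gives \<phi> K the value 1 at w. Subtracting
        \<open>\<phi> K h\<close> times w kills the new functional without disturbing the earlier
        ones, and the class of w joins the spanning set.\<close>
      define a where "a = 1 / \<phi> K w0"
      have a: "a * \<phi> K w0 = 1" using w0 by (simp add: a_def)
      define w where "w = (\<lambda>x. a * w0 x)"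
      have w: "w \<in> V" "\<And>i. i < K \<Longrightarrow> \<phi> i w = 0" "\<phi> K w = 1"
        using w0 Vsc \<phi>sc[OF Vm(2)[OF w0(1)]] a by (auto simp: w_def)
      define B' where "B' = insert (ae_class M w) B"
      have "\<exists>h\<in>V. (\<forall>i<Suc K. \<phi> i h = 0) \<and> ae_class M (\<lambda>x. f x - h x) \<in> vsubspace (Lp M p) hull B'" if f: "f \<in> V" for f
      proof -
        obtain h where h: "h \<in> V" "\<And>i. i < K \<Longrightarrow> \<phi> i h = 0" 
          "ae_class M (\<lambda>x. f x - h x) \<in> vsubspace (Lp M p) hull B" using B(3)[OF f] by blast
        define h' where "h' = (\<lambda>x. h x + (- \<phi> K h) * w x)"
        have h'V: "h' \<in> V" unfolding h'_def by (intro Vadd Vsc h w)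
        have \<phi>h': "\<phi> i h' = \<phi> i h - \<phi> K h * \<phi> i w" for i
          unfolding h'_def \<phi>add[OF Vm(2)[OF h(1)] Lfun_scale[OF Vm(2)[OF w(1)]]] \<phi>sc[OF Vm(2)[OF w(1)]]
          by simp
        note [measurable] = Vm(1)[OF f] Vm(1)[OF h(1)] Vm(1)[OF w(1)]
        have "ae_class M (\<lambda>x. f x - h x) \<in> vsubspace (Lp M p) hull B'"
          using h(3) hull_mono[of B B' "vsubspace (Lp M p)"] by (auto simp: B'_def)
        moreover have "vscale (Lp M p) (\<phi> K h) (ae_class M w) \<in> vsubspace (Lp M p) hull B'"
          by (intro hull_vsubspace_scale hull_inc) (simp add: B'_def)
        ultimately have "vadd (Lp M p) (ae_class M (\<lambda>x. f x - h x)) (vscale (Lp M p) (\<phi> K h) (ae_class M w)) \<in> vsubspace (Lp M p) hull B'"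
          by (rule hull_vsubspace_add)
        then have "ae_class M (\<lambda>x. f x - h' x) \<in> vsubspace (Lp M p) hull B'"
          by (simp add: h'_def algebra_simps)
        moreover have "\<forall>i<Suc K. \<phi> i h' = 0" using \<phi>h' h w by (auto simp: less_Suc_eq)
        ultimately show ?thesis using h'V by blast
      qed
      moreover have "finite B'" "B' \<subseteq> E" using B w(1) by (auto simp: B'_def V_def)
      ultimately show ?thesis by blast
    qed
  qed
  then obtain B where B: "finite B" "B \<subseteq> E" "\<And>f. f \<in> V \<Longrightarrow> \<exists>h\<in>V. (\<forall>i<K. \<phi> i h = 0) \<and> 
     ae_class M (\<lambda>x. f x - h x) \<in> vsubspace (Lp M p) hull B" by metis
  have "\<exists>h\<in>V. (\<forall>i<K. \<phi> i h = 0) \<and> pnorm M p h \<noteq> 0"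
  proof (rule ccontr)
    assume no: "\<not> (\<exists>h\<in>V. (\<forall>i<K. \<phi> i h = 0) \<and> pnorm M p h \<noteq> 0)"
    have "E \<subseteq> vsubspace (Lp M p) hull B"
    proof
      fix F assume F: "F \<in> E"
      then have "F \<in> vcarrier (Lp M p)" using E by (auto simp: vsubspace_def)
      then obtain f where f: "f \<in> Lfun M p" "F = ae_class M f" by (auto simp: vcarrier_Lp)
      then have "f \<in> V" using F by (simp add: V_def)
      then obtain h where h: "h \<in> V" "\<forall>i<K. \<phi> i h = 0" "ae_class M (\<lambda>x. f x - h x) \<in> vsubspace (Lp M p) hull B"
        using B(3) by blast
      then have "pnorm M p h = 0" using no by blast
      then have "AE x in M. h x = 0" using Vm(2)[OF h(1)] p by (simp add: pnorm_eq_0_iff)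
      then have "ae_class M (\<lambda>x. f x - h x) = ae_class M f"
        using f Vm(1)[OF h(1)] by (subst ae_class_eq_iff) auto
      then show "F \<in> vsubspace (Lp M p) hull B" using h f by simp
    qed
    then show False using inf B by (auto simp: infinite_dimensional_def)
  qed
  then obtain h where h: "h \<in> V" "\<And>i. i < K \<Longrightarrow> \<phi> i h = 0" "pnorm M p h \<noteq> 0" by blast
  define f where "f = (\<lambda>x. (1 / pnorm M p h) * h x)"
  have "f \<in> V" unfolding f_def by (intro Vsc h)
  moreover have "pnorm M p f = 1" using h(3) p unfolding f_def by (subst pnorm_scale) auto
  moreover have "\<phi> i f = 0" if "i < K" for i
    unfolding f_def \<phi>sc[OF Vm(2)[OF h(1)]] using h(2)[OF that] by simp
  ultimately show ?thesis by (intro bexI[of _ f]) (auto simp: V_def)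
qed

text \<open>Small values of \<open>f\<close> contribute little to \<open>T f\<close> when \<open>T f\<close> is small in the weaker norm, so the
  large values of \<open>f\<close> must carry a fixed part of its norm.\<close>

lemma pnorm_large_values:
  assumes p: "p \<ge> 1" and q: "p < q" and T: "Lp_bounded M p N q T" and T': "Lp_bounded M p N p T"
    and A: "\<And>f H. f \<in> borel_measurable M \<Longrightarrow> (\<And>x. \<bar>f x\<bar> \<le> H) \<Longrightarrow> AE t in N. \<bar>T f t\<bar> \<le> A * H" 
    and c: "0 < c"
  shows "\<exists>c'>0. \<forall>H>0. \<exists>e>0. \<forall>f\<in>Lfun M p. c \<le> pnorm N q (T f) \<longrightarrow> pnorm N p (T f) \<le> e \<longrightarrow>
      c' \<le> (\<integral>x. indicator {x\<in>space M. H < \<bar>f x\<bar>} x * \<bar>f x\<bar> powr p \<partial>M)"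
proof -
  obtain C where C: "0 \<le> C" "\<And>f. f \<in> Lfun M p \<Longrightarrow> pnorm N q (T f) \<le> C * pnorm M p f"
    using Lp_bounded_bound[OF T] by blast
  have p0: "p > 0" and q0: "q > 0" and q1: "q \<ge> 1" using p q by auto
  define C1 where "C1 = 2 powr q * (C + 1) powr q"
  have C1: "0 < C1" using C by (simp add: C1_def)
  \<comment> \<open>Chosen so that \<open>C1 * c' powr (q / p)\<close> is half of
    \<open>c powr q\<close>. It does not involve H, only e does; in the construction of long sums c'
    is fixed once while H changes at every step.\<close>
  define c' where "c' = (c powr q / (2 * C1)) powr (p / q)"
  have c': "0 < c'" "c' powr (q / p) = c powr q / (2 * C1)"
    using c C1 p0 q0 by (auto simp: c'_def powr_powr)
  show ?thesis
  proof (rule exI[of _ c'], intro conjI c'(1) allI impI)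
    fix H :: real assume H: "0 < H"
    \<comment> \<open>Since |T g| is at most half of H2, wherever |T f| exceeds H2 the part T h
      accounts for at least half of it. Elsewhere the q-th power is at most
      \<open>H2 powr (q - p)\<close> times the p-th power, whose integral e keeps small.\<close>
    define H2 where "H2 = 2 * ((\<bar>A\<bar> + 1) * H)"
    have H2: "0 < H2" using H by (simp add: H2_def add_nonneg_pos)
    define e where "e = (c powr q / (2 * H2 powr (q - p))) powr (1 / p)"
    have e: "0 < e" "H2 powr (q - p) * e powr p = c powr q / 2"
      using c H2 p0 by (auto simp: e_def powr_powr)
    have "c' \<le> (\<integral>x. indicator {x\<in>space M. H < \<bar>f x\<bar>} x * \<bar>f x\<bar> powr p \<partial>M)"
      if f: "f \<in> Lfun M p" and fc: "c \<le> pnorm N q (T f)" and fe: "pnorm N p (T f) \<le> e" for f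
    proof -
      note [measurable] = LfunD(1)[OF f]
      define g where "g x = (if \<bar>f x\<bar> \<le> H then f x else 0)" for x
      define h where "h x = indicator {x\<in>space M. H < \<bar>f x\<bar>} x * f x" for x
      have gm: "g \<in> borel_measurable M" unfolding g_def by measurable
      have hm: "h \<in> borel_measurable M" unfolding h_def by measurable
      have gL: "g \<in> Lfun M p" using pnorm_mono(1)[OF p0 gm f] by (auto simp: g_def)
      have hL: "h \<in> Lfun M p" using pnorm_mono(1)[OF p0 hm f] by (auto simp: h_def indicator_def)
      have fgh: "AE x in M. f x = g x + h x" by (rule AE_I2) (auto simp: g_def h_def indicator_def)
      have Tg: "AE t in N. \<bar>T g t\<bar> \<le> A * H" using H by (intro A gm) (auto simp: g_def)
      have Tf: "AE t in N. T f t = T g t + T h t"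
        using Lp_bounded_cong[OF T p q1 f Lfun_add[OF p gL hL] fgh] Lp_boundedD(2)[OF T gL hL]
        by eventually_elim simp
      have pt: "AE t in N. \<bar>T f t\<bar> powr q \<le> H2 powr (q - p) * \<bar>T f t\<bar> powr p + 2 powr q * \<bar>T h t\<bar> powr q"
        using Tg Tf
      proof eventually_elim
        case (elim t)
        show ?case
        proof (cases "\<bar>T f t\<bar> \<le> H2")
          case True
          have "\<bar>T f t\<bar> powr q = \<bar>T f t\<bar> powr (q - p) * \<bar>T f t\<bar> powr p" by (simp flip: powr_add)
          also have "\<dots> \<le> H2 powr (q - p) * \<bar>T f t\<bar> powr p"
            using True q by (intro mult_right_mono powr_mono2) auto
          finally show ?thesis by (simp add: add_increasing2)
        next
          case False
          have "A * H \<le> (\<bar>A\<bar> + 1) * H" using H by (intro mult_right_mono) auto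
          then have "2 * \<bar>T g t\<bar> \<le> H2" unfolding H2_def using elim(1) by linarith
          then have "\<bar>T f t\<bar> \<le> 2 * \<bar>T h t\<bar>" using False elim by linarith
          then have "\<bar>T f t\<bar> powr q \<le> (2 * \<bar>T h t\<bar>) powr q" using q0 by (intro powr_mono2) auto
          then show ?thesis by (simp add: powr_mult add_increasing)
        qed
      qed
      have ints: "integrable N (\<lambda>t. \<bar>T f t\<bar> powr q)" "integrable N (\<lambda>t. \<bar>T f t\<bar> powr p)" "integrable N (\<lambda>t. \<bar>T h t\<bar> powr q)"
        using Lp_boundedD(1)[OF T f] Lp_boundedD(1)[OF T' f] Lp_boundedD(1)[OF T hL] by auto
      have "c powr q \<le> pnorm N q (T f) powr q" using fc c q0 by (intro powr_mono2) auto
      also have "\<dots> = (\<integral>t. \<bar>T f t\<bar> powr q \<partial>N)" using q0 by (rule pnorm_powr)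
      also have "\<dots> \<le> (\<integral>t. H2 powr (q - p) * \<bar>T f t\<bar> powr p + 2 powr q * \<bar>T h t\<bar> powr q \<partial>N)"
        using ints pt by (intro integral_mono_AE) auto
      also have "\<dots> = H2 powr (q - p) * pnorm N p (T f) powr p + 2 powr q * pnorm N q (T h) powr q"
        using ints p0 q0 by (simp add: pnorm_powr)
      also have "\<dots> \<le> H2 powr (q - p) * e powr p + 2 powr q * (C * pnorm M p h) powr q"
        using fe C(2)[OF hL] p0 q0 by (intro add_mono mult_left_mono powr_mono2) auto
      also have "\<dots> \<le> c powr q / 2 + C1 * pnorm M p h powr q"
      proof -
        have "(C * pnorm M p h) powr q \<le> ((C + 1) * pnorm M p h) powr q"
          using C q0 by (intro powr_mono2 mult_right_mono) auto
        also have "\<dots> = (C + 1) powr q * pnorm M p h powr q" using C by (simp add: powr_mult)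
        finally have "2 powr q * (C * pnorm M p h) powr q \<le> 2 powr q * ((C + 1) powr q * pnorm M p h powr q)"
          by (intro mult_left_mono) auto
        then show ?thesis unfolding e(2) C1_def mult.assoc by linarith
      qed
      finally have "c powr q / 2 \<le> C1 * pnorm M p h powr q" by simp
      then have "c' powr (q / p) \<le> pnorm M p h powr q"
        unfolding c'(2) using C1 by (simp add: divide_le_eq mult.commute mult.left_commute)
      also have "\<dots> = (pnorm M p h powr p) powr (q / p)" using p0 by (simp add: powr_powr)
      finally have "c' \<le> pnorm M p h powr p"
        using powr_less_mono2[of "q/p" "pnorm M p h powr p" c'] divide_pos_pos[OF q0 p0]
        by (intro leI notI) simp
      also have "\<dots> = (\<integral>x. \<bar>h x\<bar> powr p \<partial>M)" using p0 by (rule pnorm_powr)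
      also have "\<dots> = (\<integral>x. indicator {x\<in>space M. H < \<bar>f x\<bar>} x * \<bar>f x\<bar> powr p \<partial>M)"
        by (intro Bochner_Integration.integral_cong refl) (auto simp: h_def indicator_def)
      finally show ?thesis .
    qed
    then show "\<exists>e>0. \<forall>f\<in>Lfun M p. c \<le> pnorm N q (T f) \<longrightarrow> pnorm N p (T f) \<le> e \<longrightarrow>
      c' \<le> (\<integral>x. indicator {x\<in>space M. H < \<bar>f x\<bar>} x * \<bar>f x\<bar> powr p \<partial>M)"
      using e(1) by blast
  qed
qed

text \<open>If \<open>T\<close> were an isomorphism on an infinite-dimensional subspace, one could add up \<open>n\<close> elements
  whose sum has norm at least of order \<open>n powr (1/p)\<close>, with images whose sum has norm at most of order
  \<open>n powr (1/q)\<close>.\<close>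

theorem strictly_singular_ae_lift:
  assumes finM: "finite_measure M" and finN: "finite_measure N"
    and p: "p \<ge> 1" and q: "p < q" and T: "Lp_bounded M p N q T" and T': "Lp_bounded M p N p T"
    and fa: "fin_approx M p N p T"
    and A: "\<And>f H. f \<in> borel_measurable M \<Longrightarrow> (\<And>x. \<bar>f x\<bar> \<le> H) \<Longrightarrow> AE t in N. \<bar>T f t\<bar> \<le> A * H" 
  shows "strictly_singular (Lp M p) (Lp N q) (ae_lift N T)"
  unfolding strictly_singular_def
proof (intro conjI allI impI notI; (elim conjE)?)
  have p0: "p > 0" and q0: "q > 0" and q1: "q \<ge> 1" using p q by auto
  show "bounded_operator (Lp M p) (Lp N q) (ae_lift N T)" by (rule bounded_operator_ae_lift[OF T p q1])
  note lift = ae_lift_Lfun[OF T p q1]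
  fix E assume E: "vsubspace (Lp M p) E" and inf: "infinite_dimensional (Lp M p) E" 
    and iso: "isomorphism (Lp M p\<lparr>vcarrier := E\<rparr>) (Lp N q\<lparr>vcarrier := ae_lift N T ` E\<rparr>) (ae_lift N T)"
  define V where "V = {f \<in> Lfun M p. ae_class M f \<in> E}"
  have Vadd: "(\<lambda>x. f x + s * g x) \<in> V" if "f \<in> V" "g \<in> V" for f g s
  proof -
    have "vadd (Lp M p) (ae_class M f) (vscale (Lp M p) s (ae_class M g)) \<in> E" 
      using that E by (auto simp: vsubspace_def V_def)
    then show ?thesis using that p by (auto simp: V_def Lfun_add Lfun_scale LfunD(1))
  qed
  have VL: "f \<in> Lfun M p" if "f \<in> V" for f using that by (auto simp: V_def)
  \<comment> \<open>Boundedness of the inverse, read on representatives: T is bounded below on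
    V.\<close>
  obtain C0 where C0: "0 < C0" "\<And>f. f \<in> V \<Longrightarrow> pnorm M p f \<le> C0 * pnorm N q (T f)"
  proof -
    from iso have inj: "inj_on (ae_lift N T) E" by (auto simp: isomorphism_def bij_betw_def)
    from iso have "\<exists>C. \<forall>G\<in>ae_lift N T ` E. 
        vnorm (Lp M p) (inv_into E (ae_lift N T) G) \<le> C * vnorm (Lp N q) G"
      by (simp add: isomorphism_def bounded_operator_def)
    then obtain C where C: "\<And>G. G \<in> ae_lift N T ` E \<Longrightarrow> 
        vnorm (Lp M p) (inv_into E (ae_lift N T) G) \<le> C * vnorm (Lp N q) G"
      by blast
    have "pnorm M p f \<le> max C 1 * pnorm N q (T f)" if f: "f \<in> V" for f
    proof -
      have "pnorm M p f \<le> C * pnorm N q (T f)"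
        using C[OF imageI, of "ae_class M f"] f inv_into_f_f[OF inj, of "ae_class M f"] LfunD(1)[OF VL[OF f]] 
          LfunD(1)[OF Lp_boundedD(1)[OF T VL[OF f]]]
        by (simp add: V_def lift)
      also have "\<dots> \<le> max C 1 * pnorm N q (T f)" by (intro mult_right_mono) auto
      finally show ?thesis .
    qed
    then show ?thesis by (intro that[of "max C 1"]) auto
  qed
  obtain C where C: "0 \<le> C" "\<And>f. f \<in> Lfun M p \<Longrightarrow> pnorm N q (T f) \<le> C * pnorm M p f"
    using Lp_bounded_bound[OF T] by blast
  define c where "c = 1 / C0"
  have c: "0 < c" using C0 by (simp add: c_def)
  obtain c' where c': "0 < c'" "\<And>H. 0 < H \<Longrightarrow> \<exists>e>0. \<forall>f\<in>Lfun M p. c \<le> pnorm N q (T f) \<longrightarrow> pnorm N p (T f) \<le> e \<longrightarrow>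
      c' \<le> (\<integral>x. indicator {x\<in>space M. H < \<bar>f x\<bar>} x * \<bar>f x\<bar> powr p \<partial>M)"
    using pnorm_large_values[OF p q T T' A c] by blast
  define D where "D = 2 + 2 powr q * C powr q"
  have D: "0 < D" by (simp add: D_def add_pos_nonneg)
  \<comment> \<open>A unit vector of E annihilated by the functionals that control T up to e; it
    exists because E has infinite dimension.\<close>
  have small: "\<exists>f\<in>V. pnorm M p f = 1 \<and> pnorm N p (T f) \<le> e" if e: "0 < e" for e
  proof -
    obtain K :: nat and \<phi> B where B: 
      "\<And>i f g. f \<in> Lfun M p \<Longrightarrow> g \<in> Lfun M p \<Longrightarrow> \<phi> i (\<lambda>x. f x + g x) = (\<phi> i f + \<phi> i g :: real)"
      "\<And>i a f. f \<in> Lfun M p \<Longrightarrow> \<phi> i (\<lambda>x. a * f x) = a * \<phi> i f"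
      "\<And>f. f \<in> Lfun M p \<Longrightarrow> pnorm N p (T f) \<le> e * pnorm M p f + B * (\<Sum>i<K. \<bar>\<phi> i f\<bar>)"
      by (rule fin_approxE[OF fa e]) blast
    obtain f where f: "f \<in> Lfun M p" "ae_class M f \<in> E" "pnorm M p f = 1" "\<And>i. i < K \<Longrightarrow> \<phi> i f = 0"
      using infinite_dimensional_kernel[where \<phi> = \<phi> and K = K, OF p E inf B(1,2)] by blast
    then show ?thesis using B(3)[OF f(1)] by (intro bexI[of _ f]) (auto simp: V_def)
  qed
  \<comment> \<open>Order of choices: H and e2 depend on the current sum S, e1 depends on H, and the
    new summand f is taken last, small enough for both. Its sign comes from the lower estimate; the
    upper estimate holds for either sign.\<close>
  have step: "\<exists>S'\<in>V. pnorm M p S powr p + c' / 2 \<le> pnorm M p S' powr p \<and> 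
      pnorm N q (T S') powr q \<le> pnorm N q (T S) powr q + D" if S: "S \<in> V" for S
  proof -
    have TS: "T S \<in> Lfun N q" using Lp_boundedD(1)[OF T VL[OF S]] .
    obtain H where H: "0 < H" "\<And>f. f \<in> Lfun M p \<Longrightarrow> pnorm M p f = 1 \<Longrightarrow>
        c' \<le> (\<integral>x. indicator {x\<in>space M. H < \<bar>f x\<bar>} x * \<bar>f x\<bar> powr p \<partial>M) \<Longrightarrow>
        \<exists>s\<in>{1,-1}. pnorm M p S powr p + c' / 2 \<le> pnorm M p (\<lambda>x. S x + s * f x) powr p"
      by (rule pnorm_increase[OF finM p VL[OF S] c'(1)]) blast
    obtain e1 where e1: "0 < e1" "\<And>f. f \<in> Lfun M p \<Longrightarrow> c \<le> pnorm N q (T f) \<Longrightarrow> pnorm N p (T f) \<le> e1 \<Longrightarrow>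
      c' \<le> (\<integral>x. indicator {x\<in>space M. H < \<bar>f x\<bar>} x * \<bar>f x\<bar> powr p \<partial>M)"
      using c'(2)[OF H(1)] by blast
    obtain e2 where e2: "0 < e2" "\<And>g. g \<in> Lfun N q \<Longrightarrow> g \<in> Lfun N p \<Longrightarrow> pnorm N p g \<le> e2 \<Longrightarrow> 
        pnorm N q (\<lambda>x. T S x + g x) powr q \<le> pnorm N q (T S) powr q + 2 + 2 powr q * pnorm N q g powr q"
      by (rule pnorm_increase_bounded[OF finN p q1 TS]) blast
    obtain f where f: "f \<in> V" "pnorm M p f = 1" "pnorm N p (T f) \<le> min e1 e2"
      using small[of "min e1 e2"] e1 e2 by auto
    have fL: "f \<in> Lfun M p" using VL f by blast
    have "c \<le> pnorm N q (T f)" using C0(2)[OF f(1)] C0(1) f(2) by (simp add: c_def field_simps)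
    then have "\<exists>s\<in>{1,-1}. pnorm M p S powr p + c' / 2 \<le> pnorm M p (\<lambda>x. S x + s * f x) powr p"
      using f(3) by (intro H(2)[OF fL f(2) e1(2)[OF fL]]) auto
    then obtain s where s: "s \<in> {1,-1}" "pnorm M p S powr p + c' / 2 \<le> pnorm M p (\<lambda>x. S x + s * f x) powr p"
      by blast
    have s1: "\<bar>s\<bar> = 1" using s by auto
    have TL: "T f \<in> Lfun N q" "T f \<in> Lfun N p" using Lp_boundedD(1)[OF T fL] Lp_boundedD(1)[OF T' fL] .
    note [measurable] = LfunD(1)[OF TL(1)] LfunD(1)[OF TS]
    have "AE t in N. T (\<lambda>x. S x + s * f x) t = T S t + s * T f t"
      using Lp_boundedD(2)[OF T VL[OF S] Lfun_scale[OF fL, of s]] Lp_boundedD(3)[OF T fL, of s] 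
      by eventually_elim simp
    moreover have "T (\<lambda>x. S x + s * f x) \<in> borel_measurable N" 
      using Lp_boundedD(1)[OF T VL[OF Vadd[OF S f(1)]]] by auto
    ultimately have "pnorm N q (T (\<lambda>x. S x + s * f x)) = pnorm N q (\<lambda>t. T S t + s * T f t)"
      using TL TS by (intro pnorm_cong_AE) auto
    also have "\<dots> powr q \<le> pnorm N q (T S) powr q + 2 + 2 powr q * pnorm N q (\<lambda>t. s * T f t) powr q"
      by (rule e2(2)[OF Lfun_scale[OF TL(1)] Lfun_scale[OF TL(2)]]) (use f(3) s1 p0 in \<open>simp add: pnorm_scale\<close>)
    also have "pnorm N q (\<lambda>t. s * T f t) \<le> C" using s1 q0 C(2)[OF fL] f(2) by (simp add: pnorm_scale)
    then have "2 powr q * pnorm N q (\<lambda>t. s * T f t) powr q \<le> 2 powr q * C powr q" 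
      using q0 by (intro mult_left_mono powr_mono2) auto
    then have "pnorm N q (T S) powr q + 2 + 2 powr q * pnorm N q (\<lambda>t. s * T f t) powr q \<le> pnorm N q (T S) powr q + D"
      by (simp add: D_def)
    finally show ?thesis using s(2) Vadd[OF S f(1), of s] by (intro bexI[of _ "\<lambda>x. S x + s * f x"]) auto
  qed
  have seq: "\<exists>S\<in>V. real n * (c' / 2) \<le> pnorm M p S powr p \<and> 
      pnorm N q (T S) powr q \<le> pnorm N q (T (\<lambda>_. 0)) powr q + real n * D" for n
  proof (induction n)
    case 0
    have "vzero (Lp M p) \<in> E" using E by (simp add: vsubspace_def)
    then have "(\<lambda>_. 0) \<in> V" using p by (simp add: V_def Lfun_def)
    then show ?case by (intro bexI[of _ "\<lambda>_. 0"]) auto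
  next
    case (Suc n)
    then obtain S where S: "S \<in> V" "real n * (c' / 2) \<le> pnorm M p S powr p" 
      "pnorm N q (T S) powr q \<le> pnorm N q (T (\<lambda>_. 0)) powr q + real n * D" by blast
    from step[OF S(1)] S(2,3) show ?case by (force simp: algebra_simps add_divide_distrib)
  qed
  define a where "a = pnorm N q (T (\<lambda>_. 0)) powr q"
  have "(real n * (c' / 2)) powr (1/p) \<le> C0 * (a + real n * D) powr (1/q)" for n
  proof -
    obtain S where S: "S \<in> V" "real n * (c' / 2) \<le> pnorm M p S powr p" 
      "pnorm N q (T S) powr q \<le> a + real n * D" using seq[of n] by (auto simp: a_def)
    have "(real n * (c' / 2)) powr (1/p) \<le> (pnorm M p S powr p) powr (1/p)"
      using S(2) c'(1) p0 by (intro powr_mono2) auto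
    also have "\<dots> = pnorm M p S" using p0 by (simp add: powr_powr)
    also have "\<dots> \<le> C0 * pnorm N q (T S)" by (rule C0(2)[OF S(1)])
    also have "pnorm N q (T S) = (pnorm N q (T S) powr q) powr (1/q)" using q0 by (simp add: powr_powr)
    also have "C0 * \<dots> \<le> C0 * (a + real n * D) powr (1/q)"
      using S(3) C0(1) q0 by (intro mult_left_mono powr_mono2) auto
    finally show ?thesis .
  qed
  \<comment> \<open>Here p < q enters: growth of order \<open>n powr (1/q)\<close> is eventually
    overtaken by \<open>n powr (1/p)\<close>.\<close>
  moreover have "\<forall>\<^sub>F n in sequentially. C0 * (a + real n * D) powr (1/q) < (real n * (c' / 2)) powr (1/p)"
  proof -
    have a0: "a \<ge> 0" by (simp add: a_def)
    have lim: "(\<lambda>n. C0 * (a + D) powr (1/q) * real n powr (1/q - 1/p)) \<longlonglongrightarrow> C0 * (a + D) powr (1/q) * 0"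
      using q p0 by (intro tendsto_intros tendsto_neg_powr filterlim_real_sequentially) (auto simp: field_simps)
    have "\<forall>\<^sub>F n in sequentially. C0 * (a + D) powr (1/q) * real n powr (1/q - 1/p) < (c' / 2) powr (1/p)"
      using c'(1) by (intro order_tendstoD(2)[OF lim]) auto
    then show ?thesis using eventually_gt_at_top[of 0]
    proof eventually_elim
      case (elim n)
      have "C0 * (a + real n * D) powr (1/q) \<le> C0 * (real n * (a + D)) powr (1/q)"
      proof (intro mult_left_mono powr_mono2)
        have "a * 1 \<le> a * real n" using elim a0 by (intro mult_left_mono) auto
        then show "a + real n * D \<le> real n * (a + D)" by (simp add: algebra_simps)
      qed (use C0 q0 a0 D in auto)
      also have "\<dots> = C0 * (a + D) powr (1/q) * real n powr (1/q - 1/p) * real n powr (1/p)"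
        using elim a0 D by (simp add: powr_mult flip: powr_add)
      also have "\<dots> < (c' / 2) powr (1/p) * real n powr (1/p)"
        using elim by (intro mult_strict_right_mono) auto
      also have "\<dots> = (real n * (c' / 2)) powr (1/p)" by (simp add: powr_mult[symmetric] mult.commute)
      finally show ?case .
    qed
  qed
  ultimately have "\<forall>\<^sub>F n in sequentially. False" by (auto elim!: eventually_mono simp: not_le[symmetric])
  then show False by simp
qed

section \<open>Power kernels and geometric sums\<close>

text \<open>Integrating the tangent line inequality \<open>p * k powr (p - 1) * h \<le> h powr p + (p - 1) * k powr p\<close>
  against the weight \<open>w\<close>, with the optimal constant \<open>k\<close>.\<close>

lemma tangent_powr_le:
  fixes h k :: real
  assumes "p \<ge> 1" "0 \<le> h" "0 < k"
  shows "p * k powr (p - 1) * h \<le> h powr p + (p - 1) * k powr p"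
proof (cases "h = 0 \<or> p = 1")
  case True then show ?thesis using assms by auto
next
  case False
  define q where "q = p / (p - 1)"
  have p1: "p > 1" using False assms by auto
  have "h * k powr (p - 1) \<le> h powr p / p + (k powr (p - 1)) powr q / q"
    using assms p1 False by (intro Youngs_inequality) (auto simp: q_def field_simps)
  also have "(k powr (p - 1)) powr q = k powr p" using p1 by (simp add: powr_powr q_def)
  finally have "p * (h * k powr (p - 1)) \<le> p * (h powr p / p + k powr p / q)"
    using p1 by (intro mult_left_mono) auto
  moreover have "p * (h powr p / p + k powr p / q) = h powr p + (p - 1) * k powr p"
    using p1 by (simp add: q_def field_simps)
  ultimately show ?thesis by (simp add: ac_simps)
qed

text \<open>Hoelder's inequality for the measure with density w, in extended nonnegative integrals,
  so that finiteness of the left side is a conclusion.\<close>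

lemma weighted_power_mean:
  fixes w h :: "'a \<Rightarrow> real"
  assumes p: "p \<ge> 1" and [measurable]: "w \<in> borel_measurable M" "h \<in> borel_measurable M"
    and nn: "\<And>x. 0 \<le> w x" "\<And>x. 0 \<le> h x"
    and A: "(\<integral>\<^sup>+x. ennreal (w x) \<partial>M) \<le> ennreal A" "0 < A"
    and X: "(\<integral>\<^sup>+x. ennreal (w x * h x powr p) \<partial>M) \<le> ennreal X" "0 \<le> X"
  shows "(\<integral>\<^sup>+x. ennreal (w x * h x) \<partial>M) \<le> ennreal (A powr (1 - 1/p) * X powr (1/p))"
proof -
  have p0: "p > 0" using p by simp
  have main: "(\<integral>\<^sup>+x. ennreal (w x * h x) \<partial>M) \<le> ennreal (A powr (1 - 1/p) * Y powr (1/p))" if Y: "X \<le> Y" "0 < Y" for Y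
  proof -
    \<comment> \<open>For the constant function h = k the bounds A and Y would both be attained,
      which makes this the optimal tangent point. It has to be positive, so X = 0 is reached by
      letting Y tend to 0.\<close>
    define k where "k = (Y / A) powr (1/p)"
    have k: "0 < k" "k powr p = Y / A" using Y A p0 by (auto simp: k_def powr_powr)
    have "ennreal (p * k powr (p - 1)) * (\<integral>\<^sup>+x. ennreal (w x * h x) \<partial>M) 
        = (\<integral>\<^sup>+x. ennreal (p * k powr (p - 1)) * ennreal (w x * h x) \<partial>M)"
      by (rule nn_integral_cmult[symmetric]) measurable
    also have "\<dots> \<le> (\<integral>\<^sup>+x. ennreal (w x * h x powr p) + ennreal ((p - 1) * k powr p) * ennreal (w x) \<partial>M)"
    proof (rule nn_integral_mono)
      fix x
      have "p * k powr (p - 1) * (w x * h x) = w x * (p * k powr (p - 1) * h x)" by (simp add: ac_simps)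
      also have "\<dots> \<le> w x * (h x powr p + (p - 1) * k powr p)"
        using nn p k by (intro mult_left_mono tangent_powr_le) auto
      also have "\<dots> = w x * h x powr p + (p - 1) * k powr p * w x" by (simp add: algebra_simps)
      finally show "ennreal (p * k powr (p - 1)) * ennreal (w x * h x) \<le> ennreal (w x * h x powr p) + ennreal ((p - 1) * k powr p) * ennreal (w x)"
        using nn p by (simp add: ennreal_mult[symmetric] ennreal_plus[symmetric] del: ennreal_plus)
    qed
    also have "\<dots> = (\<integral>\<^sup>+x. ennreal (w x * h x powr p) \<partial>M) + ennreal ((p - 1) * k powr p) * (\<integral>\<^sup>+x. ennreal (w x) \<partial>M)"
      by (simp add: nn_integral_add nn_integral_cmult)
    also have "\<dots> \<le> ennreal Y + ennreal ((p - 1) * k powr p) * ennreal A"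
      using X(1) Y by (intro add_mono mult_left_mono A order_trans[OF X(1)] ennreal_leI) auto
    also have "\<dots> = ennreal (Y + (p - 1) * (Y / A) * A)"
      using p A Y by (simp add: ennreal_mult[symmetric] ennreal_plus[symmetric] k(2) del: ennreal_plus)
    also have "Y + (p - 1) * (Y / A) * A = p * Y"
    proof -
      have "(p - 1) * (Y / A) * A = (p - 1) * Y" using A by simp
      then show ?thesis by (simp add: left_diff_distrib)
    qed
    finally have le: "ennreal (p * k powr (p - 1)) * (\<integral>\<^sup>+x. ennreal (w x * h x) \<partial>M) \<le> ennreal (p * Y)" .
    have "(\<integral>\<^sup>+x. ennreal (w x * h x) \<partial>M) = ennreal (1 / (p * k powr (p - 1))) * (ennreal (p * k powr (p - 1)) * (\<integral>\<^sup>+x. ennreal (w x * h x) \<partial>M))"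
      using p k by (simp add: mult.assoc[symmetric] ennreal_mult[symmetric])
    also have "\<dots> \<le> ennreal (1 / (p * k powr (p - 1))) * ennreal (p * Y)"
      by (intro mult_left_mono le) auto
    also have "\<dots> = ennreal (Y / k powr (p - 1))"
      using p k Y by (simp add: ennreal_mult[symmetric])
    also have "Y / k powr (p - 1) = A powr (1 - 1/p) * Y powr (1/p)"
    proof -
      have "k powr (p - 1) = Y powr (1 - 1/p) / A powr (1 - 1/p)"
        using Y A p0 by (simp add: k_def powr_powr powr_divide diff_divide_distrib)
      moreover have "Y = Y powr (1 - 1/p) * Y powr (1/p)" using Y by (simp flip: powr_add)
      ultimately have "Y / k powr (p - 1) = (Y powr (1 - 1/p) * Y powr (1/p)) / (Y powr (1 - 1/p) / A powr (1 - 1/p))"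
        by simp
      then show ?thesis using Y by simp
    qed
    finally show ?thesis .
  qed
  show ?thesis
  proof (cases "X = 0")
    case False then show ?thesis using main[of X] X by simp
  next
    case True
    have "(\<integral>\<^sup>+x. ennreal (w x * h x) \<partial>M) \<le> 0"
    proof (rule tendsto_lowerbound)
      show "((\<lambda>Y. ennreal (A powr (1 - 1/p) * Y powr (1/p))) \<longlongrightarrow> 0) (at_right 0)"
      proof -
        have "((\<lambda>Y. A powr (1 - 1/p) * Y powr (1/p)) \<longlongrightarrow> A powr (1 - 1/p) * 0 powr (1/p)) (at_right 0)"
          using p0 by (intro tendsto_intros tendsto_powr2) (auto simp: eventually_at_right_field intro!: exI[of _ 1])
        then have "((\<lambda>Y. ennreal (A powr (1 - 1/p) * Y powr (1/p))) \<longlongrightarrow> ennreal (A powr (1 - 1/p) * 0 powr (1/p))) (at_right 0)"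
          by (rule tendsto_ennrealI)
        then show ?thesis by simp
      qed
      show "\<forall>\<^sub>F Y in at_right 0. (\<integral>\<^sup>+x. ennreal (w x * h x) \<partial>M) \<le> ennreal (A powr (1 - 1/p) * Y powr (1/p))"
        using main True by (auto simp: eventually_at_right_field intro!: exI[of _ 1])
    qed auto
    then show ?thesis using True by simp
  qed
qed

section \<open>Geometric sums and decomposition into layers\<close>

lemma term_le_suminf_ennreal: "f j \<le> (\<Sum>i. f i :: ennreal)"
  using sum_le_suminf[of f "{j}"] by simp

text \<open>An increasing geometric sum is comparable to its last term, which the condition
  \<open>b powr j < a\<close> keeps below \<open>a powr k\<close>. The induction closes because K
  solves \<open>K * b powr - k + 1 = K\<close>.\<close>

lemma geometric_sum_below:
  fixes a b k :: real
  assumes b: "1 < b" and k: "0 < k" and a: "0 \<le> a"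
  shows "(\<Sum>j. ennreal (if b powr j < a then b powr (k * j) else 0)) \<le> ennreal (1 / (1 - b powr - k) * a powr k)"
proof -
  define K where "K = 1 / (1 - b powr - k)"
  have bk: "b powr - k < 1" using powr_less_mono[of "-k" 0 b] b k by simp
  have K: "0 < K" "K * b powr - k + 1 = K" using bk by (auto simp: K_def field_simps)
  \<comment> \<open>The subtraction \<open>real n - 1\<close> is real: for n = 0 the base of the
    bound is \<open>b powr - 1\<close>. The minimum with a stops the bound once summands
    vanish.\<close>
  have S: "(\<Sum>j<n. if b powr real j < a then b powr (k * j) else 0) \<le> K * (min a (b powr (real n - 1))) powr k" for n
  proof (induction n)
    case 0 show ?case using K by simp
  next
    case (Suc n)
    show ?case
    proof (cases "b powr real n < a")
      case True
      have "b powr (real n - 1) \<le> b powr real n" using b by (intro powr_mono) auto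
      then have m: "min a (b powr (real n - 1)) = b powr (real n - 1)" "min a (b powr (real (Suc n) - 1)) = b powr real n"
        using True by auto
      have "(\<Sum>j<Suc n. if b powr real j < a then b powr (k * j) else 0) \<le> K * (b powr (real n - 1)) powr k + b powr (k * n)"
        using Suc True m by simp
      also have "(b powr (real n - 1)) powr k = b powr (k * n) * b powr - k"
        by (simp add: powr_powr algebra_simps flip: powr_add)
      also have "K * (b powr (k * n) * b powr - k) + b powr (k * n) = b powr (k * n) * (K * b powr - k + 1)"
        by (simp add: algebra_simps)
      also have "\<dots> = K * (b powr real n) powr k" unfolding K by (simp add: powr_powr mult.commute)
      finally show ?thesis unfolding m .
    next
      case False
      have "b powr (real n - 1) \<le> b powr real n" using b by (intro powr_mono) auto
      then have "K * (min a (b powr (real n - 1))) powr k \<le> K * (min a (b powr (real (Suc n) - 1))) powr k"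
        using K a k by (intro mult_left_mono powr_mono2) auto
      then show ?thesis using Suc False by simp
    qed
  qed
  have "(\<Sum>j<n. ennreal (if b powr real j < a then b powr (k * j) else 0)) \<le> ennreal (K * a powr k)" for n
  proof -
    have "(\<Sum>j<n. ennreal (if b powr real j < a then b powr (k * j) else 0)) 
       = ennreal (\<Sum>j<n. if b powr real j < a then b powr (k * j) else 0)" by (intro sum_ennreal) auto
    also have "\<dots> \<le> ennreal (K * a powr k)"
      using S[of n] K a k by (intro ennreal_leI order_trans[OF S] mult_left_mono powr_mono2) auto
    finally show ?thesis .
  qed
  then show ?thesis unfolding K_def[symmetric] by (intro suminf_le_const) auto
qed

text \<open>A decreasing geometric sum is comparable to its first term. Partial sums are bounded in
  telescoping form, and \<open>max 0\<close> covers the indices before the first nonzero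
  summand.\<close>

lemma geometric_sum_above:
  fixes a b k :: real
  assumes b: "1 < b" and k: "0 < k" and a: "0 < a"
  shows "(\<Sum>j. ennreal (if a \<le> b powr j then b powr (- k * j) else 0)) \<le> ennreal (1 / (1 - b powr - k) * a powr - k)"
proof -
  define K where "K = 1 / (1 - b powr - k)"
  have bk: "b powr - k < 1" using powr_less_mono[of "-k" 0 b] b k by simp
  have K: "0 < K" "K * (1 - b powr - k) = 1" using bk by (auto simp: K_def)
  have S: "(\<Sum>j<n. if a \<le> b powr real j then b powr (- k * j) else 0) \<le> K * max 0 (a powr - k - b powr (- k * n))" for n
  proof (induction n)
    case 0 show ?case using K by simp
  next
    case (Suc n)
    have e: "b powr (- k * real (Suc n)) = b powr (- k * n) * b powr - k" by (simp add: algebra_simps flip: powr_add)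
    have le: "b powr (- k * real (Suc n)) \<le> b powr (- k * n)" using b k by (intro powr_mono) auto
    show ?case
    proof (cases "a \<le> b powr real n")
      case True
      have "b powr (- k * n) = (b powr real n) powr - k" by (simp add: powr_powr mult.commute)
      also have "\<dots> \<le> a powr - k" using True a k by (intro powr_mono2') auto
      finally have m: "b powr (- k * n) \<le> a powr - k" .
      have "(\<Sum>j<Suc n. if a \<le> b powr real j then b powr (- k * j) else 0) \<le> K * (a powr - k - b powr (- k * n)) + b powr (- k * n)"
        using Suc True m by simp
      also have "\<dots> = K * (a powr - k - b powr (- k * n)) + K * (1 - b powr - k) * b powr (- k * n)" unfolding K by simp
      also have "\<dots> = K * (a powr - k - b powr (- k * real (Suc n)))" unfolding e by (simp add: algebra_simps)
      also have "\<dots> \<le> K * max 0 (a powr - k - b powr (- k * real (Suc n)))" using K by (intro mult_left_mono) auto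
      finally show ?thesis .
    next
      case False
      have "K * max 0 (a powr - k - b powr (- k * n)) \<le> K * max 0 (a powr - k - b powr (- k * real (Suc n)))"
        using K le by (intro mult_left_mono) auto
      then show ?thesis using Suc False by simp
    qed
  qed
  have "(\<Sum>j<n. ennreal (if a \<le> b powr real j then b powr (- k * j) else 0)) \<le> ennreal (K * a powr - k)" for n
  proof -
    have "(\<Sum>j<n. ennreal (if a \<le> b powr real j then b powr (- k * j) else 0)) 
       = ennreal (\<Sum>j<n. if a \<le> b powr real j then b powr (- k * j) else 0)" by (intro sum_ennreal) auto
    also have "\<dots> \<le> ennreal (K * a powr - k)"
      using K a k by (intro ennreal_leI order_trans[OF S] mult_left_mono) auto
    finally show ?thesis .
  qed
  then show ?thesis unfolding K_def[symmetric] by (intro suminf_le_const) auto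
qed

lemma ex_powr_between:
  fixes b g :: real
  assumes b: "1 < b" and g: "1 < g"
  obtains j :: nat where "b powr j < g" "g \<le> b powr (real j + 1)"
proof -
  obtain n where n: "g < b ^ n" using real_arch_pow[OF b] by blast
  define m where "m = (LEAST n. g \<le> b ^ n)"
  have m: "g \<le> b ^ m" unfolding m_def by (rule LeastI[of _ n]) (use n in simp)
  have "m \<noteq> 0" using m g by (intro notI) simp
  then obtain j where j: "m = Suc j" by (cases m) auto
  have "\<not> g \<le> b ^ j" using not_less_Least[of j "\<lambda>n. g \<le> b ^ n"] j by (simp add: m_def)
  then show ?thesis using b m j powr_realpow[of b j] powr_realpow[of b "Suc j"]
    by (intro that[of j]) (auto simp: add.commute)
qed

text \<open>The top layer below g already dominates \<open>g powr q\<close>, and the leading 1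
  covers g at most 1. Writing the bound as a sum over all layers makes it integrable term by term
  over level sets.\<close>

lemma powr_le_layer_sum:
  fixes b g q :: real
  assumes b: "1 < b" and q: "0 < q" and g: "0 \<le> g"
  shows "ennreal (g powr q) \<le> 1 + (\<Sum>j. ennreal (if b powr j < g then b powr (q * (real j + 1)) else 0))"
proof (cases "g \<le> 1")
  case True
  then have "g powr q \<le> 1" using powr_mono2[of q g 1] q g by simp
  then have "ennreal (g powr q) \<le> 1" by (simp add: ennreal_le_1)
  then show ?thesis by (rule order_trans) simp
next
  case False
  then obtain j :: nat where j: "b powr j < g" "g \<le> b powr (real j + 1)" using ex_powr_between[OF b] by (metis not_le)
  have "ennreal (g powr q) \<le> ennreal ((b powr (real j + 1)) powr q)" using j g q by (intro ennreal_leI powr_mono2) auto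
  also have "\<dots> = ennreal (if b powr j < g then b powr (q * (real j + 1)) else 0)" using j by (simp add: powr_powr mult.commute)
  also have "\<dots> \<le> (\<Sum>j. ennreal (if b powr j < g then b powr (q * (real j + 1)) else 0))"
    by (rule term_le_suminf_ennreal[of "\<lambda>j. ennreal (if b powr j < g then b powr (q * (real j + 1)) else 0)" j])
  also have "\<dots> \<le> 1 + \<dots>" by simp
  finally show ?thesis .
qed

section \<open>Power kernels against measures with controlled balls\<close>

lemma one_less_two_real: "(1::real) < 2"
  by simp

text \<open>On the annulus between \<open>R / 2 ^ Suc i\<close> and \<open>R / 2 ^ i\<close> the
  kernel and the mass of the ball multiply to a geometric term of ratio
  \<open>2 powr (s - \<beta>)\<close>, which is less than 1. The measure is arbitrary since Lebesgue
  measure (\<beta> = 1) and N (\<beta> = \<open>al\<close>) are both used.\<close>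

lemma nn_integral_kernel_near:
  fixes \<nu> :: "real measure"
  assumes id[measurable]: "(\<lambda>x. x) \<in> borel_measurable \<nu>" 
    and ball: "\<And>r. 0 < r \<Longrightarrow> emeasure \<nu> {x\<in>space \<nu>. \<bar>t - x\<bar> < r} \<le> ennreal (C * r powr \<beta>)"
    and C: "0 \<le> C" and s: "0 < s" "s < \<beta>" and R: "0 < R"
  shows "(\<integral>\<^sup>+x. ennreal (if \<bar>t - x\<bar> < R then \<bar>t - x\<bar> powr - s else 0) \<partial>\<nu>) 
     \<le> ennreal (C * 2 powr s / (1 - 2 powr (s - \<beta>)) * R powr (\<beta> - s))"
proof -
  define a where "a i = (R / 2 ^ Suc i) powr - s" for i :: nat
  define B where "B i = {x\<in>space \<nu>. \<bar>t - x\<bar> < R / 2 ^ i}" for i :: nat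
  have [measurable]: "B i \<in> sets \<nu>" for i unfolding B_def by measurable
  have r: "2 powr (s - \<beta>) < 1" using powr_less_mono[of "s - \<beta>" 0 2] s by simp
  have "(\<integral>\<^sup>+x. ennreal (if \<bar>t - x\<bar> < R then \<bar>t - x\<bar> powr - s else 0) \<partial>\<nu>) \<le> (\<integral>\<^sup>+x. (\<Sum>i. ennreal (a i) * indicator (B i) x) \<partial>\<nu>)"
  proof (rule nn_integral_mono)
    fix x assume x: "x \<in> space \<nu>"
    show "ennreal (if \<bar>t - x\<bar> < R then \<bar>t - x\<bar> powr - s else 0) \<le> (\<Sum>i. ennreal (a i) * indicator (B i) x)"
    \<comment> \<open>At x = t the integrand is 0, by the convention that 0 has power 0; no annulus
      contains this point.\<close>
    proof (cases "\<bar>t - x\<bar> < R \<and> x \<noteq> t")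
      case True
      then have d: "0 < \<bar>t - x\<bar>" by auto
      have "1 < R / \<bar>t - x\<bar>" using True d by simp
      then obtain j :: nat where j: "2 powr j < R / \<bar>t - x\<bar>" "R / \<bar>t - x\<bar> \<le> 2 powr (real j + 1)"
        by (rule ex_powr_between[OF one_less_two_real])
      have j1: "\<bar>t - x\<bar> < R / 2 ^ j" using j(1) d by (simp add: powr_realpow field_simps)
      have "(2::real) powr (real j + 1) = 2 ^ Suc j" using powr_realpow[of 2 "Suc j"] by (simp add: add.commute)
      then have j2: "R / 2 ^ Suc j \<le> \<bar>t - x\<bar>" using j(2) d by (simp add: field_simps)
      have "\<bar>t - x\<bar> powr - s \<le> a j" unfolding a_def using j2 R s by (intro powr_mono2') auto
      then have "ennreal (if \<bar>t - x\<bar> < R then \<bar>t - x\<bar> powr - s else 0) \<le> ennreal (a j) * indicator (B j) x"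
        using True j1 x by (auto simp: B_def intro: ennreal_leI)
      also have "\<dots> \<le> (\<Sum>i. ennreal (a i) * indicator (B i) x)"
        by (rule term_le_suminf_ennreal[of "\<lambda>i. ennreal (a i) * indicator (B i) x" j])
      finally show ?thesis .
    qed auto
  qed
  also have "\<dots> = (\<Sum>i. \<integral>\<^sup>+x. ennreal (a i) * indicator (B i) x \<partial>\<nu>)" by (rule nn_integral_suminf) measurable
  also have "\<dots> = (\<Sum>i. ennreal (a i) * emeasure \<nu> (B i))" by (simp add: nn_integral_cmult_indicator)
  also have "\<dots> \<le> (\<Sum>i. ennreal (C * 2 powr s * R powr (\<beta> - s) * (2 powr (s - \<beta>)) ^ i))"
  proof (rule suminf_le)
    fix i
    have "ennreal (a i) * emeasure \<nu> (B i) \<le> ennreal (a i) * ennreal (C * (R / 2 ^ i) powr \<beta>)"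
      unfolding B_def using R by (intro mult_left_mono ball) auto
    also have "\<dots> = ennreal (a i * (C * (R / 2 ^ i) powr \<beta>))"
      using C by (intro ennreal_mult[symmetric]) (auto simp: a_def)
    also have "a i * (C * (R / 2 ^ i) powr \<beta>) = C * 2 powr s * R powr (\<beta> - s) * (2 powr (s - \<beta>)) ^ i"
    proof -
      have pw: "(2::real) ^ i = 2 powr i" for i by (simp add: powr_realpow)
      have "a i = R powr - s * 2 powr (s * (real i + 1))"
        unfolding a_def pw using R by (simp add: powr_divide powr_powr powr_minus_divide mult.commute add.commute)
      moreover have "(R / 2 ^ i) powr \<beta> = R powr \<beta> * 2 powr (- \<beta> * real i)"
        unfolding pw using R by (simp add: powr_divide powr_powr powr_minus_divide mult.commute)
      moreover have "(2 powr (s - \<beta>)) ^ i = 2 powr ((s - \<beta>) * real i)" by (simp add: powr_realpow[symmetric] powr_powr)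
      ultimately show ?thesis using R by (simp add: algebra_simps powr_diff powr_add powr_minus_divide)
    qed
    finally show "ennreal (a i) * emeasure \<nu> (B i) \<le> ennreal (C * 2 powr s * R powr (\<beta> - s) * (2 powr (s - \<beta>)) ^ i)" .
  qed auto
  also have "\<dots> = ennreal (C * 2 powr s * R powr (\<beta> - s) * (1 / (1 - 2 powr (s - \<beta>))))"
    using C r by (intro suminf_ennreal_eq sums_mult geometric_sums) auto
  finally show ?thesis by (simp add: ac_simps)
qed

text \<open>The same decomposition outwards, with ratio \<open>2 powr (\<beta> - s)\<close>: the
  kernel now decays faster than the mass grows.\<close>

lemma nn_integral_kernel_far:
  fixes \<nu> :: "real measure"
  assumes id[measurable]: "(\<lambda>x. x) \<in> borel_measurable \<nu>" 
    and ball: "\<And>r. 0 < r \<Longrightarrow> emeasure \<nu> {x\<in>space \<nu>. \<bar>t - x\<bar> < r} \<le> ennreal (C * r powr \<beta>)"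
    and C: "0 \<le> C" and s: "0 \<le> \<beta>" "\<beta> < s" and R: "0 < R"
  shows "(\<integral>\<^sup>+x. ennreal (if R \<le> \<bar>t - x\<bar> then \<bar>t - x\<bar> powr - s else 0) \<partial>\<nu>) 
     \<le> ennreal (C * 4 powr \<beta> / (1 - 2 powr (\<beta> - s)) * R powr (\<beta> - s))"
proof -
  define a where "a i = (R * 2 powr i) powr - s" for i :: nat
  define B where "B i = {x\<in>space \<nu>. \<bar>t - x\<bar> < R * 2 powr (real i + 2)}" for i :: nat
  have [measurable]: "B i \<in> sets \<nu>" for i unfolding B_def by measurable
  have r: "2 powr (\<beta> - s) < 1" using powr_less_mono[of "\<beta> - s" 0 2] s by simp
  have "(\<integral>\<^sup>+x. ennreal (if R \<le> \<bar>t - x\<bar> then \<bar>t - x\<bar> powr - s else 0) \<partial>\<nu>) \<le> (\<integral>\<^sup>+x. (\<Sum>i. ennreal (a i) * indicator (B i) x) \<partial>\<nu>)"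
  proof (rule nn_integral_mono)
    fix x assume x: "x \<in> space \<nu>"
    show "ennreal (if R \<le> \<bar>t - x\<bar> then \<bar>t - x\<bar> powr - s else 0) \<le> (\<Sum>i. ennreal (a i) * indicator (B i) x)"
    proof (cases "R \<le> \<bar>t - x\<bar>")
      case True
      then have d: "0 < \<bar>t - x\<bar>" using R by auto
      have "1 < 2 * \<bar>t - x\<bar> / R" using True R by (simp add: field_simps)
      then obtain j :: nat where j: "2 powr j < 2 * \<bar>t - x\<bar> / R" "2 * \<bar>t - x\<bar> / R \<le> 2 powr (real j + 1)"
        by (rule ex_powr_between[OF one_less_two_real])
      \<comment> \<open>The available intervals are closed on the right, whereas the distance R
        itself has to be included on the left. Annuli of ratio 4 absorb the shift; this is the
        origin of \<open>4 powr \<beta>\<close>.\<close>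
      have "\<exists>i::nat. R * 2 powr i \<le> \<bar>t - x\<bar> \<and> \<bar>t - x\<bar> < R * 2 powr (real i + 2)"
      proof (cases j)
        case 0
        then have "\<bar>t - x\<bar> \<le> R" using j(2) R by (simp add: field_simps)
        then show ?thesis using True R by (intro exI[of _ 0]) auto
      next
        case (Suc i)
        have "R * 2 powr i \<le> \<bar>t - x\<bar>" using j(1) R by (simp add: Suc powr_add field_simps)
        moreover have "\<bar>t - x\<bar> \<le> R * 2 powr (real i + 1)" using j(2) R by (simp add: Suc powr_add field_simps)
        moreover have "R * 2 powr (real i + 1) < R * 2 powr (real i + 2)" using R by (intro mult_strict_left_mono powr_less_mono) auto
        ultimately show ?thesis by (intro exI[of _ i] conjI) linarith+
      qed
      then obtain i :: nat where i: "R * 2 powr i \<le> \<bar>t - x\<bar>" "\<bar>t - x\<bar> < R * 2 powr (real i + 2)" by blast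
      have "\<bar>t - x\<bar> powr - s \<le> a i" unfolding a_def using i R s by (intro powr_mono2') auto
      then have "ennreal (if R \<le> \<bar>t - x\<bar> then \<bar>t - x\<bar> powr - s else 0) \<le> ennreal (a i) * indicator (B i) x"
        using True i x by (auto simp: B_def intro: ennreal_leI)
      also have "\<dots> \<le> (\<Sum>i. ennreal (a i) * indicator (B i) x)"
        by (rule term_le_suminf_ennreal[of "\<lambda>i. ennreal (a i) * indicator (B i) x" i])
      finally show ?thesis .
    qed auto
  qed
  also have "\<dots> = (\<Sum>i. \<integral>\<^sup>+x. ennreal (a i) * indicator (B i) x \<partial>\<nu>)" by (rule nn_integral_suminf) measurable
  also have "\<dots> = (\<Sum>i. ennreal (a i) * emeasure \<nu> (B i))" by (simp add: nn_integral_cmult_indicator)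
  also have "\<dots> \<le> (\<Sum>i. ennreal (C * 4 powr \<beta> * R powr (\<beta> - s) * (2 powr (\<beta> - s)) ^ i))"
  proof (rule suminf_le)
    fix i
    have "ennreal (a i) * emeasure \<nu> (B i) \<le> ennreal (a i) * ennreal (C * (R * 2 powr (real i + 2)) powr \<beta>)"
      unfolding B_def using R by (intro mult_left_mono ball) auto
    also have "\<dots> = ennreal (a i * (C * (R * 2 powr (real i + 2)) powr \<beta>))"
      using C by (intro ennreal_mult[symmetric]) (auto simp: a_def)
    also have "a i * (C * (R * 2 powr (real i + 2)) powr \<beta>) = C * 4 powr \<beta> * R powr (\<beta> - s) * (2 powr (\<beta> - s)) ^ i"
    proof -
      have "a i = R powr - s * 2 powr (- s * real i)"
        unfolding a_def using R by (simp add: powr_mult powr_powr mult.commute)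
      moreover have "(R * 2 powr (real i + 2)) powr \<beta> = R powr \<beta> * (2 powr (\<beta> * real i) * 4 powr \<beta>)"
      proof -
        have "2 powr (real i + 2) = 2 powr i * (4::real)" by (simp add: powr_add)
        then show ?thesis using R by (simp add: powr_mult powr_powr mult.commute)
      qed
      moreover have "(2 powr (\<beta> - s)) ^ i = 2 powr ((\<beta> - s) * real i)" by (simp add: powr_realpow[symmetric] powr_powr)
      ultimately show ?thesis using R by (simp add: algebra_simps powr_diff powr_add powr_minus_divide)
    qed
    finally show "ennreal (a i) * emeasure \<nu> (B i) \<le> ennreal (C * 4 powr \<beta> * R powr (\<beta> - s) * (2 powr (\<beta> - s)) ^ i)" .
  qed auto
  also have "\<dots> = ennreal (C * 4 powr \<beta> * R powr (\<beta> - s) * (1 / (1 - 2 powr (\<beta> - s))))"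
    using C r by (intro suminf_ennreal_eq sums_mult geometric_sums) auto
  finally show ?thesis by (simp add: ac_simps)
qed

section \<open>Kernel estimates for regular measures\<close>

abbreviation unit_lebesgue :: "real measure" where
  "unit_lebesgue \<equiv> lebesgue_on {0<..<1}"

lemma finite_unit_lebesgue: "finite_measure unit_lebesgue"
  by (intro finite_measure_lebesgue_on) simp

lemma space_unit_lebesgue [simp]: "space unit_lebesgue = {0<..<1}"
  by simp

lemma id_borel_measurable_unit_lebesgue [measurable]: "(\<lambda>x. x) \<in> borel_measurable unit_lebesgue"
  by (intro measurable_restrict_space1 measurable_completion) simp

lemma emeasure_unit_lebesgue_ball:
  assumes "0 < r"
  shows "emeasure unit_lebesgue {u\<in>space unit_lebesgue. \<bar>t - u\<bar> < r} \<le> ennreal (2 * r powr 1)"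
proof -
  have "emeasure unit_lebesgue {u\<in>space unit_lebesgue. \<bar>t - u\<bar> < r} = emeasure lebesgue {u\<in>space unit_lebesgue. \<bar>t - u\<bar> < r}"
    by (rule emeasure_restrict_space) auto
  also have "\<dots> \<le> emeasure lebesgue {t - r<..<t + r}"
    by (intro emeasure_mono) auto
  also have "\<dots> = ennreal (2 * r)" using assms by simp
  finally show ?thesis using assms by simp
qed

lemma AE_unit_lebesgue_neq: "AE u in unit_lebesgue. u \<noteq> t"
proof -
  have "{t} \<in> null_sets lebesgue" by simp
  then have "AE u in lebesgue. u \<noteq> t" by (rule AE_I'[of "{t}"]) auto
  then have "AE u in lebesgue. u \<in> {0<..<1} \<longrightarrow> u \<noteq> t" by eventually_elim auto
  then show ?thesis by (simp add: AE_restrict_space_iff)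
qed

text \<open>Everything the analysis uses about the Hausdorff measure. Upper bounds are for arbitrary
  centres, because by Tonelli N is also integrated against kernels centred at points u off \<Omega>;
  lower bounds are for centres in \<Omega>.\<close>

locale regular_measure =
  fixes N :: "real measure" and \<Omega> :: "real set" and al c C lam :: real
  assumes sets_N [measurable_cong]: "sets N = sets (restrict_space borel \<Omega>)"
    and space_N [simp]: "space N = \<Omega>"
    and Om_sub: "\<Omega> \<subseteq> {0<..<1}" and Om_ne: "\<Omega> \<noteq> {}"
    and al: "0 < al" "al < 1" and lam: "0 < lam" "lam < 1" and cC: "0 < c" "0 < C"
    and upper: "\<And>t r. 0 < r \<Longrightarrow> emeasure N (\<Omega> \<inter> ball t r) \<le> ennreal (C * r powr al)"
    and lower: "\<And>t r. t \<in> \<Omega> \<Longrightarrow> 0 < r \<Longrightarrow> r \<le> 1 \<Longrightarrow> ennreal (c * r powr al) \<le> emeasure N (\<Omega> \<inter> ball t r)"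
begin

abbreviation M :: "real measure" where "M \<equiv> unit_lebesgue"

lemma id_borel_measurable_N [measurable]: "(\<lambda>x. x) \<in> borel_measurable N"
  using measurable_restrict_space1[of "\<lambda>x. x" borel borel \<Omega>] by (simp cong: measurable_cong_sets add: sets_N)

lemma finite_N: "finite_measure N"
proof
  have "\<Omega> \<subseteq> \<Omega> \<inter> ball 0 1" using Om_sub by auto
  then have "\<Omega> \<inter> ball 0 1 = \<Omega>" by auto
  then have "emeasure N \<Omega> \<le> ennreal (C * 1 powr al)" using upper[of 1 0] by simp
  then show "emeasure N (space N) \<noteq> \<infinity>" by (auto simp: top_unique)
qed

sublocale N: finite_measure N by (rule finite_N)

sublocale M: finite_measure M by (rule finite_unit_lebesgue)

sublocale NM: pair_sigma_finite N M ..

lemma dist_less_1: "t \<in> \<Omega> \<Longrightarrow> u \<in> {0<..<1} \<Longrightarrow> \<bar>t - u\<bar> < 1"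
  using Om_sub by (auto simp: subset_iff abs_less_iff)

lemma emeasure_N_ball: 
  assumes "0 < r" shows "emeasure N {t\<in>space N. \<bar>u - t\<bar> < r} \<le> ennreal (C * r powr al)"
proof -
  have "{t\<in>space N. \<bar>u - t\<bar> < r} = \<Omega> \<inter> ball u r" by (auto simp: dist_real_def)
  then show ?thesis using upper[OF assms] by simp
qed

lemma fst_borel_measurable_NM [measurable]: "(\<lambda>z. fst z) \<in> borel_measurable (N \<Otimes>\<^sub>M M)"
  by (rule measurable_compose[OF measurable_fst id_borel_measurable_N])

lemma snd_borel_measurable_NM [measurable]: "(\<lambda>z. snd z) \<in> borel_measurable (N \<Otimes>\<^sub>M M)"
  by (rule measurable_compose[OF measurable_snd id_borel_measurable_unit_lebesgue])

section \<open>The near part of the kernel\<close>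

definition nnear :: "real \<Rightarrow> (real \<Rightarrow> real) \<Rightarrow> real \<Rightarrow> ennreal" where
  "nnear R f t = (\<integral>\<^sup>+u. ennreal (if \<bar>t - u\<bar> < R then \<bar>t - u\<bar> powr - lam * \<bar>f u\<bar> else 0) \<partial>M)"

text \<open>\<open>enn2real\<close> sends \<infinity> to 0, so a bound on \<open>near\<close> says
  nothing where \<open>nnear\<close> is infinite; finiteness almost everywhere is therefore
  established alongside the bounds.\<close>

definition near :: "real \<Rightarrow> (real \<Rightarrow> real) \<Rightarrow> real \<Rightarrow> real" where
  "near R f t = enn2real (nnear R f t)"

lemma near_nonneg [simp]: "0 \<le> near R f t"
  by (simp add: near_def)

lemma nnear_measurable [measurable]:
  assumes "f \<in> borel_measurable M" shows "nnear R f \<in> borel_measurable N"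
proof -
  have [measurable]: "(\<lambda>z. f (snd z)) \<in> borel_measurable (N \<Otimes>\<^sub>M M)"
    by (rule measurable_compose[OF measurable_snd assms])
  show ?thesis unfolding nnear_def by measurable
qed

lemma near_measurable [measurable]: 
  assumes f: "f \<in> borel_measurable M" shows "near R f \<in> borel_measurable N"
proof -
  note [measurable] = nnear_measurable[OF f]
  show ?thesis unfolding near_def by measurable
qed

lemma nnear_mono: 
  "R \<le> R' \<Longrightarrow> (\<And>u. \<bar>f u\<bar> \<le> \<bar>g u\<bar>) \<Longrightarrow> nnear R f t \<le> nnear R' g t"
  unfolding nnear_def by (intro nn_integral_mono ennreal_leI) (auto intro!: mult_left_mono)

lemma near_scale: 
  assumes [measurable]: "f \<in> borel_measurable M"
  shows "near R (\<lambda>u. a * f u) t = \<bar>a\<bar> * near R f t"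
proof -
  have "nnear R (\<lambda>u. a * f u) t = (\<integral>\<^sup>+u. ennreal \<bar>a\<bar> * ennreal (if \<bar>t - u\<bar> < R then \<bar>t - u\<bar> powr - lam * \<bar>f u\<bar> else 0) \<partial>M)"
    unfolding nnear_def
    by (intro nn_integral_cong) (auto simp: abs_mult ennreal_mult[symmetric] ac_simps)
  also have "\<dots> = ennreal \<bar>a\<bar> * nnear R f t"
    unfolding nnear_def by (rule nn_integral_cmult) measurable
  finally show ?thesis by (simp add: near_def enn2real_mult)
qed

text \<open>The kernel is split as a product of two powers: one is integrable with respect to Lebesgue measure and
  serves as the weight of a power mean, the other has a \<open>r\<close>-th power integrable with respect to \<open>N\<close>.\<close>

lemma near_diagonal_bound:
  assumes r: "1 < r" "1 - al < r * (1 - lam)"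
  shows "\<exists>A>0. \<forall>R>0. \<forall>f\<in>Lfun M r. (AE t in N. nnear R f t < \<infinity>) \<and>
    (\<integral>\<^sup>+t. ennreal (near R f t powr r) \<partial>N) \<le> ennreal (A * R powr (al - 1 + r * (1 - lam)) * pnorm M r f powr r)"
proof -
  \<comment> \<open>The hypotheses are what makes room for \<sigma>: \<sigma> < \<open>al\<close>
    gives integrability against N, \<sigma> > 1 - r (1 - lam) gives s < 1, hence integrability
    against Lebesgue measure, and \<sigma> < lam r gives s > 0.\<close>
  have "max 0 (1 - r * (1 - lam)) < min al (lam * r)"
    using al lam r by (auto simp: algebra_simps)
  then obtain \<sigma> where \<sigma>: "0 < \<sigma>" "1 - r * (1 - lam) < \<sigma>" "\<sigma> < al" "\<sigma> < lam * r"
    using dense[of "max 0 (1 - r * (1 - lam))" "min al (lam * r)"] by auto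
  define s where "s = (lam * r - \<sigma>) / (r - 1)"
  have s: "0 < s" "s < 1" "s * (r - 1) = lam * r - \<sigma>"
    using \<sigma> r by (auto simp: s_def field_simps)
  define aM where "aM = 2 * 2 powr s / (1 - 2 powr (s - 1))"
  define aN where "aN = C * 2 powr \<sigma> / (1 - 2 powr (\<sigma> - al))"
  have aM: "0 < aM" using powr_less_mono[of "s - 1" 0 2] s by (simp add: aM_def)
  have aN: "0 < aN" using powr_less_mono[of "\<sigma> - al" 0 2] \<sigma> cC by (simp add: aN_def)
  have r0: "r > 0" using r by simp
  show ?thesis
  proof (intro exI[of _ "aM powr (r - 1) * aN"] conjI allI impI ballI)
    show "0 < aM powr (r - 1) * aN" using aM aN by simp
    fix R :: real and f assume R: "0 < R" and f: "f \<in> Lfun M r"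
    note [measurable] = LfunD(1)[OF f]
    have [measurable]: "(\<lambda>z. f (snd z)) \<in> borel_measurable (N \<Otimes>\<^sub>M M)"
      by (rule measurable_compose[OF measurable_snd LfunD(1)[OF f]])
    define A where "A = aM * R powr (1 - s)"
    have A: "0 < A" using aM R by (simp add: A_def)
    \<comment> \<open>The integral of w times the r-th power of h in the power mean. Integrated over
      t, by Tonelli, it leaves the r-th power of |f| against a uniformly bounded integral of the
      kernel with exponent \<sigma>.\<close>
    define X where "X t = (\<integral>\<^sup>+u. ennreal (if \<bar>t - u\<bar> < R then \<bar>t - u\<bar> powr - \<sigma> * \<bar>f u\<bar> powr r else 0) \<partial>M)" for t
    have [measurable]: "X \<in> borel_measurable N" unfolding X_def by measurable
    have "(\<integral>\<^sup>+t. X t \<partial>N) = (\<integral>\<^sup>+u. (\<integral>\<^sup>+t. ennreal (if \<bar>t - u\<bar> < R then \<bar>t - u\<bar> powr - \<sigma> * \<bar>f u\<bar> powr r else 0) \<partial>N) \<partial>M)"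
      unfolding X_def by (rule NM.Fubini'[symmetric]) measurable
    also have "\<dots> = (\<integral>\<^sup>+u. (\<integral>\<^sup>+t. ennreal (\<bar>f u\<bar> powr r) * ennreal (if \<bar>u - t\<bar> < R then \<bar>u - t\<bar> powr - \<sigma> else 0) \<partial>N) \<partial>M)"
      by (intro nn_integral_cong) (auto simp: ennreal_mult[symmetric] abs_minus_commute mult.commute)
    also have "\<dots> = (\<integral>\<^sup>+u. ennreal (\<bar>f u\<bar> powr r) * (\<integral>\<^sup>+t. ennreal (if \<bar>u - t\<bar> < R then \<bar>u - t\<bar> powr - \<sigma> else 0) \<partial>N) \<partial>M)"
      by (intro nn_integral_cong nn_integral_cmult) measurable
    also have "\<dots> \<le> (\<integral>\<^sup>+u. ennreal (\<bar>f u\<bar> powr r) * ennreal (aN * R powr (al - \<sigma>)) \<partial>M)"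
    proof (intro nn_integral_mono mult_left_mono)
      fix u
      show "(\<integral>\<^sup>+t. ennreal (if \<bar>u - t\<bar> < R then \<bar>u - t\<bar> powr - \<sigma> else 0) \<partial>N) \<le> ennreal (aN * R powr (al - \<sigma>))"
        unfolding aN_def using \<sigma> R cC by (intro nn_integral_kernel_near emeasure_N_ball) auto
    qed auto
    also have "\<dots> = (\<integral>\<^sup>+u. ennreal (\<bar>f u\<bar> powr r) \<partial>M) * ennreal (aN * R powr (al - \<sigma>))"
      by (rule nn_integral_multc) measurable
    also have "\<dots> = ennreal (pnorm M r f powr r) * ennreal (aN * R powr (al - \<sigma>))"
      using nn_integral_pnorm[OF r0 f] by simp
    also have "\<dots> = ennreal (aN * R powr (al - \<sigma>) * pnorm M r f powr r)"
      using aN by (simp add: ennreal_mult[symmetric] mult.commute)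
    finally have XI: "(\<integral>\<^sup>+t. X t \<partial>N) \<le> ennreal (aN * R powr (al - \<sigma>) * pnorm M r f powr r)" .
    then have "AE t in N. X t \<noteq> \<infinity>"
      by (intro nn_integral_PInf_AE) (auto simp: top_unique)
    then have Xf: "AE t in N. X t < \<infinity>" by (simp add: less_top)
    have nb: "nnear R f t \<le> ennreal (A powr (1 - 1/r) * x powr (1/r))" if x: "X t = ennreal x" "0 \<le> x" for t x
    proof -
      define w where "w u = (if \<bar>t - u\<bar> < R then \<bar>t - u\<bar> powr - s else 0)" for u
      define h where "h u = \<bar>t - u\<bar> powr (s - lam) * \<bar>f u\<bar>" for u
      have "nnear R f t = (\<integral>\<^sup>+u. ennreal (w u * h u) \<partial>M)"
        unfolding nnear_def by (intro nn_integral_cong) (auto simp: w_def h_def powr_add[symmetric] mult.assoc[symmetric])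
      also have "\<dots> \<le> ennreal (A powr (1 - 1/r) * x powr (1/r))"
      proof (rule weighted_power_mean)
        show "w \<in> borel_measurable M" "h \<in> borel_measurable M" unfolding w_def h_def by measurable
        show "(\<integral>\<^sup>+u. ennreal (w u) \<partial>M) \<le> ennreal A"
          unfolding w_def A_def aM_def 
          by (rule nn_integral_kernel_near[OF id_borel_measurable_unit_lebesgue emeasure_unit_lebesgue_ball]) (use s R in auto)
        have "w u * h u powr r = (if \<bar>t - u\<bar> < R then \<bar>t - u\<bar> powr - \<sigma> * \<bar>f u\<bar> powr r else 0)" for u
        proof -
          have "- s + (s - lam) * r = - \<sigma>" using s(3) by (simp add: algebra_simps)
          then show ?thesis by (simp add: w_def h_def powr_mult powr_powr mult.assoc[symmetric] powr_add[symmetric])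
        qed
        then show "(\<integral>\<^sup>+u. ennreal (w u * h u powr r) \<partial>M) \<le> ennreal x" using x by (simp add: X_def)
      qed (use r A x in \<open>auto simp: w_def h_def\<close>)
      finally show ?thesis .
    qed
    show "AE t in N. nnear R f t < \<infinity>"
      using Xf
    proof eventually_elim
      case (elim t)
      then obtain x where "X t = ennreal x" "0 \<le> x" by (cases "X t") auto
      from nb[OF this] show ?case by (auto intro: le_less_trans)
    qed
    have "(\<integral>\<^sup>+t. ennreal (near R f t powr r) \<partial>N) \<le> (\<integral>\<^sup>+t. ennreal (A powr (r - 1)) * X t \<partial>N)"
    proof (rule nn_integral_mono_AE)
      show "AE t in N. ennreal (near R f t powr r) \<le> ennreal (A powr (r - 1)) * X t"
        using Xf
      proof eventually_elim
        case (elim t)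
        then obtain x where x: "X t = ennreal x" "0 \<le> x" by (cases "X t") auto
        have "near R f t \<le> A powr (1 - 1/r) * x powr (1/r)"
          unfolding near_def using nb[OF x] A x by (intro enn2real_leI) auto
        then have "near R f t powr r \<le> (A powr (1 - 1/r) * x powr (1/r)) powr r"
          using r0 by (intro powr_mono2) auto
        also have "\<dots> = A powr (r - 1) * x" using A x r0 
          by (simp add: powr_mult powr_powr left_diff_distrib)
        finally show ?case using x by (simp add: ennreal_mult[symmetric] ennreal_leI)
      qed
    qed
    also have "\<dots> = ennreal (A powr (r - 1)) * (\<integral>\<^sup>+t. X t \<partial>N)" by (rule nn_integral_cmult) measurable
    also have "\<dots> \<le> ennreal (A powr (r - 1)) * ennreal (aN * R powr (al - \<sigma>) * pnorm M r f powr r)"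
      by (intro mult_left_mono XI) auto
    also have "\<dots> = ennreal (A powr (r - 1) * (aN * R powr (al - \<sigma>) * pnorm M r f powr r))"
      using aN by (intro ennreal_mult[symmetric]) auto
    also have "A powr (r - 1) * (aN * R powr (al - \<sigma>) * pnorm M r f powr r) = 
      aM powr (r - 1) * aN * R powr (al - 1 + r * (1 - lam)) * pnorm M r f powr r"
    proof -
      have e: "(1 - s) * (r - 1) + (al - \<sigma>) = al - 1 + r * (1 - lam)" using s(3) by (simp add: algebra_simps)
      have "A powr (r - 1) = aM powr (r - 1) * R powr ((1 - s) * (r - 1))"
        unfolding A_def using aM R by (simp add: powr_mult powr_powr)
      then show ?thesis unfolding e[symmetric] powr_add by (simp add: ac_simps)
    qed
    finally show "(\<integral>\<^sup>+t. ennreal (near R f t powr r) \<partial>N) \<le> ennreal (aM powr (r - 1) * aN * R powr (al - 1 + r * (1 - lam)) * pnorm M r f powr r)" .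
  qed
qed

text \<open>Hoelder's inequality: beyond distance R the kernel lies in the dual space, since s = lam
  p / (p - 1) exceeds 1 exactly when 1/p - 1 + lam is positive. With this s the weight and h combine
  to at most the p-th power of |f|.\<close>

lemma far_bound:
  assumes p: "1 < p" "0 < 1/p - 1 + lam"
  shows "\<exists>D>0. \<forall>R>0. \<forall>f\<in>Lfun M p. \<forall>t.
    (\<integral>\<^sup>+u. ennreal (if R \<le> \<bar>t - u\<bar> then \<bar>t - u\<bar> powr - lam * \<bar>f u\<bar> else 0) \<partial>M)
       \<le> ennreal (D * R powr (- (1/p - 1 + lam)) * pnorm M p f)"
proof -
  define s where "s = lam * p / (p - 1)"
  have s: "1 < s" "s * (p - 1) = lam * p" using p by (auto simp: s_def field_simps)
  have s': "s * (1 - 1/p) = lam" using s(2) p by (simp add: field_simps)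
  define aM where "aM = 2 * 4 powr 1 / (1 - 2 powr (1 - s))"
  have aM: "0 < aM" using powr_less_mono[of "1 - s" 0 2] s by (simp add: aM_def)
  have p0: "p > 0" using p by simp
  show ?thesis
  proof (intro exI[of _ "aM powr (1 - 1/p)"] conjI allI impI ballI)
    show "0 < aM powr (1 - 1/p)" using aM by simp
    fix R :: real and f t assume R: "0 < R" and f: "f \<in> Lfun M p"
    note [measurable] = LfunD(1)[OF f]
    define A where "A = aM * R powr (1 - s)"
    have A: "0 < A" using aM R by (simp add: A_def)
    define w where "w u = (if R \<le> \<bar>t - u\<bar> then \<bar>t - u\<bar> powr - s else 0)" for u
    define h where "h u = \<bar>t - u\<bar> powr (s - lam) * \<bar>f u\<bar>" for u
    have "(\<integral>\<^sup>+u. ennreal (if R \<le> \<bar>t - u\<bar> then \<bar>t - u\<bar> powr - lam * \<bar>f u\<bar> else 0) \<partial>M) = (\<integral>\<^sup>+u. ennreal (w u * h u) \<partial>M)"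
      by (intro nn_integral_cong) (auto simp: w_def h_def powr_add[symmetric] mult.assoc[symmetric])
    also have "\<dots> \<le> ennreal (A powr (1 - 1/p) * (pnorm M p f powr p) powr (1/p))"
    proof (rule weighted_power_mean)
      show "w \<in> borel_measurable M" "h \<in> borel_measurable M" unfolding w_def h_def by measurable
      show "(\<integral>\<^sup>+u. ennreal (w u) \<partial>M) \<le> ennreal A"
        unfolding w_def A_def aM_def
        by (rule nn_integral_kernel_far[OF id_borel_measurable_unit_lebesgue emeasure_unit_lebesgue_ball]) (use s R in auto)
      have "w u * h u powr p \<le> \<bar>f u\<bar> powr p" for u
      proof -
        have "- s + (s - lam) * p = 0" using s(2) by (simp add: algebra_simps)
        then show ?thesis by (simp add: w_def h_def powr_mult powr_powr mult.assoc[symmetric] powr_add[symmetric])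
      qed
      then have "(\<integral>\<^sup>+u. ennreal (w u * h u powr p) \<partial>M) \<le> (\<integral>\<^sup>+u. ennreal (\<bar>f u\<bar> powr p) \<partial>M)"
        by (intro nn_integral_mono ennreal_leI)
      then show "(\<integral>\<^sup>+u. ennreal (w u * h u powr p) \<partial>M) \<le> ennreal (pnorm M p f powr p)" 
        using nn_integral_pnorm[OF p0 f] by simp
    qed (use p A in \<open>auto simp: w_def h_def\<close>)
    also have "A powr (1 - 1/p) * (pnorm M p f powr p) powr (1/p) = aM powr (1 - 1/p) * R powr (- (1/p - 1 + lam)) * pnorm M p f"
    proof -
      have "(1 - s) * (1 - 1/p) = - (1/p - 1 + lam)" using s' unfolding left_diff_distrib by simp
      moreover have "A powr (1 - 1/p) = aM powr (1 - 1/p) * R powr ((1 - s) * (1 - 1/p))"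
        unfolding A_def using aM R by (simp add: powr_mult powr_powr)
      ultimately show ?thesis using p0 by (simp add: powr_powr)
    qed
    finally show "(\<integral>\<^sup>+u. ennreal (if R \<le> \<bar>t - u\<bar> then \<bar>t - u\<bar> powr - lam * \<bar>f u\<bar> else 0) \<partial>M)
       \<le> ennreal (aM powr (1 - 1/p) * R powr (- (1/p - 1 + lam)) * pnorm M p f)" .
  qed
qed

end

section \<open>Interpolation on the critical line\<close>

context regular_measure
begin

text \<open>Marcinkiewicz interpolation with radius, level and height all tied to j. As the far part
  stays below \<tau> j, Chebyshev's inequality for the two near parts controls the set where G
  exceeds 2 \<tau> j. The sums over j are then taken under the integral, pointwise in u, which gives
  a strong rather than a weak bound.\<close>

lemma near_le_normalized:
  assumes p: "1 < p" "0 < 1/p - 1 + lam" "1 - al < p * (1 - lam)" and q: "q = al / (1/p - 1 + lam)"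
  shows "\<exists>K\<ge>0. \<forall>f\<in>Lfun M p. pnorm M p f \<le> 1 \<longrightarrow> (\<integral>\<^sup>+t. ennreal (near 1 f t powr q) \<partial>N) \<le> ennreal K"
proof -
  define \<eta> where "\<eta> = 1/p - 1 + lam"
  have \<eta>: "0 < \<eta>" using p by (simp add: \<eta>_def)
  have q0: "0 < q" and q\<eta>: "q * \<eta> = al" using q al \<eta> by (auto simp: \<eta>_def)
  \<comment> \<open>The strict inequality for p leaves room for a smaller p0 with the same property;
    larger exponents always have it, so p + 1 can serve as p1.\<close>
  have "max 1 ((1 - al) / (1 - lam)) < p" using p lam by (simp add: divide_less_eq)
  then obtain p0 where p0': "max 1 ((1 - al) / (1 - lam)) < p0" "p0 < p" using dense by blast
  then have p0: "1 < p0" "p0 < p" "1 - al < p0 * (1 - lam)" using lam by (auto simp: divide_less_eq)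
  define p1 where "p1 = p + 1"
  have p1: "1 < p1" "p < p1" "1 - al < p1 * (1 - lam)" using p lam by (auto simp: p1_def algebra_simps)
  obtain A0 where A0: "0 < A0" "\<And>R f. 0 < R \<Longrightarrow> f \<in> Lfun M p0 \<Longrightarrow> 
    (\<integral>\<^sup>+t. ennreal (near R f t powr p0) \<partial>N) \<le> ennreal (A0 * R powr (al - 1 + p0 * (1 - lam)) * pnorm M p0 f powr p0)"
    using near_diagonal_bound[OF p0(1,3)] by blast
  obtain A1 where A1: "0 < A1" "\<And>R f. 0 < R \<Longrightarrow> f \<in> Lfun M p1 \<Longrightarrow> 
    (\<integral>\<^sup>+t. ennreal (near R f t powr p1) \<partial>N) \<le> ennreal (A1 * R powr (al - 1 + p1 * (1 - lam)) * pnorm M p1 f powr p1)"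
    using near_diagonal_bound[OF p1(1,3)] by blast
  have nf: "AE t in N. nnear 1 f t < \<infinity>" if "f \<in> Lfun M p" for f
    using near_diagonal_bound[OF p(1,3)] that zero_less_one by blast
  obtain D where D: "0 < D" "\<And>R f t. 0 < R \<Longrightarrow> f \<in> Lfun M p \<Longrightarrow>
    (\<integral>\<^sup>+u. ennreal (if R \<le> \<bar>t - u\<bar> then \<bar>t - u\<bar> powr - lam * \<bar>f u\<bar> else 0) \<partial>M) \<le> ennreal (D * R powr (- \<eta>) * pnorm M p f)"
    using far_bound[OF p(1,2)] unfolding \<eta>_def by blast
  define b where "b = 2 powr (1/p)"
  have b: "1 < b" using p powr_less_mono[of 0 "1/p" 2] by (simp add: b_def)
  define K0 K1 where "K0 = 1 / (1 - b powr - (p - p0))" and "K1 = 1 / (1 - b powr - (p1 - p))"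
  have K0: "0 < K0" using b powr_less_mono[of "- (p - p0)" 0 b] p0 by (simp add: K0_def)
  have K1: "0 < K1" using b powr_less_mono[of "- (p1 - p)" 0 b] p1 by (simp add: K1_def)
  define B0 B1 where "B0 = 2 powr al * (2 / D) powr p0 * A0" and "B1 = 2 powr al * (2 / D) powr p1 * A1"
  have B: "0 < B0" "0 < B1" using D A0 A1 by (auto simp: B0_def B1_def)
  define K where "K = (2 * D) powr q * (measure N \<Omega> + (B0 * K0 + B1 * K1))"
  have K: "0 \<le> K" using K0 K1 B by (simp add: K_def)
  have "(\<integral>\<^sup>+t. ennreal (near 1 f t powr q) \<partial>N) \<le> ennreal K" if f: "f \<in> Lfun M p" and n1: "pnorm M p f \<le> 1" for f
  proof -
    note [measurable] = LfunD(1)[OF f]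
    have f1: "(\<integral>\<^sup>+u. ennreal (\<bar>f u\<bar> powr p) \<partial>M) \<le> 1"
    proof -
      have "pnorm M p f powr p \<le> 1 powr p" using n1 p by (intro powr_mono2) auto
      then show ?thesis using nn_integral_pnorm[of p f M] f p by (simp add: ennreal_le_1)
    qed
    define fl where "fl j u = (if b powr real j < \<bar>f u\<bar> then f u else 0)" for j :: nat and u
    define fs where "fs j u = (if \<bar>f u\<bar> \<le> b powr real j then f u else 0)" for j :: nat and u
    have [measurable]: "fl j \<in> borel_measurable M" "fs j \<in> borel_measurable M" for j
      unfolding fl_def fs_def by measurable
    have flL: "fl j \<in> Lfun M p0" for j
    proof -
      have "integrable M (\<lambda>u. \<bar>fl j u\<bar> powr p0)"
      proof (rule Bochner_Integration.integrable_bound[OF LfunD(2)[OF f]])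
        show "AE u in M. norm (\<bar>fl j u\<bar> powr p0) \<le> norm (\<bar>f u\<bar> powr p)"
        proof (rule AE_I2)
          fix u
          have "1 \<le> b powr real j" using b by (simp add: ge_one_powr_ge_zero)
          then show "norm (\<bar>fl j u\<bar> powr p0) \<le> norm (\<bar>f u\<bar> powr p)"
            using p0 by (auto simp: fl_def intro!: powr_mono)
        qed
      qed measurable
      then show ?thesis by (simp add: Lfun_def)
    qed
    have fsL: "fs j \<in> Lfun M p1" for j
      using p1 by (intro Lfun_bounded[OF finite_unit_lebesgue, where C = "b powr real j"]) (auto simp: fs_def)
    define R where "R j = 2 powr - real j" for j :: nat
    have R: "0 < R j" for j by (simp add: R_def)
    define G where "G = near 1 f"
    have [measurable]: "G \<in> borel_measurable N" unfolding G_def by measurable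
    \<comment> \<open>This is the bound for the far part at radius R j and norm at most 1.\<close>
    define \<tau> where "\<tau> j = D * 2 powr (\<eta> * real j)" for j :: nat
    have \<tau>: "0 < \<tau> j" for j using D by (simp add: \<tau>_def)
    have split: "G t \<le> \<tau> j + near (R j) (fl j) t + near (R j) (fs j) t" if fin: "nnear 1 f t < \<infinity>" for t j
    proof -
      have "R j \<le> 1" using powr_mono[of "- real j" 0 2] by (simp add: R_def)
      then have fin': "nnear (R j) (fl j) t < \<infinity>" "nnear (R j) (fs j) t < \<infinity>"
        by (intro le_less_trans[OF nnear_mono fin]; simp add: fl_def fs_def)+
      have "nnear 1 f t \<le> (\<integral>\<^sup>+u. ennreal (if R j \<le> \<bar>t - u\<bar> then \<bar>t - u\<bar> powr - lam * \<bar>f u\<bar> else 0) +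
          (ennreal (if \<bar>t - u\<bar> < R j then \<bar>t - u\<bar> powr - lam * \<bar>fl j u\<bar> else 0) + 
           ennreal (if \<bar>t - u\<bar> < R j then \<bar>t - u\<bar> powr - lam * \<bar>fs j u\<bar> else 0)) \<partial>M)"
        unfolding nnear_def by (intro nn_integral_mono) (auto simp: fl_def fs_def)
      also have "\<dots> = (\<integral>\<^sup>+u. ennreal (if R j \<le> \<bar>t - u\<bar> then \<bar>t - u\<bar> powr - lam * \<bar>f u\<bar> else 0) \<partial>M) + (nnear (R j) (fl j) t + nnear (R j) (fs j) t)"
        unfolding nnear_def by (simp add: nn_integral_add)
      also have "\<dots> \<le> ennreal (\<tau> j) + (nnear (R j) (fl j) t + nnear (R j) (fs j) t)"
      proof (rule add_right_mono)
        have "D * R j powr (- \<eta>) * pnorm M p f \<le> D * R j powr (- \<eta>) * 1" using D n1 by (intro mult_left_mono) auto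
        also have "\<dots> = \<tau> j" by (simp add: \<tau>_def R_def powr_powr mult.commute)
        finally show "(\<integral>\<^sup>+u. ennreal (if R j \<le> \<bar>t - u\<bar> then \<bar>t - u\<bar> powr - lam * \<bar>f u\<bar> else 0) \<partial>M) \<le> ennreal (\<tau> j)"
          by (intro order_trans[OF D(2)[OF R f]] ennreal_leI)
      qed
      also have "\<dots> = ennreal (\<tau> j + (near (R j) (fl j) t + near (R j) (fs j) t))"
        using fin' less_imp_le[OF \<tau>[of j]] by (simp add: near_def less_top)
      finally have "nnear 1 f t \<le> ennreal (\<tau> j + (near (R j) (fl j) t + near (R j) (fs j) t))" .
      then have "G t \<le> \<tau> j + (near (R j) (fl j) t + near (R j) (fs j) t)"
        unfolding G_def near_def[of 1] using less_imp_le[OF \<tau>[of j]] by (intro enn2real_leI) auto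
      then show ?thesis by simp
    qed
    define E where "E j = {t\<in>space N. 2 * \<tau> j < G t}" for j
    have [measurable]: "E j \<in> sets N" for j unfolding E_def by measurable
    have Ej: "ennreal (2 powr (al * (real j + 1))) * emeasure N (E j) \<le> 
        ennreal (B0 * b powr ((p - p0) * real j)) * (\<integral>\<^sup>+u. ennreal (\<bar>fl j u\<bar> powr p0) \<partial>M) + 
        ennreal (B1 * b powr (- (p1 - p) * real j)) * (\<integral>\<^sup>+u. ennreal (\<bar>fs j u\<bar> powr p1) \<partial>M)" for j
    proof -
      have cheb: "emeasure N (E j) \<le> (\<integral>\<^sup>+t. ennreal ((2 / \<tau> j) powr p0) * ennreal (near (R j) (fl j) t powr p0) + 
           ennreal ((2 / \<tau> j) powr p1) * ennreal (near (R j) (fs j) t powr p1) \<partial>N)"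
      proof -
        have "emeasure N (E j) = (\<integral>\<^sup>+t. indicator (E j) t \<partial>N)" by simp
        also have "\<dots> \<le> (\<integral>\<^sup>+t. ennreal ((2 / \<tau> j) powr p0) * ennreal (near (R j) (fl j) t powr p0) + 
           ennreal ((2 / \<tau> j) powr p1) * ennreal (near (R j) (fs j) t powr p1) \<partial>N)"
        proof (rule nn_integral_mono_AE)
          show "AE t in N. indicator (E j) t \<le> ennreal ((2 / \<tau> j) powr p0) * ennreal (near (R j) (fl j) t powr p0) + 
           ennreal ((2 / \<tau> j) powr p1) * ennreal (near (R j) (fs j) t powr p1)"
            using nf[OF f]
          proof eventually_elim
            case (elim t)
            show ?case
            proof (cases "t \<in> E j")
              case True
              then have "\<tau> j < near (R j) (fl j) t + near (R j) (fs j) t" using split[OF elim, of j] by (simp add: E_def)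
              then have "1 \<le> 2 / \<tau> j * near (R j) (fl j) t \<or> 1 \<le> 2 / \<tau> j * near (R j) (fs j) t"
                using \<tau>[of j] by (simp add: field_simps) linarith
              then have "1 \<le> (2 / \<tau> j * near (R j) (fl j) t) powr p0 \<or> 1 \<le> (2 / \<tau> j * near (R j) (fs j) t) powr p1"
                using p0 p1 by (auto intro: ge_one_powr_ge_zero)
              then have "1 \<le> (2 / \<tau> j) powr p0 * near (R j) (fl j) t powr p0 + (2 / \<tau> j) powr p1 * near (R j) (fs j) t powr p1"
              proof -
                have z: "0 \<le> (2 / \<tau> j) powr p0 * near (R j) (fl j) t powr p0" 
                  "0 \<le> (2 / \<tau> j) powr p1 * near (R j) (fs j) t powr p1" by auto
                assume "1 \<le> (2 / \<tau> j * near (R j) (fl j) t) powr p0 \<or> 1 \<le> (2 / \<tau> j * near (R j) (fs j) t) powr p1"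
                then show ?thesis unfolding powr_mult using z by linarith
              qed
              then have "ennreal 1 \<le> ennreal ((2 / \<tau> j) powr p0 * near (R j) (fl j) t powr p0 + (2 / \<tau> j) powr p1 * near (R j) (fs j) t powr p1)"
                by (rule ennreal_leI)
              then show ?thesis using True by (simp add: ennreal_mult)
            qed simp
          qed
        qed
        finally show ?thesis .
      qed
      also have "\<dots> = ennreal ((2 / \<tau> j) powr p0) * (\<integral>\<^sup>+t. ennreal (near (R j) (fl j) t powr p0) \<partial>N) + 
           ennreal ((2 / \<tau> j) powr p1) * (\<integral>\<^sup>+t. ennreal (near (R j) (fs j) t powr p1) \<partial>N)"
        by (simp add: nn_integral_add nn_integral_cmult)
      also have "\<dots> \<le> ennreal ((2 / \<tau> j) powr p0) * ennreal (A0 * R j powr (al - 1 + p0 * (1 - lam)) * pnorm M p0 (fl j) powr p0) + 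
           ennreal ((2 / \<tau> j) powr p1) * ennreal (A1 * R j powr (al - 1 + p1 * (1 - lam)) * pnorm M p1 (fs j) powr p1)"
        by (intro add_mono mult_left_mono A0 A1 R flL fsL) auto
      finally have le: "emeasure N (E j) \<le> \<dots>" .
      have coef: "ennreal (2 powr (al * (real j + 1))) * (ennreal ((2 / \<tau> j) powr r) * ennreal (A * R j powr (al - 1 + r * (1 - lam)) * pnorm M r g powr r))
         = ennreal (2 powr al * (2 / D) powr r * A * b powr ((p - r) * real j)) * (\<integral>\<^sup>+u. ennreal (\<bar>g u\<bar> powr r) \<partial>M)"
        if A: "0 < A" and g: "g \<in> Lfun M r" and r: "0 < r" for r A g
      proof -
        have "2 / \<tau> j = (2 / D) * 2 powr (- \<eta> * real j)" by (simp add: \<tau>_def powr_minus_divide)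
        then have "(2 / \<tau> j) powr r = (2 / D) powr r * (2 powr (- \<eta> * real j)) powr r"
          by (simp only: powr_mult)
        also have "(2 powr (- \<eta> * real j)) powr r = 2 powr (- \<eta> * r * real j)"
          by (simp add: powr_powr ac_simps)
        finally have "(2 / \<tau> j) powr r = (2 / D) powr r * 2 powr (- \<eta> * r * real j)" .
        moreover have "R j powr (al - 1 + r * (1 - lam)) = 2 powr (- (al - 1 + r * (1 - lam)) * real j)"
        proof -
          have "- real j * x = - x * real j" for x by (simp add: mult.commute)
          then show ?thesis unfolding R_def powr_powr by (rule arg_cong)
        qed
        moreover have "b powr ((p - r) * real j) = 2 powr ((1 - r / p) * real j)"
        proof -
          have "1 / p * ((p - r) * real j) = (1 - r / p) * real j" using p by (simp add: field_simps)
          then show ?thesis by (simp add: b_def powr_powr)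
        qed
        \<comment> \<open>The scaling is matched here: since \<eta> = 1/p - 1 + lam, all multiples
          of j cancel except (1 - r/p) j, of positive sign for r = p0 and of negative sign for r =
          p1.\<close>
        moreover have "al * (real j + 1) + - \<eta> * r * real j + - (al - 1 + r * (1 - lam)) * real j = al + (1 - r / p) * real j"
          by (simp add: \<eta>_def algebra_simps)
        then have "2 powr (al * (real j + 1)) * 2 powr (- \<eta> * r * real j) * 2 powr (- (al - 1 + r * (1 - lam)) * real j) = 2 powr al * (2::real) powr ((1 - r / p) * real j)"
          by (simp only: powr_add[symmetric])
        ultimately have "2 powr (al * (real j + 1)) * ((2 / \<tau> j) powr r * (A * R j powr (al - 1 + r * (1 - lam)))) =
           2 powr al * (2 / D) powr r * A * b powr ((p - r) * real j)"
          by (simp add: ac_simps)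
        then have "2 powr (al * (real j + 1)) * ((2 / \<tau> j) powr r * (A * R j powr (al - 1 + r * (1 - lam)) * pnorm M r g powr r)) =
           2 powr al * (2 / D) powr r * A * b powr ((p - r) * real j) * pnorm M r g powr r"
          by (simp add: mult.assoc[symmetric])
        then show ?thesis using A nn_integral_pnorm[OF r g]
          by (simp add: ennreal_mult[symmetric])
      qed
      have "ennreal (2 powr (al * (real j + 1))) * emeasure N (E j) \<le> ennreal (2 powr (al * (real j + 1))) * 
         (ennreal ((2 / \<tau> j) powr p0) * ennreal (A0 * R j powr (al - 1 + p0 * (1 - lam)) * pnorm M p0 (fl j) powr p0) + 
           ennreal ((2 / \<tau> j) powr p1) * ennreal (A1 * R j powr (al - 1 + p1 * (1 - lam)) * pnorm M p1 (fs j) powr p1))"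
        by (intro mult_left_mono le) auto
      also have "\<dots> = ennreal (B0 * b powr ((p - p0) * real j)) * (\<integral>\<^sup>+u. ennreal (\<bar>fl j u\<bar> powr p0) \<partial>M) + 
        ennreal (B1 * b powr ((p - p1) * real j)) * (\<integral>\<^sup>+u. ennreal (\<bar>fs j u\<bar> powr p1) \<partial>M)"
      proof -
        have "0 < p0" "0 < p1" using p0 p1 by auto
        note cf = coef[OF A0(1) flL[of j] this(1)] coef[OF A1(1) fsL[of j] this(2)]
        show ?thesis unfolding B0_def B1_def 
          by (subst distrib_left) (rule arg_cong2[where f = "(+)", OF cf])
      qed
      finally show ?thesis by simp
    qed
    have S0: "(\<Sum>j. ennreal (B0 * b powr ((p - p0) * real j)) * (\<integral>\<^sup>+u. ennreal (\<bar>fl j u\<bar> powr p0) \<partial>M)) \<le> ennreal (B0 * K0)"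
    proof -
      have "(\<Sum>j. ennreal (B0 * b powr ((p - p0) * real j)) * (\<integral>\<^sup>+u. ennreal (\<bar>fl j u\<bar> powr p0) \<partial>M)) 
          = (\<Sum>j. (\<integral>\<^sup>+u. ennreal (B0 * b powr ((p - p0) * real j)) * ennreal (\<bar>fl j u\<bar> powr p0) \<partial>M))"
        by (intro suminf_cong nn_integral_cmult[symmetric]) measurable
      also have "\<dots> = (\<integral>\<^sup>+u. (\<Sum>j. ennreal (B0 * b powr ((p - p0) * real j)) * ennreal (\<bar>fl j u\<bar> powr p0)) \<partial>M)"
        by (rule nn_integral_suminf[symmetric]) measurable
      also have "\<dots> \<le> (\<integral>\<^sup>+u. ennreal (B0 * K0) * ennreal (\<bar>f u\<bar> powr p) \<partial>M)"
      proof (rule nn_integral_mono)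
        fix u
        have "(\<Sum>j. ennreal (B0 * b powr ((p - p0) * real j)) * ennreal (\<bar>fl j u\<bar> powr p0)) = 
          (\<Sum>j. ennreal (B0 * \<bar>f u\<bar> powr p0) * ennreal (if b powr real j < \<bar>f u\<bar> then b powr ((p - p0) * real j) else 0))"
          using B by (intro suminf_cong) (auto simp: fl_def ennreal_mult[symmetric] ac_simps)
        also have "\<dots> = ennreal (B0 * \<bar>f u\<bar> powr p0) * (\<Sum>j. ennreal (if b powr real j < \<bar>f u\<bar> then b powr ((p - p0) * real j) else 0))"
          by (rule ennreal_suminf_cmult)
        also have "\<dots> \<le> ennreal (B0 * \<bar>f u\<bar> powr p0) * ennreal (K0 * \<bar>f u\<bar> powr (p - p0))"
          unfolding K0_def using b p0 by (intro mult_left_mono geometric_sum_below) auto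
        also have "\<dots> = ennreal (B0 * K0) * ennreal (\<bar>f u\<bar> powr p)"
        proof -
          have "\<bar>f u\<bar> powr p = \<bar>f u\<bar> powr p0 * \<bar>f u\<bar> powr (p - p0)" by (simp flip: powr_add)
          then show ?thesis using B K0 by (simp add: ennreal_mult[symmetric] ac_simps)
        qed
        finally show "(\<Sum>j. ennreal (B0 * b powr ((p - p0) * real j)) * ennreal (\<bar>fl j u\<bar> powr p0)) \<le> ennreal (B0 * K0) * ennreal (\<bar>f u\<bar> powr p)" .
      qed
      also have "\<dots> = ennreal (B0 * K0) * (\<integral>\<^sup>+u. ennreal (\<bar>f u\<bar> powr p) \<partial>M)" by (rule nn_integral_cmult) measurable
      also have "\<dots> \<le> ennreal (B0 * K0) * 1" by (intro mult_left_mono f1) auto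
      finally show ?thesis by simp
    qed
    have S1: "(\<Sum>j. ennreal (B1 * b powr (- (p1 - p) * real j)) * (\<integral>\<^sup>+u. ennreal (\<bar>fs j u\<bar> powr p1) \<partial>M)) \<le> ennreal (B1 * K1)"
    proof -
      have "(\<Sum>j. ennreal (B1 * b powr (- (p1 - p) * real j)) * (\<integral>\<^sup>+u. ennreal (\<bar>fs j u\<bar> powr p1) \<partial>M)) 
          = (\<Sum>j. (\<integral>\<^sup>+u. ennreal (B1 * b powr (- (p1 - p) * real j)) * ennreal (\<bar>fs j u\<bar> powr p1) \<partial>M))"
        by (intro suminf_cong nn_integral_cmult[symmetric]) measurable
      also have "\<dots> = (\<integral>\<^sup>+u. (\<Sum>j. ennreal (B1 * b powr (- (p1 - p) * real j)) * ennreal (\<bar>fs j u\<bar> powr p1)) \<partial>M)"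
        by (rule nn_integral_suminf[symmetric]) measurable
      also have "\<dots> \<le> (\<integral>\<^sup>+u. ennreal (B1 * K1) * ennreal (\<bar>f u\<bar> powr p) \<partial>M)"
      proof (rule nn_integral_mono)
        fix u
        show "(\<Sum>j. ennreal (B1 * b powr (- (p1 - p) * real j)) * ennreal (\<bar>fs j u\<bar> powr p1)) \<le> ennreal (B1 * K1) * ennreal (\<bar>f u\<bar> powr p)"
        proof (cases "f u = 0")
          case True
          then show ?thesis by (simp add: fs_def)
        next
          case False
          have "(\<Sum>j. ennreal (B1 * b powr (- (p1 - p) * real j)) * ennreal (\<bar>fs j u\<bar> powr p1)) = 
            (\<Sum>j. ennreal (B1 * \<bar>f u\<bar> powr p1) * ennreal (if \<bar>f u\<bar> \<le> b powr real j then b powr (- (p1 - p) * real j) else 0))"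
            using B by (intro suminf_cong) (auto simp: fs_def ennreal_mult[symmetric] ac_simps)
          also have "\<dots> = ennreal (B1 * \<bar>f u\<bar> powr p1) * (\<Sum>j. ennreal (if \<bar>f u\<bar> \<le> b powr real j then b powr (- (p1 - p) * real j) else 0))"
            by (rule ennreal_suminf_cmult)
          also have "\<dots> \<le> ennreal (B1 * \<bar>f u\<bar> powr p1) * ennreal (K1 * \<bar>f u\<bar> powr - (p1 - p))"
            unfolding K1_def using b p1 False by (intro mult_left_mono geometric_sum_above) auto
          also have "\<dots> = ennreal (B1 * K1) * ennreal (\<bar>f u\<bar> powr p)"
          proof -
            have "\<bar>f u\<bar> powr p = \<bar>f u\<bar> powr p1 * \<bar>f u\<bar> powr - (p1 - p)" by (simp flip: powr_add)
            then show ?thesis using B K1 by (simp add: ennreal_mult[symmetric] ac_simps)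
          qed
          finally show ?thesis .
        qed
      qed
      also have "\<dots> = ennreal (B1 * K1) * (\<integral>\<^sup>+u. ennreal (\<bar>f u\<bar> powr p) \<partial>M)" by (rule nn_integral_cmult) measurable
      also have "\<dots> \<le> ennreal (B1 * K1) * 1" by (intro mult_left_mono f1) auto
      finally show ?thesis by simp
    qed
    have "(\<integral>\<^sup>+t. ennreal (G t powr q) \<partial>N) \<le> (\<integral>\<^sup>+t. ennreal ((2 * D) powr q) * (1 + (\<Sum>j. ennreal (2 powr (al * (real j + 1))) * indicator (E j) t)) \<partial>N)"
    proof (rule nn_integral_mono)
      fix t assume t: "t \<in> space N"
      \<comment> \<open>Layers of ratio \<open>2 powr \<eta>\<close> follow the levels \<tau> j; as
        q \<eta> = \<open>al\<close>, layer j gets the weight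
        \<open>2 powr (al * (real j + 1))\<close>.\<close>
      define b2 where "b2 = 2 powr \<eta>"
      have b2: "1 < b2" using \<eta> powr_less_mono[of 0 \<eta> 2] by (simp add: b2_def)
      have G0: "0 \<le> G t" by (simp add: G_def)
      have "ennreal (G t powr q) = ennreal ((2 * D) powr q * (G t / (2 * D)) powr q)"
        using D G0 by (simp add: powr_divide)
      also have "\<dots> = ennreal ((2 * D) powr q) * ennreal ((G t / (2 * D)) powr q)"
        by (rule ennreal_mult) auto
      also have "\<dots> \<le> ennreal ((2 * D) powr q) * (1 + (\<Sum>j. ennreal (if b2 powr real j < G t / (2 * D) then b2 powr (q * (real j + 1)) else 0)))"
        using b2 q0 G0 D by (intro mult_left_mono powr_le_layer_sum) auto
      also have "(\<lambda>j::nat. ennreal (if b2 powr real j < G t / (2 * D) then b2 powr (q * (real j + 1)) else 0)) = 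
         (\<lambda>j. ennreal (2 powr (al * (real j + 1))) * indicator (E j) t)"
      proof
        fix j :: nat
        have "b2 powr real j < G t / (2 * D) \<longleftrightarrow> t \<in> E j"
          using t D by (simp add: E_def \<tau>_def b2_def powr_powr field_simps)
        moreover have "b2 powr (q * (real j + 1)) = 2 powr (al * (real j + 1))"
          by (simp add: b2_def powr_powr mult.assoc[symmetric] mult.commute[of \<eta> q] q\<eta>)
        ultimately show "ennreal (if b2 powr real j < G t / (2 * D) then b2 powr (q * (real j + 1)) else 0) = ennreal (2 powr (al * (real j + 1))) * indicator (E j) t"
          by (simp add: indicator_def)
      qed
      finally show "ennreal (G t powr q) \<le> ennreal ((2 * D) powr q) * (1 + (\<Sum>j. ennreal (2 powr (al * (real j + 1))) * indicator (E j) t))" .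
    qed
    also have "\<dots> = ennreal ((2 * D) powr q) * (emeasure N (space N) + (\<Sum>j. ennreal (2 powr (al * (real j + 1))) * emeasure N (E j)))"
      by (simp add: nn_integral_cmult nn_integral_add nn_integral_suminf nn_integral_cmult_indicator del: space_N)
    also have "\<dots> \<le> ennreal ((2 * D) powr q) * (ennreal (measure N \<Omega>) + (ennreal (B0 * K0) + ennreal (B1 * K1)))"
    proof (intro mult_left_mono add_mono)
      show "emeasure N (space N) \<le> ennreal (measure N \<Omega>)" using N.emeasure_eq_measure[of \<Omega>] by simp
      have "(\<Sum>j. ennreal (2 powr (al * (real j + 1))) * emeasure N (E j)) \<le> (\<Sum>j. 
        ennreal (B0 * b powr ((p - p0) * real j)) * (\<integral>\<^sup>+u. ennreal (\<bar>fl j u\<bar> powr p0) \<partial>M) + 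
        ennreal (B1 * b powr (- (p1 - p) * real j)) * (\<integral>\<^sup>+u. ennreal (\<bar>fs j u\<bar> powr p1) \<partial>M))"
        by (intro suminf_le Ej) auto
      also have "\<dots> = (\<Sum>j. ennreal (B0 * b powr ((p - p0) * real j)) * (\<integral>\<^sup>+u. ennreal (\<bar>fl j u\<bar> powr p0) \<partial>M)) + 
        (\<Sum>j. ennreal (B1 * b powr (- (p1 - p) * real j)) * (\<integral>\<^sup>+u. ennreal (\<bar>fs j u\<bar> powr p1) \<partial>M))"
        by (rule suminf_add[symmetric]) auto
      also have "\<dots> \<le> ennreal (B0 * K0) + ennreal (B1 * K1)" by (intro add_mono S0 S1)
      finally show "(\<Sum>j. ennreal (2 powr (al * (real j + 1))) * emeasure N (E j)) \<le> ennreal (B0 * K0) + ennreal (B1 * K1)" .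
    qed auto
    also have "\<dots> = ennreal K"
      unfolding K_def using B K0 K1 by (simp add: ennreal_mult ennreal_plus)
    finally show ?thesis unfolding G_def .
  qed
  then show ?thesis using K by blast
qed

end

section \<open>Comparison of exponents and bounds above the critical line\<close>

lemma Lfun_mono_exponent:
  assumes fin: "finite_measure M" and p: "0 < p'" "p' \<le> p"
  shows "\<exists>k>0. \<forall>f\<in>Lfun M p. f \<in> Lfun M p' \<and> pnorm M p' f \<le> k * pnorm M p f"
proof -
  interpret finite_measure M by fact
  define k where "k = (measure M (space M) + 1) powr (1/p')"
  have "0 < measure M (space M) + 1" by (simp add: add_nonneg_pos)
  then have k: "0 < k" "k powr p' = measure M (space M) + 1"
    using p by (auto simp: k_def powr_powr)
  have L: "f \<in> Lfun M p'" if f: "f \<in> Lfun M p" for f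
  proof -
    have "integrable M (\<lambda>x. \<bar>f x\<bar> powr p')"
    proof (rule Bochner_Integration.integrable_bound)
      show "integrable M (\<lambda>x. 1 + \<bar>f x\<bar> powr p)" using f by auto
      show "AE x in M. norm (\<bar>f x\<bar> powr p') \<le> norm (1 + \<bar>f x\<bar> powr p)"
      proof (rule AE_I2)
        fix x show "norm (\<bar>f x\<bar> powr p') \<le> norm (1 + \<bar>f x\<bar> powr p)"
          using powr_mono2[of p' "\<bar>f x\<bar>" 1] powr_mono[of p' p "\<bar>f x\<bar>"] p 
          by (cases "\<bar>f x\<bar> \<le> 1") (auto simp: add_increasing add_increasing2)
      qed
    qed (use f in auto)
    then show ?thesis using f by (auto simp: Lfun_def)
  qed
  have le: "pnorm M p' f \<le> k" if f: "f \<in> Lfun M p" and n1: "pnorm M p f \<le> 1" for f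
  proof -
    \<comment> \<open>The pointwise bound by 1 plus the p-th power settles the unit ball, the 1
      costing the total measure; scaling then gives the bound for every f.\<close>
    have "(\<integral>x. \<bar>f x\<bar> powr p' \<partial>M) \<le> (\<integral>x. 1 + \<bar>f x\<bar> powr p \<partial>M)"
    proof (rule integral_mono)
      fix x show "\<bar>f x\<bar> powr p' \<le> 1 + \<bar>f x\<bar> powr p"
        using powr_mono2[of p' "\<bar>f x\<bar>" 1] powr_mono[of p' p "\<bar>f x\<bar>"] p 
        by (cases "\<bar>f x\<bar> \<le> 1") (auto simp: add_increasing add_increasing2)
    qed (use f L[OF f] in auto)
    also have "\<dots> = measure M (space M) + pnorm M p f powr p"
      using f p by (subst Bochner_Integration.integral_add) (auto simp: pnorm_powr)
    also have "\<dots> \<le> measure M (space M) + 1"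
      using powr_mono2[of p "pnorm M p f" 1] n1 p by simp
    finally show ?thesis using p k by (simp add: pnorm_le_iff)
  qed
  have "pnorm M p' f \<le> k * pnorm M p f" if f: "f \<in> Lfun M p" for f
  proof (cases "pnorm M p f = 0")
    case True
    have "AE x in M. f x = 0" using True pnorm_eq_0_iff[OF f] p by simp
    then have "pnorm M p' f = 0" using pnorm_eq_0_iff[OF L[OF f]] p by simp
    then show ?thesis using True by simp
  next
    case False
    define a where "a = 1 / pnorm M p f"
    have a: "0 < a" using False by (simp add: a_def less_le)
    have "pnorm M p (\<lambda>x. a * f x) = a * pnorm M p f" using a p pnorm_scale[of p M a f] by simp
    also have "a * pnorm M p f \<le> 1" using False by (simp add: a_def)
    finally have "pnorm M p (\<lambda>x. a * f x) \<le> 1" .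
    then have "pnorm M p' (\<lambda>x. a * f x) \<le> k" by (intro le Lfun_scale f)
    then have "a * pnorm M p' f \<le> k" using a p by (simp add: pnorm_scale)
    then have "pnorm M p' f \<le> k / a" using a by (simp add: field_simps)
    then show ?thesis by (simp add: a_def)
  qed
  then show ?thesis using k L by blast
qed

text \<open>Small g are absorbed by the constant e, large g by the higher power q', and in between g
  is bounded away from 0, so any positive power r controls it. It lets smallness with one exponent r
  pass to the exponent q.\<close>

lemma powr_le_interpolation:
  fixes q q' r e :: real
  assumes q: "0 < q" "q < q'" and r: "0 < r" and e: "0 < e"
  shows "\<exists>B>0. \<forall>g\<ge>0. g powr q \<le> e + e * g powr q' + B * g powr r"
proof -
  define a H where "a = e powr (1/q)" and "H = e powr (- 1 / (q' - q))"
  have a: "0 < a" "a powr q = e" using e q by (auto simp: a_def powr_powr)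
  have "- 1 / (q' - q) * (q - q') = 1" using q by (simp add: field_simps)
  then have H: "0 < H" "H powr (q - q') = e" using e by (auto simp: H_def powr_powr)
  have "g powr q \<le> e + e * g powr q' + H powr q * a powr - r * g powr r" if g: "0 \<le> g" for g
  proof -
    have nn: "0 \<le> e * g powr q'" "0 \<le> H powr q * a powr - r * g powr r" using e by auto
    consider "g \<le> a" | "H \<le> g" | "a \<le> g" "g \<le> H" by linarith
    then show ?thesis
    proof cases
      case 1
      then have "g powr q \<le> e" using powr_mono2[of q g a] a q g by simp
      then show ?thesis using nn by linarith
    next
      case 2
      have "g powr q = g powr q' * g powr (q - q')" by (simp flip: powr_add)
      also have "\<dots> \<le> g powr q' * H powr (q - q')" using 2 H q by (intro mult_left_mono powr_mono2') auto
      finally have "g powr q \<le> e * g powr q'" using H by (simp add: mult.commute)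
      then show ?thesis using nn e by linarith
    next
      case 3
      have "1 \<le> (g / a) powr r" using 3 a r by (intro ge_one_powr_ge_zero) auto
      also have "(g / a) powr r = a powr - r * g powr r" using a g by (simp add: powr_divide powr_minus_divide)
      finally have "g powr q * 1 \<le> H powr q * (a powr - r * g powr r)"
        using 3 g q by (intro mult_mono powr_mono2) auto
      then show ?thesis unfolding mult.assoc using nn(1) e by linarith
    qed
  qed
  then show ?thesis using a H by (intro exI[of _ "H powr q * a powr - r"]) auto
qed

context regular_measure
begin

text \<open>Scaling from the unit ball. If f has norm 0 every multiple of it lies in the unit ball,
  so all multiples of its image stay below e, which forces norm 0.\<close>

lemma near_homogeneous:
  assumes q: "0 < q" and p: "0 < p" and e: "0 \<le> e"
    and le: "\<And>f. f \<in> Lfun M p \<Longrightarrow> pnorm M p f \<le> 1 \<Longrightarrow> (\<integral>\<^sup>+t. ennreal (near R f t powr q) \<partial>N) \<le> ennreal (e powr q)"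
    and f: "f \<in> Lfun M p"
  shows "near R f \<in> Lfun N q" "pnorm N q (near R f) \<le> e * pnorm M p f"
proof -
  note [measurable] = LfunD(1)[OF f]
  have *: "near R f \<in> Lfun N q \<and> a * pnorm N q (near R f) \<le> e" if a: "0 < a" "a * pnorm M p f \<le> 1" for a
  proof -
    have n: "near R (\<lambda>x. a * f x) = (\<lambda>t. a * near R f t)" using near_scale[of f R a] a by auto
    have "(\<integral>\<^sup>+t. ennreal (near R (\<lambda>x. a * f x) t powr q) \<partial>N) \<le> ennreal (e powr q)"
      using a p by (intro le Lfun_scale f) (simp add: pnorm_scale)
    then have i: "(\<integral>\<^sup>+t. ennreal (\<bar>a * near R f t\<bar> powr q) \<partial>N) \<le> ennreal (e powr q)"
      using a by (simp add: n)
    have "(\<lambda>t. a * near R f t) \<in> Lfun N q" "pnorm N q (\<lambda>t. a * near R f t) \<le> e"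
      by (rule Lfun_pnorm_leI[OF q _ e i], measurable)+
    then show ?thesis using Lfun_scale[of "\<lambda>t. a * near R f t" N q "1/a"] a q by (simp add: pnorm_scale)
  qed
  obtain a where a: "0 < a" "a * pnorm M p f \<le> 1"
    by (rule that[of "1 / (pnorm M p f + 1)"]) (auto simp: add_nonneg_pos)
  show "near R f \<in> Lfun N q" using *[OF a] by blast
  show "pnorm N q (near R f) \<le> e * pnorm M p f"
  proof (cases "pnorm M p f = 0")
    case True
    have "pnorm N q (near R f) \<le> 0"
    proof (rule ccontr)
      assume "\<not> pnorm N q (near R f) \<le> 0"
      then have pos: "0 < pnorm N q (near R f)" by simp
      have "(e + 1) / pnorm N q (near R f) * pnorm N q (near R f) \<le> e"
        using * True pos e by (intro conjunct2[OF *]) auto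
      then show False using pos by simp
    qed
    then show ?thesis using True by simp
  next
    case False
    then have "1 / pnorm M p f * pnorm N q (near R f) \<le> e"
      by (intro conjunct2[OF *]) (auto simp: less_le)
    moreover have "0 < pnorm M p f" using False by (simp add: less_le)
    ultimately show ?thesis by (simp add: field_simps)
  qed
qed

lemma near_bound_line:
  assumes p: "1 < p" "0 < 1/p - 1 + lam" "1 - al < p * (1 - lam)" and q: "q = al / (1/p - 1 + lam)"
  shows "\<exists>K\<ge>0. \<forall>f\<in>Lfun M p. near 1 f \<in> Lfun N q \<and> pnorm N q (near 1 f) \<le> K * pnorm M p f"
proof -
  have q0: "0 < q" using p al by (simp add: q)
  obtain K where K: "0 \<le> K" "\<And>f. f \<in> Lfun M p \<Longrightarrow> pnorm M p f \<le> 1 \<Longrightarrow> (\<integral>\<^sup>+t. ennreal (near 1 f t powr q) \<partial>N) \<le> ennreal K"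
    using near_le_normalized[OF p q] by blast
  have "(\<integral>\<^sup>+t. ennreal (near 1 f t powr q) \<partial>N) \<le> ennreal ((K powr (1/q)) powr q)"
    if "f \<in> Lfun M p" "pnorm M p f \<le> 1" for f
    using K that q0 by (simp add: powr_powr)
  from near_homogeneous[OF q0 _ powr_ge_zero this, of p] p show ?thesis 
    by (intro exI[of _ "K powr (1/q)"] conjI ballI powr_ge_zero) auto
qed

lemma near_finite:
  assumes "1 < p" "1 - al < p * (1 - lam)" "f \<in> Lfun M p"
  shows "AE t in N. nnear 1 f t < \<infinity>"
  using near_diagonal_bound[OF assms(1,2)] assms(3) zero_less_one by blast

text \<open>Strictly above the critical line one may lower \<open>p\<close> to some \<open>p'\<close> whose critical exponent \<open>q'\<close> still
  exceeds \<open>q\<close>, and interpolate between smallness for \<open>(p', p')\<close> and boundedness for \<open>(p', q')\<close>.\<close>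

lemma near_above_line:
  assumes p: "1 < p" "1 - al < p * (1 - lam)" and q: "1 < q" "1/p - 1 + lam < al / q" and e: "0 < e"
  shows "\<exists>B>0. \<exists>\<gamma>>0. \<forall>R>0. R \<le> 1 \<longrightarrow> (\<forall>f\<in>Lfun M p. pnorm M p f \<le> 1 \<longrightarrow> 
     (\<integral>\<^sup>+t. ennreal (near R f t powr q) \<partial>N) \<le> ennreal (e + B * R powr \<gamma>))"
proof -
  \<comment> \<open>Here x = 1/p'. The lower bounds give p' < p and a positive critical denominator,
    also when 1/p is at most 1 - lam; the upper ones give p' > 1, the diagonal condition and q' >
    q.\<close>
  have "max (1/p) (1 - lam) < min 1 (min ((1 - lam) / (1 - al)) (1 - lam + al / q))"
    using p q al lam by (auto simp: field_simps)
  then obtain x where x': "max (1/p) (1 - lam) < x" "x < min 1 (min ((1 - lam) / (1 - al)) (1 - lam + al / q))"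
    using dense by blast
  then have x: "1/p < x" "1 - lam < x" "x < 1" "x < (1 - lam) / (1 - al)" "x < 1 - lam + al / q" by auto
  have x0: "0 < x" using x(2) lam by linarith
  define p' where "p' = 1 / x"
  have p': "1 < p'" "0 < 1/p' - 1 + lam" "1 - al < p' * (1 - lam)" "p' \<le> p" "0 < p'"
    using x x0 p al by (auto simp: p'_def field_simps)
  define q' where "q' = al / (1/p' - 1 + lam)"
  have q': "q < q'"
  proof -
    have "1/p' - 1 + lam < al / q" using x by (simp add: p'_def)
    then show ?thesis unfolding q'_def using p'(2) q(1) by (simp add: field_simps)
  qed
  define \<gamma> where "\<gamma> = al - 1 + p' * (1 - lam)"
  have \<gamma>: "0 < \<gamma>" using p' by (simp add: \<gamma>_def)
  have q0: "0 < q" "0 < q'" using q q' by auto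
  obtain k where k: "0 < k" "\<And>f. f \<in> Lfun M p \<Longrightarrow> f \<in> Lfun M p' \<and> pnorm M p' f \<le> k * pnorm M p f"
    using Lfun_mono_exponent[OF finite_unit_lebesgue p'(5,4)] by blast
  obtain A where A: "0 < A" "\<And>R f. 0 < R \<Longrightarrow> f \<in> Lfun M p' \<Longrightarrow>
      (\<integral>\<^sup>+t. ennreal (near R f t powr p') \<partial>N) \<le> ennreal (A * R powr \<gamma> * pnorm M p' f powr p')"
    using near_diagonal_bound[OF p'(1,3)] unfolding \<gamma>_def by blast
  obtain K where K: "0 \<le> K" "\<And>f. f \<in> Lfun M p' \<Longrightarrow> near 1 f \<in> Lfun N q' \<and> pnorm N q' (near 1 f) \<le> K * pnorm M p' f"
    using near_bound_line[OF p'(1,2,3) q'_def] by blast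
  define e1 where "e1 = e / (measure N \<Omega> + (K * k) powr q' + 1)"
  have den: "0 < measure N \<Omega> + (K * k) powr q' + 1" by (simp add: add_nonneg_pos)
  have e1: "0 < e1" "e1 * (measure N \<Omega> + (K * k) powr q') \<le> e"
  proof -
    show "0 < e1" unfolding e1_def using e den by (rule divide_pos_pos)
    have "e1 * (measure N \<Omega> + (K * k) powr q') \<le> e1 * (measure N \<Omega> + (K * k) powr q' + 1)"
      using \<open>0 < e1\<close> by (intro mult_left_mono) auto
    also have "\<dots> = e" using den by (simp add: e1_def)
    finally show "e1 * (measure N \<Omega> + (K * k) powr q') \<le> e" .
  qed
  obtain B where B: "0 < B" "\<And>g. 0 \<le> g \<Longrightarrow> g powr q \<le> e1 + e1 * g powr q' + B * g powr p'"
    using powr_le_interpolation[OF q0(1) q' p'(5) e1(1)] by blast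
  show ?thesis
  proof (rule exI[of _ "B * (A * k powr p')"], rule conjI, use B A k in simp,
      rule exI[of _ \<gamma>], intro conjI \<gamma> allI impI ballI)
    fix R :: real and f assume R: "0 < R" "R \<le> 1" and f: "f \<in> Lfun M p" and n1: "pnorm M p f \<le> 1"
    note [measurable] = LfunD(1)[OF f]
    have fL: "f \<in> Lfun M p'" and fk: "pnorm M p' f \<le> k"
      using k(2)[OF f] order_trans[OF _ mult_left_mono[OF n1, of k]] k(1) by auto
    \<comment> \<open>Monotonicity in the radius survives \<open>enn2real\<close> only where the
      larger integral is finite.\<close>
    have mono: "AE t in N. near R f t \<le> near 1 f t"
      using near_finite[OF p'(1,3) fL]
    proof eventually_elim
      case (elim t)
      have "nnear R f t \<le> nnear 1 f t" by (rule nnear_mono) (use R in auto)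
      then show ?case unfolding near_def using elim by (intro enn2real_mono) auto
    qed
    have Iq': "(\<integral>\<^sup>+t. ennreal (near R f t powr q') \<partial>N) \<le> ennreal ((K * k) powr q')"
    proof -
      have "(\<integral>\<^sup>+t. ennreal (near R f t powr q') \<partial>N) \<le> (\<integral>\<^sup>+t. ennreal (\<bar>near 1 f t\<bar> powr q') \<partial>N)"
      proof (rule nn_integral_mono_AE)
        show "AE t in N. ennreal (near R f t powr q') \<le> ennreal (\<bar>near 1 f t\<bar> powr q')"
          using mono by eventually_elim (use q0 in \<open>auto intro!: ennreal_leI powr_mono2\<close>)
      qed
      also have "\<dots> = ennreal (pnorm N q' (near 1 f) powr q')" 
        using K(2)[OF fL] q0 by (intro nn_integral_pnorm) auto
      also have "\<dots> \<le> ennreal ((K * k) powr q')"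
        using K(2)[OF fL] mult_left_mono[OF fk K(1)] q0 by (intro ennreal_leI powr_mono2) auto
      finally show ?thesis .
    qed
    have Ip': "(\<integral>\<^sup>+t. ennreal (near R f t powr p') \<partial>N) \<le> ennreal (A * R powr \<gamma> * k powr p')"
      using A(1) fk p'(5) by (intro order_trans[OF A(2)[OF R(1) fL]] ennreal_leI mult_left_mono powr_mono2) auto
    have "(\<integral>\<^sup>+t. ennreal (near R f t powr q) \<partial>N) \<le> 
      (\<integral>\<^sup>+t. ennreal e1 + (ennreal e1 * ennreal (near R f t powr q') + ennreal B * ennreal (near R f t powr p')) \<partial>N)"
    proof (rule nn_integral_mono)
      fix t
      have "ennreal (near R f t powr q) \<le> ennreal (e1 + (e1 * near R f t powr q' + B * near R f t powr p'))"
        using B(2)[of "near R f t"] by (intro ennreal_leI) simp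
      then show "ennreal (near R f t powr q) \<le> ennreal e1 + (ennreal e1 * ennreal (near R f t powr q') + ennreal B * ennreal (near R f t powr p'))"
        using e1(1) B(1) by (simp add: ennreal_mult)
    qed
    also have "\<dots> = ennreal e1 * emeasure N (space N) + (ennreal e1 * (\<integral>\<^sup>+t. ennreal (near R f t powr q') \<partial>N) + 
        ennreal B * (\<integral>\<^sup>+t. ennreal (near R f t powr p') \<partial>N))"
      by (simp add: nn_integral_add nn_integral_cmult del: space_N)
    also have "\<dots> \<le> ennreal e1 * ennreal (measure N \<Omega>) + (ennreal e1 * ennreal ((K * k) powr q') + ennreal B * ennreal (A * R powr \<gamma> * k powr p'))"
      using Iq' Ip' N.emeasure_eq_measure[of \<Omega>] by (intro add_mono mult_left_mono) auto
    also have "\<dots> = ennreal (e1 * measure N \<Omega> + (e1 * (K * k) powr q' + B * (A * R powr \<gamma> * k powr p')))"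
      using e1(1) B(1) A(1) by (simp add: ennreal_mult ennreal_plus)
    also have "\<dots> \<le> ennreal (e + B * (A * k powr p') * R powr \<gamma>)"
      using e1(2) by (intro ennreal_leI) (simp add: distrib_left ac_simps)
    finally show "(\<integral>\<^sup>+t. ennreal (near R f t powr q) \<partial>N) \<le> ennreal (e + B * (A * k powr p') * R powr \<gamma>)" .
  qed
qed

lemma near_bound_above_line:
  assumes p: "1 < p" "1 - al < p * (1 - lam)" and q: "1 < q" "1/p - 1 + lam < al / q"
  shows "\<exists>K\<ge>0. \<forall>f\<in>Lfun M p. near 1 f \<in> Lfun N q \<and> pnorm N q (near 1 f) \<le> K * pnorm M p f"
proof -
  obtain B \<gamma> where B: "0 < B" "\<And>R f. 0 < R \<Longrightarrow> R \<le> 1 \<Longrightarrow> f \<in> Lfun M p \<Longrightarrow> pnorm M p f \<le> 1 \<Longrightarrow> 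
     (\<integral>\<^sup>+t. ennreal (near R f t powr q) \<partial>N) \<le> ennreal (1 + B * R powr \<gamma>)"
    using near_above_line[OF p q zero_less_one] by blast
  have "(\<integral>\<^sup>+t. ennreal (near 1 f t powr q) \<partial>N) \<le> ennreal (((1 + B) powr (1/q)) powr q)"
    if "f \<in> Lfun M p" "pnorm M p f \<le> 1" for f
    using B(2)[of 1 f] that q B(1) by (simp add: powr_powr)
  from near_homogeneous[OF _ _ powr_ge_zero this, of p] p q show ?thesis 
    by (intro exI[of _ "(1 + B) powr (1/q)"] conjI ballI powr_ge_zero) auto
qed

lemma near_small_above_line:
  assumes p: "1 < p" "1 - al < p * (1 - lam)" and q: "1 < q" "1/p - 1 + lam < al / q" and e: "0 < e"
  shows "\<exists>R>0. R \<le> 1 \<and> (\<forall>f\<in>Lfun M p. near R f \<in> Lfun N q \<and> pnorm N q (near R f) \<le> e * pnorm M p f)"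
proof -
  define e2 where "e2 = e powr q / 2"
  have e2: "0 < e2" using e by (simp add: e2_def)
  obtain B \<gamma> where B: "0 < B" "0 < \<gamma>" "\<And>R f. 0 < R \<Longrightarrow> R \<le> 1 \<Longrightarrow> f \<in> Lfun M p \<Longrightarrow> pnorm M p f \<le> 1 \<Longrightarrow> 
     (\<integral>\<^sup>+t. ennreal (near R f t powr q) \<partial>N) \<le> ennreal (e2 + B * R powr \<gamma>)"
    using near_above_line[OF p q e2] by blast
  define R where "R = min 1 ((e2 / B) powr (1/\<gamma>))"
  have R: "0 < R" "R \<le> 1" using B e2 by (auto simp: R_def)
  have "R powr \<gamma> \<le> ((e2 / B) powr (1/\<gamma>)) powr \<gamma>" using R B by (intro powr_mono2) (auto simp: R_def)
  then have "B * R powr \<gamma> \<le> e2" using B e2 by (simp add: powr_powr field_simps)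
  then have le: "e2 + B * R powr \<gamma> \<le> e powr q" by (simp add: e2_def)
  have "(\<integral>\<^sup>+t. ennreal (near R f t powr q) \<partial>N) \<le> ennreal (e powr q)"
    if "f \<in> Lfun M p" "pnorm M p f \<le> 1" for f
    by (rule order_trans[OF B(3)[OF R that] ennreal_leI[OF le]])
  from near_homogeneous[OF _ _ less_imp_le[OF e] this, of p] p q R show ?thesis by (intro exI[of _ R] conjI ballI) auto
qed

subsection \<open>The fractional integral operator\<close>

abbreviation T :: "(real \<Rightarrow> real) \<Rightarrow> real \<Rightarrow> real" where "T \<equiv> frac_integral lam"

lemma T_measurable [measurable]:
  assumes "f \<in> borel_measurable M" shows "T f \<in> borel_measurable N"
proof -
  have [measurable]: "(\<lambda>z. f (snd z)) \<in> borel_measurable (N \<Otimes>\<^sub>M M)"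
    by (rule measurable_compose[OF measurable_snd assms])
  show ?thesis unfolding frac_integral_def by measurable
qed

lemma nnear_1:
  assumes "t \<in> \<Omega>"
  shows "nnear 1 f t = (\<integral>\<^sup>+u. ennreal (norm (f u / \<bar>t - u\<bar> powr lam)) \<partial>M)"
  unfolding nnear_def using dist_less_1[OF assms]
  by (intro nn_integral_cong) (auto simp: powr_minus_divide abs_mult)

lemma T_integrable:
  assumes t: "t \<in> \<Omega>" and [measurable]: "f \<in> borel_measurable M" and fin: "nnear 1 f t < \<infinity>"
  shows "integrable M (\<lambda>u. f u / \<bar>t - u\<bar> powr lam)"
  using fin unfolding nnear_1[OF t] by (intro integrableI_bounded) measurable

text \<open>Where the defining integral does not converge, the Bochner integral is 0 by convention
  and the bound still holds; no exceptional set arises.\<close>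

lemma abs_T_le_near:
  assumes t: "t \<in> \<Omega>" and f: "f \<in> borel_measurable M"
  shows "\<bar>T f t\<bar> \<le> near 1 f t"
proof (cases "integrable M (\<lambda>u. f u / \<bar>t - u\<bar> powr lam)")
  case True
  have "ennreal (norm (T f t)) \<le> nnear 1 f t"
    unfolding nnear_1[OF t] frac_integral_def by (rule integral_norm_bound_ennreal[OF True])
  moreover have "nnear 1 f t < \<infinity>" unfolding nnear_1[OF t] using True by (simp add: integrable_iff_bounded)
  ultimately show ?thesis unfolding near_def by (cases "nnear 1 f t") auto
next
  case False
  then show ?thesis by (simp add: frac_integral_def not_integrable_integral_eq)
qed

text \<open>Additivity requires both integrals to converge at t. The norm bound on
  \<open>near\<close> cannot detect divergence, hence the separate finiteness assumption.\<close>

lemma T_Lp_bounded: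
  assumes p: "p \<ge> 1" and q: "q \<ge> 1" and fin: "\<And>f. f \<in> Lfun M p \<Longrightarrow> AE t in N. nnear 1 f t < \<infinity>"
    and K: "\<exists>K\<ge>0. \<forall>f\<in>Lfun M p. near 1 f \<in> Lfun N q \<and> pnorm N q (near 1 f) \<le> K * pnorm M p f"
  shows "Lp_bounded M p N q T"
  unfolding Lp_bounded_def
proof (intro conjI ballI allI)
  have q0: "q > 0" using q by simp
  have ae: "AE t in N. \<bar>T f t\<bar> \<le> \<bar>near 1 f t\<bar>" if "f \<in> Lfun M p" for f
    using abs_T_le_near[of _ f] that by (intro AE_I2) auto
  have b: "T f \<in> Lfun N q" "pnorm N q (T f) \<le> pnorm N q (near 1 f)" if f: "f \<in> Lfun M p" for f
    using pnorm_mono[OF q0 T_measurable[OF LfunD(1)[OF f]] _ ae[OF f]] K f by auto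
  show "T f \<in> Lfun N q" if "f \<in> Lfun M p" for f by (rule b[OF that])
  show "\<exists>C\<ge>0. \<forall>f\<in>Lfun M p. pnorm N q (T f) \<le> C * pnorm M p f"
    using K b(2) by (meson order_trans)
  show "AE t in N. T (\<lambda>x. f x + g x) t = T f t + T g t" if f: "f \<in> Lfun M p" and g: "g \<in> Lfun M p" for f g
    using fin[OF f] fin[OF g] AE_space
  proof eventually_elim
    case (elim t)
    then have "integrable M (\<lambda>u. f u / \<bar>t - u\<bar> powr lam)" "integrable M (\<lambda>u. g u / \<bar>t - u\<bar> powr lam)"
      using f g by (auto intro!: T_integrable)
    then show ?case by (simp add: frac_integral_def add_divide_distrib)
  qed
  show "AE t in N. T (\<lambda>x. a * f x) t = a * T f t" if f: "f \<in> Lfun M p" for f a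
    by (rule AE_I2) (simp add: frac_integral_def flip: times_divide_eq_right)
qed

lemma T_bounded_line:
  assumes p: "1 < p" "0 < 1/p - 1 + lam" "1 - al < p * (1 - lam)" and q: "q = al / (1/p - 1 + lam)" "q \<ge> 1"
  shows "Lp_bounded M p N q T"
  using p q(2) near_finite[OF p(1,3)] near_bound_line[OF p q(1)] by (intro T_Lp_bounded) auto

lemma T_bounded_above_line:
  assumes p: "1 < p" "1 - al < p * (1 - lam)" and q: "1 < q" "1/p - 1 + lam < al / q"
  shows "Lp_bounded M p N q T"
  using p q near_finite[OF p] near_bound_above_line[OF p q] by (intro T_Lp_bounded) auto

section \<open>Bounded functions and approximation by finitely many functionals\<close>

lemma nnear_bounded_sup:
  "\<exists>A>0. \<forall>f H t. f \<in> borel_measurable M \<longrightarrow> (\<forall>x. \<bar>f x\<bar> \<le> H) \<longrightarrow> nnear 1 f t \<le> ennreal (A * H)"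
proof -
  define A where "A = 2 * 2 powr lam / (1 - 2 powr (lam - 1)) * 1 powr (1 - lam)"
  have A: "0 < A" using powr_less_mono[of "lam - 1" 0 2] lam by (simp add: A_def)
  have "nnear 1 f t \<le> ennreal (A * H)" if f[measurable]: "f \<in> borel_measurable M" and H: "\<And>x. \<bar>f x\<bar> \<le> H" for f H t
  proof -
    have H0: "0 \<le> H" using H[of 0] by linarith
    have "nnear 1 f t \<le> (\<integral>\<^sup>+u. ennreal H * ennreal (if \<bar>t - u\<bar> < 1 then \<bar>t - u\<bar> powr - lam else 0) \<partial>M)"
      unfolding nnear_def using H H0
      by (intro nn_integral_mono) (auto simp: ennreal_mult[symmetric] mult.commute intro!: ennreal_leI mult_right_mono)
    also have "\<dots> = ennreal H * (\<integral>\<^sup>+u. ennreal (if \<bar>t - u\<bar> < 1 then \<bar>t - u\<bar> powr - lam else 0) \<partial>M)"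
      by (rule nn_integral_cmult) measurable
    also have "\<dots> \<le> ennreal H * ennreal A"
      unfolding A_def
      by (intro mult_left_mono nn_integral_kernel_near[OF id_borel_measurable_unit_lebesgue emeasure_unit_lebesgue_ball]) (use lam in auto)
    also have "\<dots> = ennreal (A * H)" using A H0 by (simp add: ennreal_mult[symmetric] mult.commute)
    finally show ?thesis .
  qed
  then show ?thesis using A by blast
qed

lemma T_bounded_sup:
  "\<exists>A>0. \<forall>f H. f \<in> borel_measurable M \<longrightarrow> (\<forall>x. \<bar>f x\<bar> \<le> H) \<longrightarrow> (\<forall>t\<in>\<Omega>. \<bar>T f t\<bar> \<le> A * H)"
proof -
  obtain A where A: "0 < A" "\<And>f H t. f \<in> borel_measurable M \<Longrightarrow> (\<And>x. \<bar>f x\<bar> \<le> H) \<Longrightarrow> nnear 1 f t \<le> ennreal (A * H)"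
    using nnear_bounded_sup by blast
  have "\<bar>T f t\<bar> \<le> A * H" if f: "f \<in> borel_measurable M" and H: "\<And>x. \<bar>f x\<bar> \<le> H" and t: "t \<in> \<Omega>" for f H t
  proof -
    have "0 \<le> H" using H[of 0] by linarith
    then have "near 1 f t \<le> A * H" unfolding near_def using A by (intro enn2real_leI A(2) f H) auto
    then show ?thesis using abs_T_le_near[OF t f] by simp
  qed
  then show ?thesis using A(1) by blast
qed

lemma T_bounded_integrable:
  assumes "t \<in> \<Omega>" "f \<in> borel_measurable M" "\<And>x. \<bar>f x\<bar> \<le> H"
  shows "integrable M (\<lambda>u. f u / \<bar>t - u\<bar> powr lam)"
proof -
  obtain A where "nnear 1 f t \<le> ennreal (A * H)"
    using nnear_bounded_sup assms(2,3) by blast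
  then show ?thesis using assms by (intro T_integrable) (auto intro: le_less_trans)
qed

text \<open>The kernel truncated at height \<open>R powr - lam\<close> is uniformly continuous, so up to a small error the truncated
  operator only depends on the values at finitely many points.\<close>

lemma T_fin_approx:
  assumes p: "1 < p" "1 - al < p * (1 - lam)" and q: "1 < q" "1/p - 1 + lam < al / q"
  shows "fin_approx M p N q T"
  unfolding fin_approx_def
proof (intro allI impI)
  fix e :: real assume e: "0 < e"
  have p1: "p \<ge> 1" "p > 0" and q1: "q \<ge> 1" "q > 0" using p q by auto
  obtain k where k: "0 < k" "\<And>f. f \<in> Lfun M p \<Longrightarrow> f \<in> Lfun M 1 \<and> pnorm M 1 f \<le> k * pnorm M p f"
    using Lfun_mono_exponent[OF finite_unit_lebesgue zero_less_one p1(1)] by blast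
  define n where "n = measure N \<Omega> powr (1/q)"
  have n: "0 \<le> n" by (simp add: n_def)
  have f1: "integrable M f" "(\<integral>u. \<bar>f u\<bar> \<partial>M) \<le> k * pnorm M p f" if f: "f \<in> Lfun M p" for f
    using k(2)[OF f] LfunD[OF f] by (auto simp: Lfun_def pnorm_def integrable_abs_iff)
  obtain R where R: "0 < R" "R \<le> 1" "\<And>f. f \<in> Lfun M p \<Longrightarrow> near R f \<in> Lfun N q \<and> pnorm N q (near R f) \<le> e/2 * pnorm M p f"
    using near_small_above_line[OF p q, of "e/2"] e by auto
  \<comment> \<open>Capping the distance from below makes the kernel bounded and continuous. It
    differs from the true kernel only at distances below R, and there by at most the true kernel, so
    \<open>near R\<close> absorbs the difference.\<close>
  define ker where "ker s = (max s R) powr - lam" for s :: real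
  have kerb: "0 \<le> ker s" "ker s \<le> R powr - lam" for s
    unfolding ker_def using R lam by (auto intro!: powr_mono2')
  have [measurable]: "ker \<in> borel_measurable borel" unfolding ker_def by measurable
  define e1 where "e1 = e / (2 * k * (n + 1))"
  have e1: "0 < e1" using e k n by (simp add: e1_def)
  have "continuous_on {0..1} ker" unfolding ker_def using R by (intro continuous_intros) auto
  then have "uniformly_continuous_on {0..1} ker" by (intro compact_uniformly_continuous) auto
  then obtain d where d: "0 < d" "\<And>s s'. s \<in> {0..1} \<Longrightarrow> s' \<in> {0..1} \<Longrightarrow> dist s' s < d \<Longrightarrow> dist (ker s') (ker s) < e1"
    using e1 unfolding uniformly_continuous_on_def by metis
  obtain K0 where K0: "1 / real (Suc K0) < d" using d(1) nat_approx_posE by blast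
  define K where "K = Suc K0"
  have K: "0 < real K" "1 / real K < d" using K0 by (auto simp: K_def)
  define \<phi> where "\<phi> i f = (\<integral>u. ker \<bar>real i / real K - u\<bar> * f u \<partial>M)" for i :: nat and f
  have ki: "integrable M (\<lambda>u. ker \<bar>x - u\<bar> * f u)" if f: "f \<in> Lfun M p" for x f
  proof (rule Bochner_Integration.integrable_bound)
    show "integrable M (\<lambda>u. R powr - lam * f u)" using f1(1)[OF f] by simp
    show "(\<lambda>u. ker \<bar>x - u\<bar> * f u) \<in> borel_measurable M" using LfunD(1)[OF f] by measurable
    show "AE u in M. norm (ker \<bar>x - u\<bar> * f u) \<le> norm (R powr - lam * f u)"
      using kerb by (intro AE_I2) (auto simp: abs_mult intro!: mult_right_mono)
  qed
  \<comment> \<open>One constant in two roles: it bounds the functionals, and through n, the q-norm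
    of the constant 1, it is the coefficient of their sum.\<close>
  define C0 where "C0 = R powr - lam * k + n"
  have C0: "0 \<le> C0" "R powr - lam * k \<le> C0" "n \<le> C0" using k n by (auto simp: C0_def)
  have \<phi>b: "\<bar>\<phi> i f\<bar> \<le> C0 * pnorm M p f" if f: "f \<in> Lfun M p" for i f
  proof -
    have "\<bar>\<phi> i f\<bar> \<le> (\<integral>u. \<bar>ker \<bar>real i / real K - u\<bar> * f u\<bar> \<partial>M)" unfolding \<phi>_def by (rule integral_abs_bound)
    also have "\<dots> \<le> (\<integral>u. R powr - lam * \<bar>f u\<bar> \<partial>M)"
    proof (rule integral_mono)
      show "integrable M (\<lambda>u. \<bar>ker \<bar>real i / real K - u\<bar> * f u\<bar>)" by (intro integrable_abs ki f)
      show "\<bar>ker \<bar>real i / real K - u\<bar> * f u\<bar> \<le> R powr - lam * \<bar>f u\<bar>" for u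
        using kerb by (auto simp: abs_mult intro!: mult_right_mono)
    qed (use f1(1)[OF f] in auto)
    also have "\<dots> \<le> R powr - lam * (k * pnorm M p f)"
      using f1(2)[OF f] by (simp add: mult_left_mono)
    also have "\<dots> \<le> C0 * pnorm M p f" using C0(2) by (simp add: mult.assoc[symmetric] mult_right_mono)
    finally show ?thesis .
  qed
  have main: "pnorm N q (T f) \<le> e * pnorm M p f + C0 * (\<Sum>i<K. \<bar>\<phi> i f\<bar>)" if f: "f \<in> Lfun M p" for f
  proof -
    note [measurable] = LfunD(1)[OF f]
    \<comment> \<open>The grid point i/K next to t depends on t; summing over all i gives a bound
      that does not.\<close>
    define S where "S = e1 * (k * pnorm M p f) + (\<Sum>i<K. \<bar>\<phi> i f\<bar>)"
    have S: "0 \<le> S" using e1 k by (auto simp: S_def intro!: add_nonneg_nonneg sum_nonneg)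
    have pt: "AE t in N. \<bar>T f t\<bar> \<le> \<bar>near R f t + S\<bar>"
      using near_finite[OF p f] AE_space
    proof eventually_elim
      case (elim t)
      then have t: "t \<in> \<Omega>" by simp
      have t01: "0 < t" "t < 1" using t Om_sub by auto
      define i where "i = nat \<lfloor>t * K\<rfloor>"
      have "real_of_int \<lfloor>t * K\<rfloor> \<le> t * K" "t * K < real_of_int \<lfloor>t * K\<rfloor> + 1" by linarith+
      moreover have "0 \<le> \<lfloor>t * K\<rfloor>" using t01 K by simp
      ultimately have i: "real i \<le> t * K" "t * K < real i + 1" by (auto simp: i_def)
      have "t * K < K" using t01 K by simp
      then have iK: "i < K" using i(1) by linarith
      have ti: "\<bar>t - real i / K\<bar> \<le> 1 / K"
      proof -
        have "real i / K \<le> t" "t \<le> (real i + 1) / K" using i K by (auto simp: field_simps)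
        then show ?thesis by (simp add: add_divide_distrib abs_le_iff)
      qed
      have iK01: "0 \<le> real i / K" "real i / K \<le> 1" using iK by auto
      have Tint: "integrable M (\<lambda>u. f u / \<bar>t - u\<bar> powr lam)" using elim t by (intro T_integrable) auto
      have "nnear R f t \<le> nnear 1 f t" by (rule nnear_mono) (use R in auto)
      then have nfin: "nnear R f t < \<infinity>" using elim by (auto intro: le_less_trans)
      have nint: "integrable M (\<lambda>u. if \<bar>t - u\<bar> < R then \<bar>t - u\<bar> powr - lam * \<bar>f u\<bar> else 0)"
        using nfin unfolding nnear_def by (intro integrableI_nonneg) auto
      have neq: "near R f t = (\<integral>u. (if \<bar>t - u\<bar> < R then \<bar>t - u\<bar> powr - lam * \<bar>f u\<bar> else 0) \<partial>M)"
        unfolding near_def nnear_def by (subst integral_eq_nn_integral) auto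
      have "\<bar>T f t - \<phi> i f\<bar> = \<bar>\<integral>u. f u / \<bar>t - u\<bar> powr lam - ker \<bar>real i / K - u\<bar> * f u \<partial>M\<bar>"
        unfolding \<phi>_def frac_integral_def using Tint ki[OF f] by simp
      also have "\<dots> \<le> (\<integral>u. \<bar>f u / \<bar>t - u\<bar> powr lam - ker \<bar>real i / K - u\<bar> * f u\<bar> \<partial>M)" by (rule integral_abs_bound)
      also have "\<dots> \<le> (\<integral>u. (if \<bar>t - u\<bar> < R then \<bar>t - u\<bar> powr - lam * \<bar>f u\<bar> else 0) + e1 * \<bar>f u\<bar> \<partial>M)"
      proof (rule integral_mono_AE)
        show "AE u in M. \<bar>f u / \<bar>t - u\<bar> powr lam - ker \<bar>real i / K - u\<bar> * f u\<bar> \<le> 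
           (if \<bar>t - u\<bar> < R then \<bar>t - u\<bar> powr - lam * \<bar>f u\<bar> else 0) + e1 * \<bar>f u\<bar>"
          using AE_unit_lebesgue_neq[of t] AE_space
        proof eventually_elim
          case (elim u)
          then have u: "0 < u" "u < 1" by auto
          have "dist (ker \<bar>t - u\<bar>) (ker \<bar>real i / K - u\<bar>) < e1"
          proof (rule d(2))
            show "\<bar>real i / K - u\<bar> \<in> {0..1}" "\<bar>t - u\<bar> \<in> {0..1}" unfolding atLeastAtMost_iff using u t01 iK01 by linarith+
            have "dist \<bar>t - u\<bar> \<bar>real i / K - u\<bar> \<le> \<bar>t - real i / K\<bar>" by (simp add: dist_real_def)
            then show "dist \<bar>t - u\<bar> \<bar>real i / K - u\<bar> < d" using ti K by linarith
          qed
          then have k1: "\<bar>ker \<bar>t - u\<bar> - ker \<bar>real i / K - u\<bar>\<bar> \<le> e1" by (simp add: dist_real_def)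
          have k2: "\<bar>\<bar>t - u\<bar> powr - lam - ker \<bar>t - u\<bar>\<bar> \<le> (if \<bar>t - u\<bar> < R then \<bar>t - u\<bar> powr - lam else 0)"
          proof (cases "\<bar>t - u\<bar> < R")
            case True
            then have "ker \<bar>t - u\<bar> = R powr - lam" by (simp add: ker_def)
            moreover have "R powr - lam \<le> \<bar>t - u\<bar> powr - lam" using True elim lam by (intro powr_mono2') auto
            ultimately show ?thesis using True kerb(1)[of "\<bar>t - u\<bar>"] by simp
          qed (simp add: ker_def)
          have "f u / \<bar>t - u\<bar> powr lam - ker \<bar>real i / K - u\<bar> * f u = 
            ((\<bar>t - u\<bar> powr - lam - ker \<bar>t - u\<bar>) + (ker \<bar>t - u\<bar> - ker \<bar>real i / K - u\<bar>)) * f u"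
            by (simp add: powr_minus_divide algebra_simps)
          also have "\<bar>\<dots>\<bar> \<le> ((if \<bar>t - u\<bar> < R then \<bar>t - u\<bar> powr - lam else 0) + e1) * \<bar>f u\<bar>"
            unfolding abs_mult
            by (intro mult_right_mono order_trans[OF abs_triangle_ineq add_mono[OF k2 k1]]) auto
          finally show ?case by (simp add: distrib_right split: if_splits)
        qed
      qed (use Tint ki[OF f] nint f1(1)[OF f] in auto)
      also have "\<dots> = near R f t + e1 * (\<integral>u. \<bar>f u\<bar> \<partial>M)" unfolding neq using nint f1(1)[OF f] by simp
      also have "\<dots> \<le> near R f t + e1 * (k * pnorm M p f)" using f1(2)[OF f] e1 by simp
      finally have "\<bar>T f t\<bar> \<le> near R f t + e1 * (k * pnorm M p f) + \<bar>\<phi> i f\<bar>" by linarith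
      also have "\<bar>\<phi> i f\<bar> \<le> (\<Sum>i<K. \<bar>\<phi> i f\<bar>)" using iK by (intro member_le_sum) auto
      finally show ?case using S by (simp add: S_def)
    qed
    have cL: "(\<lambda>_. S) \<in> Lfun N q" by (rule Lfun_bounded[OF finite_N, of _ "\<bar>S\<bar>"]) (use q1 in auto)
    have pc: "pnorm N q (\<lambda>_. S) = S * n"
      using S q1 by (simp add: pnorm_def n_def powr_mult powr_powr mult.commute)
    have "pnorm N q (T f) \<le> pnorm N q (\<lambda>t. near R f t + S)"
      using R(3)[OF f] by (intro pnorm_mono(2)[OF q1(2) _ _ pt] Lfun_add[OF q1(1)] cL) auto
    also have "\<dots> \<le> pnorm N q (near R f) + S * n"
      using pnorm_add_le[OF q1(1) _ cL] R(3)[OF f] pc by auto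
    also have "\<dots> \<le> e/2 * pnorm M p f + S * n" using R(3)[OF f] by simp
    also have "S * n \<le> e/2 * pnorm M p f + C0 * (\<Sum>i<K. \<bar>\<phi> i f\<bar>)"
    proof -
      have "e1 * k * n \<le> e1 * k * (n + 1)" using e1 k by (intro mult_left_mono) auto
      also have "\<dots> = e / 2"
      proof -
        have "e / (2 * k * m) * k * m = e / 2" if "0 < m" for m using that k by simp
        then show ?thesis unfolding e1_def using n by simp
      qed
      finally have "e1 * k * n * pnorm M p f \<le> e / 2 * pnorm M p f" by (intro mult_right_mono) auto
      moreover have "(\<Sum>i<K. \<bar>\<phi> i f\<bar>) * n \<le> (\<Sum>i<K. \<bar>\<phi> i f\<bar>) * C0" using C0 by (intro mult_left_mono sum_nonneg) auto
      moreover have "S * n = e1 * k * n * pnorm M p f + (\<Sum>i<K. \<bar>\<phi> i f\<bar>) * n"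
        by (simp add: S_def algebra_simps)
      ultimately show ?thesis unfolding mult.commute[of C0] by linarith
    qed
    finally show ?thesis by simp
  qed
  show "\<exists>(K::nat) \<phi> C. 0 \<le> C \<and>
     (\<forall>i. \<forall>f\<in>Lfun M p. \<forall>g\<in>Lfun M p. \<phi> i (\<lambda>x. f x + g x) = (\<phi> i f + \<phi> i g :: real)) \<and>
     (\<forall>i a. \<forall>f\<in>Lfun M p. \<phi> i (\<lambda>x. a * f x) = a * \<phi> i f) \<and>
     (\<forall>i. \<forall>f\<in>Lfun M p. \<bar>\<phi> i f\<bar> \<le> C * pnorm M p f) \<and>
     (\<forall>f\<in>Lfun M p. pnorm N q (T f) \<le> e * pnorm M p f + C * (\<Sum>i<K. \<bar>\<phi> i f\<bar>))"
  proof (rule exI[of _ K], rule exI[of _ \<phi>], rule exI[of _ C0], intro conjI C0(1) allI ballI)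
    show "\<phi> i (\<lambda>x. f x + g x) = \<phi> i f + \<phi> i g" if "f \<in> Lfun M p" "g \<in> Lfun M p" for i f g
      unfolding \<phi>_def distrib_left by (rule Bochner_Integration.integral_add[OF ki[OF that(1)] ki[OF that(2)]])
    show "\<phi> i (\<lambda>x. a * f x) = a * \<phi> i f" for i a f
      unfolding \<phi>_def by (subst integral_mult_right_zero[symmetric]) (simp add: ac_simps)
  qed (use \<phi>b main in auto)
qed

end

section \<open>Unboundedness\<close>

lemma pnorm_lower:
  assumes q: "0 < q" and g: "g \<in> Lfun N q" and fin: "finite_measure N" and S: "S \<in> sets N" and a: "0 \<le> a"
    and le: "\<And>t. t \<in> S \<Longrightarrow> a \<le> \<bar>g t\<bar>"
  shows "a * measure N S powr (1/q) \<le> pnorm N q g"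
proof -
  interpret finite_measure N by fact
  have "a powr q * measure N S = (\<integral>t. a powr q * indicator S t \<partial>N)" using S by simp
  also have "\<dots> \<le> (\<integral>t. \<bar>g t\<bar> powr q \<partial>N)"
  proof (rule integral_mono)
    show "integrable N (\<lambda>t. a powr q * indicator S t)" using S by (intro integrable_mult_right) (simp add: less_top[symmetric])
    show "a powr q * indicator S t \<le> \<bar>g t\<bar> powr q" for t
      using le[of t] a q by (auto simp: indicator_def intro!: powr_mono2)
  qed (use g in auto)
  also have "\<dots> = pnorm N q g powr q" using q by (simp add: pnorm_powr)
  finally have "(a powr q * measure N S) powr (1/q) \<le> (pnorm N q g powr q) powr (1/q)"
    using q by (intro powr_mono2) auto
  then show ?thesis using q a by (simp add: powr_mult powr_powr)
qed

context regular_measure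
begin

lemma Om_borel: "\<Omega> \<inter> ball t r \<in> sets N"
proof -
  have "{x\<in>space N. dist t x < r} \<in> sets N" unfolding dist_real_def by measurable
  moreover have "{x\<in>space N. dist t x < r} = \<Omega> \<inter> ball t r" by auto
  ultimately show ?thesis by simp
qed

lemma measure_lower: "t \<in> \<Omega> \<Longrightarrow> 0 < r \<Longrightarrow> r \<le> 1 \<Longrightarrow> c * r powr al \<le> measure N (\<Omega> \<inter> ball t r)"
  using lower[of t r] N.emeasure_eq_measure[of "\<Omega> \<inter> ball t r"] by (simp add: ennreal_le_iff)

lemma measure_Om_pos: "0 < measure N \<Omega>"
proof -
  obtain t where t: "t \<in> \<Omega>" using Om_ne by auto
  have "c * 1 powr al \<le> measure N (\<Omega> \<inter> ball t 1)" by (rule measure_lower[OF t]) auto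
  also have "\<dots> \<le> measure N \<Omega>" using sets.top[of N] by (intro N.finite_measure_mono) auto
  finally show ?thesis using cC by simp
qed

lemma T_bounded_Lfun:
  assumes "f \<in> borel_measurable M" "\<And>x. \<bar>f x\<bar> \<le> H" "0 < q"
  shows "T f \<in> Lfun N q"
proof -
  obtain A where "\<forall>t\<in>\<Omega>. \<bar>T f t\<bar> \<le> A * H" using T_bounded_sup assms(1,2) by blast
  then show ?thesis using assms by (intro Lfun_bounded[OF finite_N, where C = "A * H"]) auto
qed

text \<open>Changing f on a null set changes no value of T f, whether or not the integral converges,
  so the lift is well defined on all classes.\<close>

lemma ae_lift_T:
  assumes f: "f \<in> borel_measurable M"
  shows "ae_lift N T (ae_class M f) = ae_class N (T f)"
  unfolding ae_lift_def
proof (rule UN_ae_class_const[OF f])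
  fix g assume g: "g \<in> ae_class M f"
  note [measurable] = f ae_classD(1)[OF g]
  have "T g t = T f t" for t
    unfolding frac_integral_def
  proof (rule integral_cong_AE)
    show "AE u in M. g u / \<bar>t - u\<bar> powr lam = f u / \<bar>t - u\<bar> powr lam"
      using ae_classD(2)[OF g] by eventually_elim simp
  qed measurable
  then have "T g = T f" by auto
  then show "ae_class N (T g) = ae_class N (T f)" by simp
qed

lemma ae_class_bounded_Linfty:
  "f \<in> borel_measurable M \<Longrightarrow> (\<And>x. \<bar>f x\<bar> \<le> H) \<Longrightarrow> ae_class M f \<in> Linfty M"
  unfolding Linfty_def by blast

text \<open>A point of S comes with some extension U that is known on bounded functions. Necessary
  conditions are thus extracted by testing the norm inequality on bounded functions.\<close>

lemma bounded_operator_extends_T: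
  assumes U: "bounded_operator (Lp M p) (Lp N q) U" "\<forall>F\<in>Linfty M. U F = ae_lift N T F" and pq: "0 < p" "0 < q"
  shows "\<exists>K\<ge>0. \<forall>f H. f \<in> borel_measurable M \<longrightarrow> (\<forall>x. \<bar>f x\<bar> \<le> H) \<longrightarrow> pnorm N q (T f) \<le> K * pnorm M p f"
proof -
  obtain K where K: "\<And>F. F \<in> vcarrier (Lp M p) \<Longrightarrow> vnorm (Lp N q) (U F) \<le> K * vnorm (Lp M p) F"
    using U(1) unfolding bounded_operator_def by blast
  have "pnorm N q (T f) \<le> max K 0 * pnorm M p f" if f: "f \<in> borel_measurable M" and H: "\<And>x. \<bar>f x\<bar> \<le> H" for f H
  proof -
    have "f \<in> Lfun M p" using f H pq by (intro Lfun_bounded[OF finite_unit_lebesgue, where C = H]) auto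
    then have "ae_class M f \<in> vcarrier (Lp M p)" by (simp add: vcarrier_Lp)
    moreover have "U (ae_class M f) = ae_class N (T f)"
      using U(2) ae_class_bounded_Linfty[OF f H] ae_lift_T[OF f] by simp
    ultimately have "pnorm N q (T f) \<le> K * pnorm M p f"
      using K[of "ae_class M f"] f by simp
    also have "\<dots> \<le> max K 0 * pnorm M p f" by (intro mult_right_mono) auto
    finally show ?thesis .
  qed
  then show ?thesis by (intro exI[of _ "max K 0"]) auto
qed

subsection \<open>Test functions\<close>

definition bump :: "real \<Rightarrow> real \<Rightarrow> real \<Rightarrow> real" where
  "bump t r = indicator {t - r<..<t + r}"

lemma bump_measurable [measurable]: "bump t r \<in> borel_measurable M"
proof -
  have "bump t r = (\<lambda>u. if t - r < u \<and> u < t + r then 1 else 0)" by (auto simp: bump_def)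
  then show ?thesis by (simp only:) measurable
qed

lemma abs_bump_le: "\<bar>bump t r u\<bar> \<le> 1"
  by (simp add: bump_def indicator_def)

lemma pnorm_bump:
  assumes "0 < r" "r \<le> t" "r \<le> 1 - t" "0 < p"
  shows "pnorm M p (bump t r) = (2 * r) powr (1/p)"
proof -
  have "{t - r<..<t + r} \<inter> {0<..<1} = {t - r<..<t + r}" using assms by auto
  then have "measure M {t - r<..<t + r} = 2 * r"
    using assms by (subst measure_restrict_space) (auto simp: measure_def)
  moreover have "\<bar>bump t r u\<bar> powr p = indicator {t - r<..<t + r} u" for u by (simp add: bump_def indicator_def)
  moreover have "{t - r<..<t + r} \<inter> space M = {t - r<..<t + r}" using assms by auto
  ultimately show ?thesis by (simp add: pnorm_def)
qed

text \<open>Two points of the interval are at distance at most 2r, so the kernel is at least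
  \<open>(2 * r) powr - lam\<close> on a set of length 2r.\<close>

lemma T_bump_lower:
  assumes r: "0 < r" "r \<le> t0" "r \<le> 1 - t0" and t: "t \<in> \<Omega> \<inter> ball t0 r"
  shows "(2 * r) powr (1 - lam) \<le> T (bump t0 r) t"
proof -
  have i: "integrable M (\<lambda>u. bump t0 r u / \<bar>t - u\<bar> powr lam)"
    by (rule T_bounded_integrable[OF _ bump_measurable abs_bump_le]) (use t in auto)
  have ib: "integrable M (\<lambda>u. (2 * r) powr - lam * bump t0 r u)"
    by (intro integrable_mult_right M.integrable_const_bound[where B = 1]) (auto simp: abs_bump_le)
  have I: "(\<integral>u. bump t0 r u \<partial>M) = 2 * r"
  proof -
    have "(\<integral>u. \<bar>bump t0 r u\<bar> powr 1 \<partial>M) = 2 * r"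
      using pnorm_bump[OF r zero_less_one] r by (simp add: pnorm_def)
    moreover have "\<bar>bump t0 r u\<bar> powr 1 = bump t0 r u" for u by (simp add: bump_def)
    ultimately show ?thesis by simp
  qed
  have "(2 * r) powr (1 - lam) = (2 * r) powr - lam * (\<integral>u. bump t0 r u \<partial>M)"
    unfolding I using r powr_add[of "2 * r" "- lam" 1] by (simp add: add.commute)
  also have "(2 * r) powr - lam * (\<integral>u. bump t0 r u \<partial>M) = (\<integral>u. (2 * r) powr - lam * bump t0 r u \<partial>M)" by simp
  also have "\<dots> \<le> (\<integral>u. bump t0 r u / \<bar>t - u\<bar> powr lam \<partial>M)"
  proof (rule integral_mono_AE[OF ib i])
    show "AE u in M. (2 * r) powr - lam * bump t0 r u \<le> bump t0 r u / \<bar>t - u\<bar> powr lam"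
      using AE_unit_lebesgue_neq[of t]
    proof eventually_elim
      case (elim u)
      show ?case
      proof (cases "u \<in> {t0 - r<..<t0 + r}")
        case True
        then have "\<bar>t - u\<bar> \<le> 2 * r" using t by (auto simp: dist_real_def)
        then have "(2 * r) powr - lam \<le> \<bar>t - u\<bar> powr - lam" using elim lam by (intro powr_mono2') auto
        then show ?thesis using True by (simp add: bump_def powr_minus_divide)
      qed (simp add: bump_def)
    qed
  qed
  finally show ?thesis by (simp add: frac_integral_def)
qed

text \<open>The image of a bump of radius r has norm at least of order
  \<open>r powr (1 - lam + al / q)\<close>, the bump itself norm of order
  \<open>r powr (1/p)\<close>; comparing them as r tends to 0 gives the inequality.\<close>

lemma unbounded_below_line:
  assumes pq: "1 < p" "1 < q" and K: "0 \<le> K" "\<And>f H. f \<in> borel_measurable M \<Longrightarrow> (\<And>x. \<bar>f x\<bar> \<le> H) \<Longrightarrow> pnorm N q (T f) \<le> K * pnorm M p f"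
  shows "1/p - 1 + lam \<le> al / q"
proof (rule ccontr)
  assume "\<not> 1/p - 1 + lam \<le> al / q"
  define d where "d = 1/p - 1 + lam - al / q"
  have d: "0 < d" using \<open>\<not> _\<close> by (simp add: d_def)
  obtain t0 where t0: "t0 \<in> \<Omega>" using Om_ne by auto
  then have t01: "0 < t0" "t0 < 1" using Om_sub by auto
  define K' where "K' = K * 2 powr (1/p) / (2 powr (1 - lam) * c powr (1/q))"
  have K': "0 \<le> K'" using K cC by (simp add: K'_def)
  \<comment> \<open>The first two bounds keep the bump inside (0,1); the third makes
    \<open>r powr - d\<close> at least K' + 1.\<close>
  define r where "r = min (min t0 (1 - t0)) ((K' + 1) powr (- 1 / d))"
  have r: "0 < r" "r \<le> t0" "r \<le> 1 - t0" "r \<le> (K' + 1) powr (- 1 / d)" using t01 K' by (auto simp: r_def)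
  have TL: "T (bump t0 r) \<in> Lfun N q" by (rule T_bounded_Lfun[OF bump_measurable abs_bump_le]) (use pq in auto)
  have "(2 * r) powr (1 - lam) * (c * r powr al) powr (1/q) \<le> (2 * r) powr (1 - lam) * measure N (\<Omega> \<inter> ball t0 r) powr (1/q)"
    using measure_lower[OF t0] r t01 cC pq by (intro mult_left_mono powr_mono2) auto
  also have "\<dots> \<le> pnorm N q (T (bump t0 r))"
    using T_bump_lower[OF r(1-3)] pq by (intro pnorm_lower[OF _ TL finite_N Om_borel]) (auto intro: order_trans[OF _ abs_ge_self])
  also have "\<dots> \<le> K * pnorm M p (bump t0 r)" by (rule K(2)[OF bump_measurable abs_bump_le])
  also have "\<dots> = K * (2 * r) powr (1/p)" using pnorm_bump[OF r(1-3)] pq by simp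
  finally have le: "(2 * r) powr (1 - lam) * (c * r powr al) powr (1/q) \<le> K * (2 * r) powr (1/p)" .
  have "r powr - d \<le> K'"
  proof -
    have e: "r powr (1 - lam) * r powr (al / q) = r powr - d * r powr (1/p)"
    proof -
      have "(1 - lam) + al / q = - d + 1/p" by (simp add: d_def)
      then show ?thesis unfolding powr_add[symmetric] by (rule arg_cong)
    qed
    have "(2 powr (1 - lam) * c powr (1/q) * r powr - d) * r powr (1/p) \<le> (K * 2 powr (1/p)) * r powr (1/p)"
    proof -
      have L: "(2 * r) powr (1 - lam) * (c * r powr al) powr (1/q) = 
          (2 powr (1 - lam) * c powr (1/q)) * (r powr (1 - lam) * r powr (al / q))"
        by (simp add: powr_mult powr_powr ac_simps)
      show ?thesis using le unfolding L e by (simp add: powr_mult ac_simps)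
    qed
    then have "2 powr (1 - lam) * c powr (1/q) * r powr - d \<le> K * 2 powr (1/p)" using r by simp
    then show ?thesis using cC by (simp add: K'_def field_simps)
  qed
  moreover have "K' + 1 \<le> r powr - d"
  proof -
    have "K' + 1 = ((K' + 1) powr (- 1 / d)) powr - d" using K' d by (simp add: powr_powr)
    also have "\<dots> \<le> r powr - d" using r d by (intro powr_mono2') auto
    finally show ?thesis .
  qed
  ultimately show False by simp
qed

section \<open>Neighbourhoods of \<Omega> and the ladder functions\<close>

definition nbhd :: "nat \<Rightarrow> real set" where
  "nbhd j = {u\<in>{0<..<1}. \<exists>z\<in>\<Omega>. \<bar>u - z\<bar> < 2 powr - real j}"

lemma nbhd_sets [measurable]: "nbhd j \<in> sets M"
proof -
  have "nbhd j = {0<..<1} \<inter> (\<Union>z\<in>\<Omega>. ball z (2 powr - real j))"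
    by (auto simp: nbhd_def dist_real_def abs_minus_commute)
  then have "open (nbhd j)" by (auto intro!: open_Int open_UN)
  then have "nbhd j \<in> sets lebesgue" by simp
  then show ?thesis by (subst sets_restrict_space_iff) (auto simp: nbhd_def)
qed

text \<open>Double counting in place of a covering argument: every u of the neighbourhood has N-mass
  at least \<open>c * r powr al\<close> within distance 2r, while every t has Lebesgue measure at
  most 4r within distance 2r.\<close>

lemma measure_nbhd_le: "measure M (nbhd j) \<le> 4 * measure N \<Omega> / c * 2 powr (- (1 - al) * real j)"
proof -
  define r where "r = 2 powr - real j"
  have r: "0 < r" "r \<le> 1" using powr_mono[of "- real j" 0 2] by (auto simp: r_def)
  have "ennreal (c * r powr al) * emeasure M (nbhd j) = (\<integral>\<^sup>+u. ennreal (c * r powr al) * indicator (nbhd j) u \<partial>M)"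
    by (simp add: nn_integral_cmult_indicator)
  also have "\<dots> \<le> (\<integral>\<^sup>+u. (\<integral>\<^sup>+t. indicator {z. \<bar>t - z\<bar> < 2 * r} u \<partial>N) \<partial>M)"
  proof (rule nn_integral_mono)
    fix u
    show "ennreal (c * r powr al) * indicator (nbhd j) u \<le> (\<integral>\<^sup>+t. indicator {z. \<bar>t - z\<bar> < 2 * r} u \<partial>N)"
    proof (cases "u \<in> nbhd j")
      case True
      then obtain z where z: "z \<in> \<Omega>" "\<bar>u - z\<bar> < r" by (auto simp: nbhd_def r_def)
      have "ennreal (c * r powr al) \<le> emeasure N (\<Omega> \<inter> ball z r)" by (rule lower[OF z(1) r])
      also have "\<dots> \<le> emeasure N {t\<in>space N. \<bar>t - u\<bar> < 2 * r}"
      proof (rule emeasure_mono)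
        show "\<Omega> \<inter> ball z r \<subseteq> {t\<in>space N. \<bar>t - u\<bar> < 2 * r}" using z by (auto simp: dist_real_def)
        show "{t\<in>space N. \<bar>t - u\<bar> < 2 * r} \<in> sets N" by measurable
      qed
      also have "\<dots> = (\<integral>\<^sup>+t. indicator {t\<in>space N. \<bar>t - u\<bar> < 2 * r} t \<partial>N)"
        by (rule nn_integral_indicator[symmetric]) measurable
      also have "\<dots> = (\<integral>\<^sup>+t. indicator {z. \<bar>t - z\<bar> < 2 * r} u \<partial>N)"
        by (intro nn_integral_cong) (auto simp: indicator_def)
      finally show ?thesis using True by simp
    qed simp
  qed
  also have "\<dots> = (\<integral>\<^sup>+t. (\<integral>\<^sup>+u. indicator {z. \<bar>t - z\<bar> < 2 * r} u \<partial>M) \<partial>N)"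
  proof (rule NM.Fubini')
    have "(\<lambda>z. indicator {z'. \<bar>fst z - z'\<bar> < 2 * r} (snd z) :: ennreal) = (\<lambda>z. if \<bar>fst z - snd z\<bar> < 2 * r then 1 else 0)"
      by (auto simp: indicator_def)
    then show "(\<lambda>(x, y). indicator {z. \<bar>x - z\<bar> < 2 * r} y :: ennreal) \<in> borel_measurable (N \<Otimes>\<^sub>M M)"
      unfolding case_prod_beta' by (simp only:) measurable
  qed
  also have "\<dots> \<le> (\<integral>\<^sup>+t. ennreal (2 * (2 * r)) \<partial>N)"
  proof (rule nn_integral_mono)
    fix t
    have "(\<integral>\<^sup>+u. indicator {z. \<bar>t - z\<bar> < 2 * r} u \<partial>M) = (\<integral>\<^sup>+u. indicator {u\<in>space M. \<bar>t - u\<bar> < 2 * r} u \<partial>M)"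
      by (intro nn_integral_cong) (auto simp: indicator_def)
    also have "\<dots> = emeasure M {u\<in>space M. \<bar>t - u\<bar> < 2 * r}" by (rule nn_integral_indicator) measurable
    also have "\<dots> \<le> ennreal (2 * (2 * r) powr 1)" using r by (intro emeasure_unit_lebesgue_ball) auto
    finally show "(\<integral>\<^sup>+u. indicator {z. \<bar>t - z\<bar> < 2 * r} u \<partial>M) \<le> ennreal (2 * (2 * r))" using r by simp
  qed
  also have "\<dots> = ennreal (4 * r * measure N \<Omega>)"
    using r N.emeasure_eq_measure[of \<Omega>] by (simp add: ennreal_mult[symmetric])
  finally have "c * r powr al * measure M (nbhd j) \<le> 4 * r * measure N \<Omega>"
    using r cC by (simp add: M.emeasure_eq_measure ennreal_mult[symmetric] ennreal_le_iff)
  then have "measure M (nbhd j) \<le> 4 * measure N \<Omega> / c * (r / r powr al)"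
    using r cC by (simp add: field_simps)
  also have "r / r powr al = r powr (1 - al)" using r by (simp add: powr_diff)
  also have "\<dots> = 2 powr (- (1 - al) * real j)"
  proof -
    have "- real j * (1 - al) = - (1 - al) * real j" by (simp add: algebra_simps)
    then show ?thesis unfolding r_def powr_powr by (rule arg_cong)
  qed
  finally show ?thesis .
qed

text \<open>At distances from \<Omega> below 1/2 this is comparable to the distance to the power -
  (1 - lam), capped at height of order \<open>2 powr ((1 - lam) * real n)\<close>. The weights are
  those for which every dyadic scale contributes a fixed amount to the image on \<Omega>.\<close>

definition ladder :: "nat \<Rightarrow> real \<Rightarrow> real" where
  "ladder n u = (\<Sum>j\<in>{1..n}. 2 powr ((1 - lam) * real j) * indicator (nbhd j) u)"

lemma ladder_measurable [measurable]: "ladder n \<in> borel_measurable M"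
  unfolding ladder_def by measurable

lemma ladder_nonneg: "0 \<le> ladder n u"
  unfolding ladder_def by (intro sum_nonneg) auto

lemma ladder_le: "ladder n u \<le> 1 / (1 - 2 powr - (1 - lam)) * 2 powr ((1 - lam) * real n)"
proof (induction n)
  case 0
  have "2 powr - (1 - lam) < (1::real)" using powr_less_mono[of "- (1 - lam)" 0 2] lam by simp
  then show ?case by (simp add: ladder_def)
next
  case (Suc n)
  define G where "G = 1 / (1 - 2 powr - (1 - lam))"
  have "2 powr - (1 - lam) < (1::real)" using powr_less_mono[of "- (1 - lam)" 0 2] lam by simp
  moreover have "1 / (1 - x) * x + 1 = 1 / (1 - x)" if "x < 1" for x :: real using that by (simp add: field_simps)
  ultimately have G: "G * 2 powr - (1 - lam) + 1 = G" unfolding G_def by blast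
  have "ladder (Suc n) u = ladder n u + 2 powr ((1 - lam) * real (Suc n)) * indicator (nbhd (Suc n)) u"
    by (simp add: ladder_def)
  also have "\<dots> \<le> G * 2 powr ((1 - lam) * real n) + 2 powr ((1 - lam) * real (Suc n)) * 1"
    using Suc by (intro add_mono mult_left_mono) (auto simp: G_def)
  also have "2 powr ((1 - lam) * real n) = 2 powr ((1 - lam) * real (Suc n)) * 2 powr - (1 - lam)"
    by (simp add: algebra_simps flip: powr_add)
  also have "G * (2 powr ((1 - lam) * real (Suc n)) * 2 powr - (1 - lam)) + 2 powr ((1 - lam) * real (Suc n)) * 1
     = (G * 2 powr - (1 - lam) + 1) * 2 powr ((1 - lam) * real (Suc n))" by (simp add: algebra_simps)
  also have "\<dots> = G * 2 powr ((1 - lam) * real (Suc n))" by (simp only: G)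
  finally show ?case unfolding G_def .
qed

text \<open>Geometric growth makes the rung with the largest index containing u dominate, so the
  power of the sum is comparable to the sum of the powers.\<close>

lemma ladder_powr_le:
  assumes p: "0 < p"
  shows "ladder n u powr p \<le> (1 / (1 - 2 powr - (1 - lam))) powr p * 
     (\<Sum>j\<in>{1..n}. 2 powr (p * (1 - lam) * real j) * indicator (nbhd j) u)"
proof (induction n)
  case 0 then show ?case using p by (simp add: ladder_def)
next
  case (Suc n)
  define G where "G = 1 / (1 - 2 powr - (1 - lam))"
  have "2 powr - (1 - lam) < (1::real)" using powr_less_mono[of "- (1 - lam)" 0 2] lam by simp
  then have G: "0 < G" by (simp add: G_def)
  show ?case
  proof (cases "u \<in> nbhd (Suc n)")
    case True
    have "ladder (Suc n) u powr p \<le> (G * 2 powr ((1 - lam) * real (Suc n))) powr p"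
      using ladder_le[of "Suc n" u] ladder_nonneg p unfolding G_def by (intro powr_mono2) auto
    also have "\<dots> = G powr p * (2 powr (p * (1 - lam) * real (Suc n)) * indicator (nbhd (Suc n)) u)"
      using True by (simp add: powr_mult powr_powr ac_simps)
    also have "\<dots> \<le> G powr p * (\<Sum>j\<in>{1..Suc n}. 2 powr (p * (1 - lam) * real j) * indicator (nbhd j) u)"
      by (intro mult_left_mono member_le_sum) auto
    finally show ?thesis unfolding G_def .
  next
    case False
    then have "ladder (Suc n) u = ladder n u" 
      "(\<Sum>j\<in>{1..Suc n}. 2 powr (p * (1 - lam) * real j) * indicator (nbhd j) u) = (\<Sum>j\<in>{1..n}. 2 powr (p * (1 - lam) * real j) * indicator (nbhd j) u :: real)"
      by (auto simp: ladder_def)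
    then show ?thesis using Suc by simp
  qed
qed

text \<open>Each rung contributes at least 1: an interval of length r =
  \<open>2 powr - real j\<close> next to t carries the weight \<open>r powr - (1 - lam)\<close> and
  the kernel is at least \<open>r powr - lam\<close> there.\<close>

lemma T_ladder_ge:
  assumes t: "t \<in> \<Omega>"
  shows "real n \<le> T (ladder n) t"
proof -
  define g where "g j u = 2 powr ((1 - lam) * real j) * indicator (nbhd j) u" for j :: nat and u :: real
  have [measurable]: "g j \<in> borel_measurable M" for j unfolding g_def by measurable
  have gi: "integrable M (\<lambda>u. g j u / \<bar>t - u\<bar> powr lam)" for j
    by (rule T_bounded_integrable[OF t, where H = "2 powr ((1 - lam) * real j)"]) (auto simp: g_def indicator_def)
  have one: "1 \<le> (\<integral>u. g j u / \<bar>t - u\<bar> powr lam \<partial>M)" if j: "1 \<le> j" for j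
  proof -
    define r where "r = 2 powr - real j"
    have r: "0 < r" "r \<le> 1/2" using j powr_mono[of "- real j" "-1" 2] by (auto simp: r_def powr_minus_divide)
    have t01: "0 < t" "t < 1" using t Om_sub by auto
    \<comment> \<open>The side of t is chosen so that the interval stays in (0,1). This works since
      r is at most 1/2, which is why rungs start at j = 1.\<close>
    define I where "I = (if t \<le> 1/2 then {t<..<t + r} else {t - r<..<t})"
    have I: "I \<subseteq> {0<..<1}" "I \<in> sets lebesgue" "measure lebesgue I = r" using t01 r by (auto simp: I_def)
    have IM: "I \<in> sets M" using I by (subst sets_restrict_space_iff) auto
    have mI: "measure M I = r" using I by (subst measure_restrict_space) auto
    have In: "I \<subseteq> nbhd j"
    proof
      fix u assume u: "u \<in> I"
      then have "\<bar>u - t\<bar> < r" using r by (auto simp: I_def split: if_splits)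
      then show "u \<in> nbhd j" using u I t by (auto simp: nbhd_def r_def)
    qed
    have "1 = 2 powr ((1 - lam) * real j) * r powr - lam * r"
    proof -
      have "(1 - lam) * real j = - real j * - (1 - lam)" by (simp add: algebra_simps)
      then have "2 powr ((1 - lam) * real j) = r powr - (1 - lam)" unfolding r_def powr_powr by (rule arg_cong)
      moreover have "r powr - (1 - lam) * r powr - lam = r powr - 1" by (simp flip: powr_add)
      ultimately show ?thesis using r by (simp add: powr_minus_divide)
    qed
    also have "\<dots> = (\<integral>u. 2 powr ((1 - lam) * real j) * r powr - lam * indicator I u \<partial>M)"
      using IM mI Int_absorb2[OF I(1)] by simp
    also have "\<dots> \<le> (\<integral>u. g j u / \<bar>t - u\<bar> powr lam \<partial>M)"
    proof (rule integral_mono[OF _ gi])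
      show "integrable M (\<lambda>u. 2 powr ((1 - lam) * real j) * r powr - lam * indicator I u)"
        using IM by (intro integrable_mult_right) (simp add: less_top[symmetric])
      fix u
      show "2 powr ((1 - lam) * real j) * r powr - lam * indicator I u \<le> g j u / \<bar>t - u\<bar> powr lam"
      proof (cases "u \<in> I")
        case True
        then have d: "0 < \<bar>t - u\<bar>" "\<bar>t - u\<bar> < r" by (auto simp: I_def split: if_splits)
        have "r powr - lam \<le> \<bar>t - u\<bar> powr - lam" using d lam by (intro powr_mono2') auto
        then have "2 powr ((1 - lam) * real j) * r powr - lam \<le> 2 powr ((1 - lam) * real j) * \<bar>t - u\<bar> powr - lam"
          by (intro mult_left_mono) auto
        moreover have "g j u / \<bar>t - u\<bar> powr lam = 2 powr ((1 - lam) * real j) * \<bar>t - u\<bar> powr - lam"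
          using True In by (auto simp: g_def powr_minus_divide)
        ultimately show ?thesis using True by simp
      qed (simp add: g_def)
    qed
    finally show ?thesis .
  qed
  have "real n = (\<Sum>j\<in>{1..n}. 1)" by simp
  also have "\<dots> \<le> (\<Sum>j\<in>{1..n}. (\<integral>u. g j u / \<bar>t - u\<bar> powr lam \<partial>M))" by (intro sum_mono one) auto
  also have "\<dots> = (\<integral>u. (\<Sum>j\<in>{1..n}. g j u / \<bar>t - u\<bar> powr lam) \<partial>M)"
    by (rule Bochner_Integration.integral_sum[symmetric]) (rule gi)
  also have "\<dots> = T (ladder n) t"
    unfolding frac_integral_def ladder_def g_def sum_divide_distrib ..
  finally show ?thesis .
qed

text \<open>The functions \<open>ladder n\<close> witness that \<open>\<Omega>\<close> has zero capacity for this range of exponents.\<close>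

lemma unbounded_small_exponent:
  assumes pq: "1 < p" "1 < q" and K: "0 \<le> K" "\<And>f H. f \<in> borel_measurable M \<Longrightarrow> (\<And>x. \<bar>f x\<bar> \<le> H) \<Longrightarrow> pnorm N q (T f) \<le> K * pnorm M p f"
  shows "1 - al < p * (1 - lam)"
proof (rule ccontr)
  assume "\<not> 1 - al < p * (1 - lam)"
  then have le: "p * (1 - lam) \<le> 1 - al" by simp
  define G where "G = 1 / (1 - 2 powr - (1 - lam))"
  have "2 powr - (1 - lam) < (1::real)" using powr_less_mono[of "- (1 - lam)" 0 2] lam by simp
  then have G: "0 < G" by (simp add: G_def)
  define C1 where "C1 = 4 * measure N \<Omega> / c"
  have C1: "0 \<le> C1" using cC by (simp add: C1_def)
  have lb: "\<bar>ladder n u\<bar> \<le> G * 2 powr ((1 - lam) * real n)" for n u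
    using ladder_le[of n u] ladder_nonneg[of n u] by (simp add: G_def)
  \<comment> \<open>Under the negated claim the p-th power of rung j outgrows the decay of the
    measure of \<open>nbhd j\<close> at no scale, so each scale contributes a bounded amount and the
    p-th power of the norm grows at most linearly in n.\<close>
  have up: "pnorm M p (ladder n) \<le> (G powr p * C1 * n) powr (1/p)" for n
  proof -
    have "(\<integral>u. \<bar>ladder n u\<bar> powr p \<partial>M) \<le> (\<integral>u. G powr p * (\<Sum>j\<in>{1..n}. 2 powr (p * (1 - lam) * real j) * indicator (nbhd j) u) \<partial>M)"
    proof (rule integral_mono)
      show "integrable M (\<lambda>u. \<bar>ladder n u\<bar> powr p)"
        using lb[of n] pq by (intro LfunD(2) Lfun_bounded[OF finite_unit_lebesgue]) auto
      show "integrable M (\<lambda>u. G powr p * (\<Sum>j\<in>{1..n}. 2 powr (p * (1 - lam) * real j) * indicator (nbhd j) u))"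
        by (intro integrable_mult_right Bochner_Integration.integrable_sum) (simp add: less_top[symmetric])
      show "\<bar>ladder n u\<bar> powr p \<le> G powr p * (\<Sum>j\<in>{1..n}. 2 powr (p * (1 - lam) * real j) * indicator (nbhd j) u)" for u
        using ladder_powr_le[of p n u] ladder_nonneg[of n u] pq by (simp add: G_def)
    qed
    also have "\<dots> = G powr p * (\<integral>u. (\<Sum>j\<in>{1..n}. 2 powr (p * (1 - lam) * real j) * indicator (nbhd j) u) \<partial>M)" by simp
    also have "(\<integral>u. (\<Sum>j\<in>{1..n}. 2 powr (p * (1 - lam) * real j) * indicator (nbhd j) u) \<partial>M) = (\<Sum>j\<in>{1..n}. 2 powr (p * (1 - lam) * real j) * measure M (nbhd j))"
    proof (subst Bochner_Integration.integral_sum)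
      show "integrable M (\<lambda>u. 2 powr (p * (1 - lam) * real j) * indicator (nbhd j) u)" for j
        by (intro integrable_mult_right) (simp add: less_top[symmetric])
      show "(\<Sum>j\<in>{1..n}. \<integral>u. 2 powr (p * (1 - lam) * real j) * indicator (nbhd j) u \<partial>M) = (\<Sum>j\<in>{1..n}. 2 powr (p * (1 - lam) * real j) * measure M (nbhd j))"
        using sets.sets_into_space[OF nbhd_sets] by (intro sum.cong) (auto simp: Int_absorb2)
    qed
    also have "G powr p * (\<Sum>j\<in>{1..n}. 2 powr (p * (1 - lam) * real j) * measure M (nbhd j)) \<le> G powr p * (\<Sum>j\<in>{1..n}. C1)"
    proof (intro mult_left_mono sum_mono)
      fix j
      have "2 powr (p * (1 - lam) * real j) * measure M (nbhd j) \<le> 2 powr (p * (1 - lam) * real j) * (C1 * 2 powr (- (1 - al) * real j))"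
        using measure_nbhd_le[of j] unfolding C1_def by (intro mult_left_mono) auto
      also have "\<dots> = C1 * 2 powr ((p * (1 - lam) - (1 - al)) * real j)"
      proof -
        have e: "(p * (1 - lam) - (1 - al)) * real j = p * (1 - lam) * real j + (- (1 - al) * real j)"
          by (simp add: algebra_simps)
        show ?thesis unfolding e powr_add by (simp only: mult.left_commute)
      qed
      also have "\<dots> \<le> C1 * 2 powr 0" using C1 le by (intro mult_left_mono powr_mono mult_nonpos_nonneg) auto
      finally show "2 powr (p * (1 - lam) * real j) * measure M (nbhd j) \<le> C1" by simp
    qed auto
    finally have "(\<integral>u. \<bar>ladder n u\<bar> powr p \<partial>M) \<le> G powr p * C1 * n" by (simp add: ac_simps)
    then show ?thesis unfolding pnorm_def using pq by (intro powr_mono2) auto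
  qed
  \<comment> \<open>The image is at least n on \<Omega>, against a norm of order
    \<open>n powr (1/p)\<close>. In the case of equality a single scale gives no contradiction; it
    is the accumulation over n scales, with p > 1, that does.\<close>
  define K' where "K' = K * (G powr p * C1) powr (1/p) / measure N \<Omega> powr (1/q)"
  have bd: "real n powr (1 - 1/p) \<le> K'" if n: "0 < n" for n :: nat
  proof -
    have TL: "T (ladder n) \<in> Lfun N q" using lb[of n] pq by (intro T_bounded_Lfun) auto
    have "real n * measure N \<Omega> powr (1/q) \<le> pnorm N q (T (ladder n))"
      using T_ladder_ge[of _ n] sets.top[of N] pq
      by (intro pnorm_lower[OF _ TL finite_N]) (auto intro: order_trans[OF _ abs_ge_self])
    also have "\<dots> \<le> K * pnorm M p (ladder n)" by (rule K(2)[OF ladder_measurable lb])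
    also have "\<dots> \<le> K * (G powr p * C1 * n) powr (1/p)" by (intro mult_left_mono up K)
    also have "\<dots> = K * (G powr p * C1) powr (1/p) * real n powr (1/p)" using C1 G by (simp add: powr_mult)
    finally have "real n * measure N \<Omega> powr (1/q) \<le> K * (G powr p * C1) powr (1/p) * real n powr (1/p)" .
    then have "real n \<le> K' * real n powr (1/p)" using measure_Om_pos by (simp add: K'_def field_simps)
    moreover have "real n = real n powr (1 - 1/p) * real n powr (1/p)" using n by (simp flip: powr_add)
    ultimately have "real n powr (1 - 1/p) * real n powr (1/p) \<le> K' * real n powr (1/p)" by simp
    then show ?thesis using n by simp
  qed
  define m where "m = nat \<lceil>(\<bar>K'\<bar> + 1) powr (1 / (1 - 1/p))\<rceil> + 1"
  have "\<bar>K'\<bar> + 1 = ((\<bar>K'\<bar> + 1) powr (1 / (1 - 1/p))) powr (1 - 1/p)" using pq by (simp add: powr_powr)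
  also have "\<dots> \<le> real m powr (1 - 1/p)" using pq unfolding m_def by (intro powr_mono2) (auto, linarith)
  also have "\<dots> \<le> K'" by (rule bd) (simp add: m_def)
  finally show False by simp
qed

end

section \<open>The critical line\<close>

context regular_measure
begin

text \<open>On the critical line the images of normalized bumps of width tending to zero keep a norm bounded below
  on sets of measure tending to zero, so no subsequence is Cauchy.\<close>

lemma not_compact_on_line:
  assumes p: "1 < p" and q: "1 < q" and line: "1/p - 1 + lam = al / q"
    and U: "\<forall>F\<in>Linfty M. U F = ae_lift N T F"
  shows "\<not> compact_operator (Lp M p) (Lp N q) U"
proof
  assume comp: "compact_operator (Lp M p) (Lp N q) U"
  have p0: "p > 0" and q0: "q > 0" "q \<ge> 1" using p q by auto
  interpret Metric_space "vcarrier (Lp N q)" "vdist (Lp N q)" by (rule Metric_space_Lp[OF q0(2)])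
  obtain t0 where t0: "t0 \<in> \<Omega>" using Om_ne by auto
  then have t01: "0 < t0" "t0 < 1" using Om_sub by auto
  define r where "r j = min t0 (1 - t0) * 2 powr - real j" for j :: nat
  have r: "0 < r j" "r j \<le> t0" "r j \<le> 1 - t0" "r j \<le> 1" for j
  proof -
    have "min t0 (1 - t0) * 2 powr - real j \<le> min t0 (1 - t0) * 1"
      using powr_mono[of "- real j" 0 2] t01 by (intro mult_left_mono) auto
    then show "r j \<le> t0" "r j \<le> 1 - t0" "r j \<le> 1" using t01 by (auto simp: r_def)
    show "0 < r j" using t01 by (simp add: r_def)
  qed
  \<comment> \<open>Normalizes the bump in L_p.\<close>
  define a where "a j = (2 * r j) powr - (1/p)" for j
  have a: "0 < a j" for j using r[of j] by (simp add: a_def)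
  define f where "f j u = a j * bump t0 (r j) u" for j u
  have fm[measurable]: "f j \<in> borel_measurable M" for j unfolding f_def by measurable
  have fb: "\<bar>f j u\<bar> \<le> a j" for j u
    using abs_bump_le[of t0 "r j" u] a[of j] by (simp add: f_def abs_mult mult_left_le)
  have fL: "f j \<in> Lfun M p" for j using fb p0 by (intro Lfun_bounded[OF finite_unit_lebesgue]) auto
  have fn: "pnorm M p (f j) = 1" for j
    using pnorm_scale[OF p0, of M "a j" "bump t0 (r j)"] pnorm_bump[OF r(1-3)[of j] p0] a[of j] r(1)[of j]
    by (simp add: f_def[abs_def] a_def flip: powr_add)
  have TL: "T (f j) \<in> Lfun N q" for j by (rule T_bounded_Lfun[OF fm fb q0(1)])
  have Tf: "T (f j) t = a j * T (bump t0 (r j)) t" for j t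
    by (simp add: f_def frac_integral_def flip: times_divide_eq_right)
  define \<sigma> where "\<sigma> j = ae_class N (T (f j))" for j
  define B where "B = U ` {x \<in> vcarrier (Lp M p). vnorm (Lp M p) x \<le> 1}"
  have \<sigma>B: "\<sigma> j \<in> B" for j
  proof -
    have "U (ae_class M (f j)) = \<sigma> j"
      using U ae_class_bounded_Linfty[OF fm fb] ae_lift_T[OF fm] by (simp add: \<sigma>_def)
    moreover have "ae_class M (f j) \<in> {x \<in> vcarrier (Lp M p). vnorm (Lp M p) x \<le> 1}"
      using fL[of j] fn[of j] fm[of j] by (simp add: vcarrier_Lp)
    ultimately show ?thesis unfolding B_def by (rule image_eqI[OF sym])
  qed
  have "B \<subseteq> vcarrier (Lp N q)"
    using comp by (auto simp: B_def compact_operator_def bounded_operator_def)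
  then have "mtotally_bounded B"
    using comp by (intro compact_closure_of_imp_mtotally_bounded) (simp_all add: compact_operator_def vtopology_def B_def)
  then obtain s where s: "strict_mono s" "MCauchy (\<sigma> \<circ> s)"
    using \<sigma>B unfolding mtotally_bounded_sequentially by blast
  \<comment> \<open>On the line, the image of the k-th normalized bump is at least
    \<open>(2 * r k) powr - (al / q)\<close> on a set of measure at least
    \<open>c * r k powr al\<close>. Half of this height leaves a lower bound for the norm in which
    \<open>r k\<close> cancels.\<close>
  define \<kappa> where "\<kappa> = 2 powr (- (al / q)) * c powr (1/q) / 2"
  have \<kappa>: "0 < \<kappa>" using cC by (simp add: \<kappa>_def)
  then obtain n0 where n0: "\<And>n n'. n0 \<le> n \<Longrightarrow> n0 \<le> n' \<Longrightarrow> vdist (Lp N q) ((\<sigma> \<circ> s) n) ((\<sigma> \<circ> s) n') < \<kappa>"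
    using s(2) unfolding MCauchy_def by blast
  define i where "i = s n0"
  obtain A where A: "\<And>f H t. f \<in> borel_measurable M \<Longrightarrow> (\<And>x. \<bar>f x\<bar> \<le> H) \<Longrightarrow> t \<in> \<Omega> \<Longrightarrow> \<bar>T f t\<bar> \<le> A * H"
    using T_bounded_sup by blast
  have alq: "0 < al / q" using al q by simp
  have rlim: "((\<lambda>j. (2 * r j) powr (al / q)) \<longlongrightarrow> 0) sequentially"
  proof -
    have "(\<lambda>j. (2 * r j) powr (al / q)) = (\<lambda>j. (2 * min t0 (1 - t0)) powr (al / q) * (2 powr - (al / q)) ^ j)"
      using t01 by (auto simp: r_def powr_mult powr_powr powr_realpow[symmetric] ac_simps)
    moreover have "(2::real) powr - (al / q) < 1" using powr_less_mono[of "- (al / q)" 0 2] alq by simp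
    then have "(\<lambda>j. (2 * min t0 (1 - t0)) powr (al / q) * (2 powr - (al / q)) ^ j) \<longlonglongrightarrow> (2 * min t0 (1 - t0)) powr (al / q) * 0"
      by (intro tendsto_mult_left LIMSEQ_realpow_zero) auto
    ultimately show ?thesis by simp
  qed
  then have "((\<lambda>j. 2 * (\<bar>A\<bar> * a i) * (2 * r j) powr (al / q)) \<longlongrightarrow> 2 * (\<bar>A\<bar> * a i) * 0) sequentially"
    by (intro tendsto_mult_left)
  then have "\<forall>\<^sub>F j in sequentially. 2 * (\<bar>A\<bar> * a i) * (2 * r j) powr (al / q) < 1"
    by (intro order_tendstoD(2)) auto
  then obtain n1 where n1: "\<And>j. n1 \<le> j \<Longrightarrow> 2 * (\<bar>A\<bar> * a i) * (2 * r j) powr (al / q) < 1"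
    by (auto simp: eventually_sequentially)
  \<comment> \<open>The index i stays fixed while k moves far out: T (f i) is bounded by
    \<open>A * a i\<close>, whereas the lower bound b for T (f k) grows without limit, so the
    difference finally keeps half of b.\<close>
  define k where "k = s (max n0 n1)"
  have "n1 \<le> k" using seq_suble[OF s(1), of "max n0 n1"] by (simp add: k_def)
  define b where "b = (2 * r k) powr - (al / q)"
  have b: "0 < b" "2 * (\<bar>A\<bar> * a i) \<le> b"
  proof -
    show "0 < b" using r[of k] by (simp add: b_def)
    have "2 * (\<bar>A\<bar> * a i) * (2 * r k) powr (al / q) * b < 1 * b" using n1[OF \<open>n1 \<le> k\<close>] \<open>0 < b\<close> by (intro mult_strict_right_mono)
    moreover have "(2 * r k) powr (al / q) * b = 1" using r(1)[of k] by (simp add: b_def flip: powr_add)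
    ultimately show "2 * (\<bar>A\<bar> * a i) \<le> b" by (simp add: mult.assoc)
  qed
  have low: "b / 2 \<le> \<bar>T (f k) t - T (f i) t\<bar>" if t: "t \<in> \<Omega> \<inter> ball t0 (r k)" for t
  proof -
    have "b = a k * (2 * r k) powr (1 - lam)"
    proof -
      have "- (al / q) = - (1/p) + (1 - lam)" using line by simp
      then show ?thesis unfolding b_def a_def powr_add[symmetric] by (rule arg_cong)
    qed
    also have "\<dots> \<le> a k * T (bump t0 (r k)) t" using a[of k] T_bump_lower[OF r(1-3) t] by (intro mult_left_mono) auto
    finally have 1: "b \<le> T (f k) t" by (simp add: Tf)
    have "\<bar>T (f i) t\<bar> \<le> A * a i" using t by (intro A fm fb) auto
    also have "\<dots> \<le> \<bar>A\<bar> * a i" using a[of i] by (intro mult_right_mono) auto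
    finally have 2: "\<bar>T (f i) t\<bar> \<le> b / 2" using b(2) by simp
    show ?thesis using 1 2 by linarith
  qed
  have "\<kappa> = b / 2 * (c * r k powr al) powr (1/q)"
  proof -
    have "b = 2 powr (- (al / q)) * r k powr (- (al / q))" by (simp add: b_def powr_mult)
    moreover have "(c * r k powr al) powr (1/q) = c powr (1/q) * r k powr (al / q)" by (simp add: powr_mult powr_powr)
    moreover have "r k powr (- (al / q)) * r k powr (al / q) = 1" using r(1)[of k] by (simp flip: powr_add)
    ultimately show ?thesis by (simp add: \<kappa>_def)
  qed
  also have "\<dots> \<le> b / 2 * measure N (\<Omega> \<inter> ball t0 (r k)) powr (1/q)"
    using measure_lower[OF t0 r(1,4)] b(1) cC q0 by (intro mult_left_mono powr_mono2) auto
  also have "\<dots> \<le> pnorm N q (\<lambda>t. T (f k) t - T (f i) t)"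
    by (rule pnorm_lower[OF q0(1) Lfun_diff[OF q0(2) TL TL] finite_N Om_borel _ low]) (use b in auto)
  also have "\<dots> = vdist (Lp N q) (\<sigma> k) (\<sigma> i)" unfolding \<sigma>_def by (simp add: vdist_Lp TL)
  also have "\<dots> < \<kappa>" using n0[of "max n0 n1" n0] by (simp add: k_def i_def)
  finally show False by simp
qed

text \<open>Three estimates meet: the strong bound on the line for (p, q), approximability above the
  line for (p, p), and the uniform bound for bounded functions.\<close>

lemma strictly_singular_on_line:
  assumes p: "1 < p" and q: "p < q" and line: "1/p - 1 + lam = al / q" and x0: "1 - al < p * (1 - lam)"
  shows "strictly_singular (Lp M p) (Lp N q) (ae_lift N T)"
proof -
  have q1: "q \<ge> 1" and p1: "p \<ge> 1" using p q by auto
  have pos: "0 < 1/p - 1 + lam" unfolding line using al p q by simp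
  have qe: "q = al / (1/p - 1 + lam)" unfolding line using al p q by simp
  have "(1 - al) / p < p * (1 - lam) / p" using x0 p by (intro divide_strict_right_mono) auto
  then have diag: "1/p - 1 + lam < al / p" using p by (simp add: diff_divide_distrib)
  obtain A where A: "\<And>f H t. f \<in> borel_measurable M \<Longrightarrow> (\<And>x. \<bar>f x\<bar> \<le> H) \<Longrightarrow> t \<in> \<Omega> \<Longrightarrow> \<bar>T f t\<bar> \<le> A * H"
    using T_bounded_sup by blast
  show ?thesis
  proof (rule strictly_singular_ae_lift[OF finite_unit_lebesgue finite_N p1 q])
    show "Lp_bounded M p N q T" by (rule T_bounded_line[OF p pos x0 qe q1])
    show "Lp_bounded M p N p T" by (rule T_bounded_above_line[OF p x0 p diag])
    show "fin_approx M p N p T" by (rule T_fin_approx[OF p x0 p diag])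
    show "AE t in N. \<bar>T f t\<bar> \<le> A * H" if "f \<in> borel_measurable M" "\<And>x. \<bar>f x\<bar> \<le> H" for f H
      using A[OF that] by (intro AE_I2) auto
  qed
qed

lemma V_set_T:
  "V_set M N (ae_lift N T) = {(x, (1 / al) * (x - 1 + lam)) | x. 1 - lam < x \<and> x < min 1 ((1 - lam) / (1 - al))}"
proof (intro set_eqI iffI)
  fix z assume z: "z \<in> V_set M N (ae_lift N T)"
  then obtain p q U where pq: "z = (1/p, 1/q)" "1 < p" "1 < q" 
    and U: "strictly_singular (Lp M p) (Lp N q) U" "\<forall>F\<in>Linfty M. U F = ae_lift N T F"
    unfolding V_set_def S_set_def by auto
  have bop: "bounded_operator (Lp M p) (Lp N q) U" using U(1) by (simp add: strictly_singular_def)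
  obtain K where K: "0 \<le> K" "\<And>f H. f \<in> borel_measurable M \<Longrightarrow> (\<And>x. \<bar>f x\<bar> \<le> H) \<Longrightarrow> pnorm N q (T f) \<le> K * pnorm M p f"
    using bounded_operator_extends_T[OF bop U(2)] pq by (auto intro: less_trans[OF zero_less_one])
  have x0: "1 - al < p * (1 - lam)" by (rule unbounded_small_exponent[OF pq(2,3) K])
  have le: "1/p - 1 + lam \<le> al / q" by (rule unbounded_below_line[OF pq(2,3) K])
  have line: "1/p - 1 + lam = al / q"
  proof (rule ccontr)
    assume "1/p - 1 + lam \<noteq> al / q"
    then have lt: "1/p - 1 + lam < al / q" using le by simp
    \<comment> \<open>The witness is \<open>ae_lift N T\<close> itself, whatever extension U came
      with z.\<close>
    have "compact_operator (Lp M p) (Lp N q) (ae_lift N T)"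
      using pq by (intro compact_operator_ae_lift T_bounded_above_line T_fin_approx x0 lt) auto
    then have "z \<in> K_set M N (ae_lift N T)" unfolding K_set_def using pq by blast
    then show False using z by (simp add: V_set_def)
  qed
  have "0 < al / q" using al pq by simp
  then have "1 - lam < 1/p" using line by linarith
  moreover have "1/p < (1 - lam) / (1 - al)" using x0 pq al by (simp add: field_simps)
  ultimately show "z \<in> {(x, (1 / al) * (x - 1 + lam)) | x. 1 - lam < x \<and> x < min 1 ((1 - lam) / (1 - al))}"
    using pq al line by (intro CollectI exI[of _ "1/p"]) auto
next
  fix z assume "z \<in> {(x, (1 / al) * (x - 1 + lam)) | x. 1 - lam < x \<and> x < min 1 ((1 - lam) / (1 - al))}"
  then obtain x where x: "z = (x, (1 / al) * (x - 1 + lam))" "1 - lam < x" "x < 1" "x < (1 - lam) / (1 - al)" by auto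
  have xpos: "0 < x" using x(2) lam by linarith
  define p q where "p = 1 / x" and "q = al / (x - 1 + lam)"
  have p: "1 < p" "1/p = x" using x xpos by (auto simp: p_def)
  have y: "0 < x - 1 + lam" using x by simp
  have lt: "x - 1 + lam < al * x" using x(4) al by (simp add: field_simps)
  have q: "p < q" "al / q = x - 1 + lam" using y xpos lt al by (auto simp: p_def q_def field_simps)
  have zpq: "z = (1/p, 1/q)" using p by (simp add: x(1) q_def)
  have line: "1/p - 1 + lam = al / q" using p q by simp
  have x0: "1 - al < p * (1 - lam)" using x(4) xpos al by (simp add: p_def field_simps)
  have "z \<in> S_set M N (ae_lift N T)"
    unfolding S_set_def using zpq p(1) q(1) strictly_singular_on_line[OF p(1) q(1) line x0] 
    by (intro CollectI exI[of _ p] exI[of _ q]) auto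
  moreover have "z \<notin> K_set M N (ae_lift N T)"
  proof
    assume "z \<in> K_set M N (ae_lift N T)"
    then obtain p' q' U where z': "z = (1/p', 1/q')" "1 < p'" "1 < q'" 
      and U: "compact_operator (Lp M p') (Lp N q') U" "\<forall>F\<in>Linfty M. U F = ae_lift N T F"
      unfolding K_set_def by auto
    \<comment> \<open>Membership in K may present z through exponents of its own; the coordinates
      still determine the line equation.\<close>
    have "1/p' = x" "1/q' = (x - 1 + lam) / al" using z'(1) x(1) by auto
    then have "al / q' = al * ((x - 1 + lam) / al)" by (simp flip: \<open>1/q' = _\<close>)
    then have "1/p' - 1 + lam = al / q'" using al \<open>1/p' = x\<close> by simp
    then show False using not_compact_on_line[OF z'(2,3) _ U(2)] U(1) by blast
  qed
  ultimately show "z \<in> V_set M N (ae_lift N T)" by (simp add: V_set_def)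
qed

end

theorem theorem10:
  fixes lam \<alpha> :: real and \<Omega> :: "real set"
  assumes "0 < lam" "lam < 1" "0 < \<alpha>" "\<alpha> < 1"
    and "\<Omega> \<subseteq> {0<..<1}"
    and "closedin (top_of_set {0<..<1}) \<Omega>"
    and "ahlfors_regular \<alpha> \<Omega>"
  shows "V_set (lebesgue_on {0<..<1}) (hausdorff_measure \<alpha> \<Omega>)
           (ae_lift (hausdorff_measure \<alpha> \<Omega>) (frac_integral lam))
         = {(x, (1 / \<alpha>) * (x - 1 + lam)) | x.
              1 - lam < x \<and> x < min 1 ((1 - lam) / (1 - \<alpha>))}"
proof -
  obtain F where F: "closed F" "\<Omega> = F \<inter> {0<..<1}"
    using assms(6) by (auto simp: closedin_closed)
  have borel: "\<Omega> \<in> sets borel" unfolding F(2) using F(1) by (intro sets.Int) auto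
  obtain c C where cC: "\<Omega> \<noteq> {}" "0 < c" "0 < C"
    "\<And>t r. 0 < r \<Longrightarrow> emeasure (hausdorff_measure \<alpha> \<Omega>) (\<Omega> \<inter> ball t r) \<le> ennreal (C * r powr \<alpha>)"
    "\<And>t r. t \<in> \<Omega> \<Longrightarrow> 0 < r \<Longrightarrow> r \<le> 1 \<Longrightarrow> ennreal (c * r powr \<alpha>) \<le> emeasure (hausdorff_measure \<alpha> \<Omega>) (\<Omega> \<inter> ball t r)"
    by (rule ahlfors_regular_bounds[OF assms(3,5) borel assms(7)]) blast
  interpret regular_measure "hausdorff_measure \<alpha> \<Omega>" \<Omega> \<alpha> c C lam
    by unfold_locales (use assms cC sets_hausdorff_measure in auto)
  show ?thesis by (rule V_set_T)
qed

end
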